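(* Let $\vec r=(r_1,\dots,r_d)\in\mathbb{R}^d$. The spectrum of $\Delta_{\mathbb{Z}^d}^{\vec r}$ on $\ell^2(\mathbb{Z}^d)$ is $$\sigma\big(\Delta_{\mathbb{Z}^d}^{\vec r}\big)=\Big\{\sum_{j=1}^d\lambda_j\ \Big|\ \lambda_j\in\sigma(\Delta_{\mathbb{Z}}^{r_j})\Big\}.$$ In particular, if $r_j>0$ for all $j$, then $\sigma(\Delta_{\mathbb{Z}^d}^{\vec r})=\big[0,\sum_{j=1}^d2^{2r_j}\big]$.
   Context: $\Delta_{\mathbb{Z}}=2\,\mathrm{id}-U-U^*$ on $\ell^2(\mathbb{Z})$, with $U$ the unit shift; under the discrete Fourier transform it is multiplication by $2-2\cos\theta$ on $L^2([-\pi,\pi])$. For $r\in\mathbb{R}$, $\Delta_{\mathbb{Z}}^r$ is defined by Borel functional calculus (multiplication by $(2-2\cos\theta)^r$ on its maximal domain). $\Delta_{\mathbb{Z}^d}^{\vec r}=\sum_{j=1}^d\mathrm{id}^{\otimes(j-1)}\otimes\Delta_{\mathbb{Z}}^{r_j}\otimes\mathrm{id}^{\otimes(d-j)}$ on $\ell^2(\mathbb{Z}^d)=\ell^2(\mathbb{Z})^{\otimes d}$, the self-adjoint operator which under Fourier transform is multiplication by $\sum_{j=1}^d(2-2\cos\theta_j)^{r_j}$ on $L^2([-\pi,\pi]^d)$. *)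

theory Defs
  imports "HOL-Analysis.Analysis"
begin

text \<open>
  The Hilbert space \<open>\<ell>\<^sup>2(I)\<close> is the set of square-summable functions on the index type.
  An unbounded operator on it is identified with its graph, a subset of
  \<open>\<ell>\<^sup>2(I) \<times> \<ell>\<^sup>2(I)\<close>; in particular the graph carries the domain.
\<close>

definition ell2 :: "('i \<Rightarrow> complex) set" where
  "ell2 = {f. (\<lambda>x. (cmod (f x))\<^sup>2) summable_on UNIV}"

definition ell2_norm :: "('i \<Rightarrow> complex) \<Rightarrow> real" where
  "ell2_norm f = sqrt (\<Sum>\<^sub>\<infinity>x. (cmod (f x))\<^sup>2)"

type_synonym 'i operator = "(('i \<Rightarrow> complex) \<times> ('i \<Rightarrow> complex)) set"

text \<open>
  \<open>z\<close> is in the resolvent set of \<open>T\<close> iff \<open>T - z\<close> is a bijection from the domain of \<open>T\<close>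
  onto \<open>\<ell>\<^sup>2(I)\<close> with bounded inverse. The domain is parametrised by the points
  \<open>(f, T f)\<close> of the graph.
\<close>

definition resolvent_set :: "'i operator \<Rightarrow> complex set" where
  "resolvent_set T =
     {z. bij_betw (\<lambda>(f, g). (\<lambda>x. g x - z * f x)) T ell2 \<and>
         (\<exists>C. \<forall>(f, g)\<in>T. ell2_norm f \<le> C * ell2_norm (\<lambda>x. g x - z * f x))}"

definition spectrum :: "'i operator \<Rightarrow> complex set" where
  "spectrum T = - resolvent_set T"

definition ell2_op_closure :: "'i operator \<Rightarrow> 'i operator" where
  "ell2_op_closure T =
     {(f, g). f \<in> ell2 \<and> g \<in> ell2 \<and>
        (\<forall>\<epsilon>>0. \<exists>(f', g')\<in>T. ell2_norm (\<lambda>x. f x - f' x) < \<epsilon> \<and> ell2_norm (\<lambda>x. g x - g' x) < \<epsilon>)}"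


subsection \<open>Fourier transform and powers of the Laplacian on \<open>\<int>\<close>\<close>

abbreviation circle_measure :: "real measure" where
  "circle_measure \<equiv> restrict_space lborel {-pi..pi}"

definition L2_circle :: "(real \<Rightarrow> complex) set" where
  "L2_circle = {g. g \<in> borel_measurable circle_measure \<and>
                   integrable circle_measure (\<lambda>\<theta>. (cmod (g \<theta>))\<^sup>2)}"

text \<open>
  This is the inverse of the unitary discrete Fourier transform
  \<open>\<ell>\<^sup>2(\<int>) \<rightarrow> L\<^sup>2([-\<pi>,\<pi>])\<close>, \<open>f \<mapsto> (2\<pi>)\<^bsup>-1/2\<^esup> \<Sum>\<^sub>n f(n) e\<^bsup>in\<theta>\<^esup>\<close>. Elements of \<open>L2_circle\<close> are
  functions rather than classes; the integral only depends on the class.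
\<close>

definition inv_fourier :: "(real \<Rightarrow> complex) \<Rightarrow> int \<Rightarrow> complex" where
  "inv_fourier g n =
     complex_of_real (1 / sqrt (2 * pi)) *
     (\<integral>\<theta>. g \<theta> * cis (- (real_of_int n * \<theta>)) \<partial>circle_measure)"

text \<open>
  The operator on \<open>\<ell>\<^sup>2(\<int>)\<close> that the Fourier transform turns into multiplication by \<open>m\<close>
  on its maximal domain \<open>{g \<in> L\<^sup>2. m g \<in> L\<^sup>2}\<close>.
\<close>

definition fourier_multiplier :: "(real \<Rightarrow> real) \<Rightarrow> int operator" where
  "fourier_multiplier m =
     {(inv_fourier g, inv_fourier (\<lambda>\<theta>. complex_of_real (m \<theta>) * g \<theta>)) | g.
        g \<in> L2_circle \<and> (\<lambda>\<theta>. complex_of_real (m \<theta>) * g \<theta>) \<in> L2_circle}"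

text \<open>
  \<open>\<Delta> = 2 id - U - U\<^sup>*\<close> with \<open>(U f)(n) = f(n - 1)\<close>. Under the Fourier transform it is
  multiplication by \<open>2 - 2 cos \<theta>\<close>, see \<open>inv_fourier_laplacian_symbol\<close> below.
\<close>

definition unit_shift :: "(int \<Rightarrow> complex) \<Rightarrow> int \<Rightarrow> complex" where
  "unit_shift f n = f (n - 1)"

definition unit_shift_adj :: "(int \<Rightarrow> complex) \<Rightarrow> int \<Rightarrow> complex" where
  "unit_shift_adj f n = f (n + 1)"

definition laplacian_Z :: "(int \<Rightarrow> complex) \<Rightarrow> int \<Rightarrow> complex" where
  "laplacian_Z f n = 2 * f n - unit_shift f n - unit_shift_adj f n"

definition laplacian_symbol :: "real \<Rightarrow> real" where
  "laplacian_symbol \<theta> = 2 - 2 * cos \<theta>"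

text \<open>
  At \<open>\<theta> = 0\<close> the symbol vanishes and \<open>0 powr r = 0\<close> for every \<open>r\<close> (also for \<open>r \<le> 0\<close>);
  this is a null set, so the operator does not depend on this value.
\<close>

definition laplacian_Z_pow :: "real \<Rightarrow> int operator" where
  "laplacian_Z_pow r = fourier_multiplier (\<lambda>\<theta>. laplacian_symbol \<theta> powr r)"

lemma L2_circle_integrable:
  assumes "g \<in> L2_circle"
  shows "integrable circle_measure g"
proof -
  have fin: "finite_measure circle_measure"
    by (intro finite_measureI) (simp add: emeasure_restrict_space)
  interpret finite_measure circle_measure by (rule fin)
  have [measurable]: "g \<in> borel_measurable circle_measure"
    and sq: "integrable circle_measure (\<lambda>\<theta>. (cmod (g \<theta>))\<^sup>2)"
    using assms by (auto simp: L2_circle_def)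
  have "integrable circle_measure (\<lambda>\<theta>. 1 + (cmod (g \<theta>))\<^sup>2)"
    using sq by simp
  then show ?thesis
  proof (rule Bochner_Integration.integrable_bound)
    have "cmod z \<le> 1 + (cmod z)\<^sup>2" for z
      using sum_power2_ge_zero[of "cmod z - 1/2" 0]
      by (simp add: power2_diff power2_eq_square algebra_simps)
    then show "AE \<theta> in circle_measure. norm (g \<theta>) \<le> norm (1 + (cmod (g \<theta>))\<^sup>2)"
      by (auto intro!: AE_I2 order_trans[OF _ abs_ge_self])
  qed simp
qed

lemma inv_fourier_laplacian_symbol:
  assumes "g \<in> L2_circle"
  shows "inv_fourier (\<lambda>\<theta>. complex_of_real (laplacian_symbol \<theta>) * g \<theta>) = laplacian_Z (inv_fourier g)"
proof
  fix n
  have [measurable]: "g \<in> borel_measurable circle_measure"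
    using assms by (auto simp: L2_circle_def)
  define e where "e k \<theta> = cis (- (real_of_int k * \<theta>))" for k \<theta>
  have "continuous_on UNIV (e k)" for k
    unfolding e_def by (intro continuous_intros)
  then have "e k \<in> borel_measurable lborel" for k
    by (simp add: borel_measurable_continuous_onI)
  then have [measurable]: "e k \<in> borel_measurable circle_measure" for k
    by (rule measurable_restrict_space1)
  have int: "integrable circle_measure (\<lambda>\<theta>. g \<theta> * e k \<theta>)" for k
    by (rule Bochner_Integration.integrable_bound[OF L2_circle_integrable[OF assms]])
       (measurable, simp add: norm_mult e_def)
  have "complex_of_real (laplacian_symbol \<theta>) * g \<theta> * e n \<theta>
      = 2 * (g \<theta> * e n \<theta>) - g \<theta> * e (n - 1) \<theta> - g \<theta> * e (n + 1) \<theta>" for \<theta>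
  proof -
    have "e (n - 1) \<theta> = e n \<theta> * cis \<theta>" "e (n + 1) \<theta> = e n \<theta> * cis (- \<theta>)"
      by (simp_all add: e_def cis_mult algebra_simps)
    moreover have "complex_of_real (laplacian_symbol \<theta>) = 2 - cis \<theta> - cis (- \<theta>)"
      by (simp add: laplacian_symbol_def complex_eq_iff)
    ultimately show ?thesis by (simp only: ring_distribs left_diff_distrib right_diff_distrib ac_simps)
  qed
  then have "(\<integral>\<theta>. complex_of_real (laplacian_symbol \<theta>) * g \<theta> * e n \<theta> \<partial>circle_measure)
      = 2 * (\<integral>\<theta>. g \<theta> * e n \<theta> \<partial>circle_measure)
        - (\<integral>\<theta>. g \<theta> * e (n - 1) \<theta> \<partial>circle_measure)
        - (\<integral>\<theta>. g \<theta> * e (n + 1) \<theta> \<partial>circle_measure)"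
    using int by simp
  then show "inv_fourier (\<lambda>\<theta>. complex_of_real (laplacian_symbol \<theta>) * g \<theta>) n
      = laplacian_Z (inv_fourier g) n"
    unfolding inv_fourier_def laplacian_Z_def unit_shift_def unit_shift_adj_def e_def
    by (simp only: right_diff_distrib mult.left_commute)
qed


subsection \<open>The operator on \<open>\<int>\<^sup>d\<close>\<close>

text \<open>
  Under \<open>\<ell>\<^sup>2(\<int>\<^sup>d) = \<ell>\<^sup>2(\<int>)\<^bsup>\<otimes>d\<^esup>\<close> the pure tensor \<open>f\<^sub>1 \<otimes> \<dots> \<otimes> f\<^sub>d\<close> is
  \<open>x \<mapsto> f\<^sub>1(x\<^sub>1) \<cdots> f\<^sub>d(x\<^sub>d)\<close>.
\<close>

definition pure_tensor :: "('n::finite \<Rightarrow> int \<Rightarrow> complex) \<Rightarrow> int ^ 'n \<Rightarrow> complex" where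
  "pure_tensor F x = (\<Prod>j\<in>UNIV. F j (x $ j))"

text \<open>
  \<open>\<Sum>\<^sub>j id \<otimes> \<dots> \<otimes> A\<^sub>j \<otimes> \<dots> \<otimes> id\<close> on the algebraic tensor product of the domains of the
  \<open>A\<^sub>j\<close>, i.e. on finite sums of pure tensors \<open>f\<^sub>1 \<otimes> \<dots> \<otimes> f\<^sub>d\<close> with \<open>f\<^sub>j\<close> in the domain
  of \<open>A\<^sub>j\<close>. Here \<open>F k j\<close> is the \<open>j\<close>-th factor of the \<open>k\<close>-th summand and
  \<open>G k j\<close> is its image under \<open>A\<^sub>j\<close>.
\<close>

definition alg_tensor_sum :: "('n::finite \<Rightarrow> int operator) \<Rightarrow> (int ^ 'n) operator" where
  "alg_tensor_sum A =
     {((\<lambda>x. \<Sum>k<N. pure_tensor (F k) x),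
       (\<lambda>x. \<Sum>k<N. \<Sum>j\<in>UNIV. pure_tensor ((F k)(j := G k j)) x)) | N F G.
      \<forall>k<N::nat. \<forall>j. (F k j, G k j) \<in> A j}"

text \<open>
  As usual for tensor products of unbounded operators, the self-adjoint operator on the
  completed tensor product is the closure.
\<close>

definition laplacian_Zd_pow :: "real ^ 'n \<Rightarrow> (int ^ 'n::finite) operator" where
  "laplacian_Zd_pow r = ell2_op_closure (alg_tensor_sum (\<lambda>j. laplacian_Z_pow (r $ j)))"

end

theory Submission
  imports Defs
begin

text \<open>
  In dimension one the spectrum of a Fourier multiplier is the essential range of its symbol,
  because the Fourier transform is unitary (Riesz-Fischer and Parseval). In dimension \<open>d\<close> the
  Fourier transform of \<open>\<ell>\<^sup>2(\<int>\<^sup>d)\<close> is only needed on finite sums of pure tensors, where it is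
  isometric since inner products of tensors factorise; there the operator is multiplication by
  \<open>s(\<theta>) = \<Sum>\<^sub>j m\<^sub>j(\<theta>\<^sub>j)\<close>.

  If \<open>z\<close> has distance \<open>\<delta> > 0\<close> to the sum of the spectra, then \<open>\<bar>s - z\<bar> \<ge> \<delta>\<close> bounds the operator
  minus \<open>z\<close> from below, and its range is dense: after cutting off where some \<open>\<bar>m\<^sub>j\<bar>\<close> is large, a
  Fourier basis function \<open>e\<close> is approximated by \<open>(s - z) P(s) e\<close> for one-variable polynomials \<open>P\<close>
  close to \<open>1 / (t - z)\<close>. Hence \<open>z\<close> is in the resolvent set of the closure. Conversely, tensor
  products of approximate eigenvectors for \<open>\<lambda>\<^sub>j\<close> are approximate eigenvectors for \<open>\<Sum>\<^sub>j \<lambda>\<^sub>j\<close>.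
\<close>


section \<open>Square-integrable functions\<close>

text \<open>The function 1 / (s - z) is in general no finite sum of products of one-variable
  functions, so (T - z) u = h cannot be solved by division inside the algebraic tensor product. A
  polynomial in s applied to a tensor does expand into finitely many tensors, hence the detour
  through Stone-Weierstrass. It requires s to stay in a compact set and repeated products with
  \<open>m j\<close> to stay square integrable; for negative exponents both can fail, and the cutoff
  provides both.

  The resolvent estimates use pointwise lower bounds on the modulus of s - z. So every value of s
  has to lie in the sum of the spectra, and that sum has to be closed for the distance \<delta> to
  be positive. A sum of closed subsets of the line need not be closed; here it is, because all
  one-dimensional spectra consist of nonnegative numbers. The point z may be any complex number, so
  nonreal points are covered by the same estimate, without an appeal to self-adjointness.\<close>

definition L2 :: "'a measure \<Rightarrow> ('a \<Rightarrow> complex) set" where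
  "L2 M = {f \<in> borel_measurable M. integrable M (\<lambda>x. (cmod (f x))\<^sup>2)}"

definition L2_norm :: "'a measure \<Rightarrow> ('a \<Rightarrow> complex) \<Rightarrow> real" where
  "L2_norm M f = sqrt (\<integral>x. (cmod (f x))\<^sup>2 \<partial>M)"

definition L2_inner :: "'a measure \<Rightarrow> ('a \<Rightarrow> complex) \<Rightarrow> ('a \<Rightarrow> complex) \<Rightarrow> complex" where
  "L2_inner M f g = (\<integral>x. f x * cnj (g x) \<partial>M)"

lemma L2_measurable [measurable_dest]: "f \<in> L2 M \<Longrightarrow> f \<in> borel_measurable M"
  by (simp add: L2_def)

lemma L2_integrable_square: "f \<in> L2 M \<Longrightarrow> integrable M (\<lambda>x. (cmod (f x))\<^sup>2)"
  by (simp add: L2_def)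

lemma cnj_borel_measurable [measurable (raw)]:
  "f \<in> borel_measurable M \<Longrightarrow> (\<lambda>x. cnj (f x)) \<in> borel_measurable M"
  by (rule borel_measurable_continuous_on[where f=cnj]) (intro continuous_intros)

lemma L2_integrable_inner:
  assumes f: "f \<in> L2 M" and g: "g \<in> L2 M"
  shows "integrable M (\<lambda>x. f x * cnj (g x))"
proof (rule Bochner_Integration.integrable_bound)
  show "integrable M (\<lambda>x. (cmod (f x))\<^sup>2 + (cmod (g x))\<^sup>2)"
    using f g by (intro Bochner_Integration.integrable_add L2_integrable_square)
  show "(\<lambda>x. f x * cnj (g x)) \<in> borel_measurable M"
    using f g by measurable
  have "cmod a * cmod b \<le> (cmod a)\<^sup>2 + (cmod b)\<^sup>2" for a b
    using sum_squares_bound[of "cmod a" "cmod b"] mult_nonneg_nonneg[OF norm_ge_zero norm_ge_zero, of a b]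
    by (simp only: mult.assoc)
  then show "AE x in M. norm (f x * cnj (g x)) \<le> norm ((cmod (f x))\<^sup>2 + (cmod (g x))\<^sup>2)"
    by (simp add: norm_mult)
qed

lemma L2_bounded:
  assumes "g \<in> L2 M" "f \<in> borel_measurable M" "AE x in M. cmod (f x) \<le> C * cmod (g x)"
  shows "f \<in> L2 M"
proof -
  have "integrable M (\<lambda>x. (cmod (f x))\<^sup>2)"
  proof (rule Bochner_Integration.integrable_bound)
    show "integrable M (\<lambda>x. C\<^sup>2 * (cmod (g x))\<^sup>2)"
      using assms(1) by (intro integrable_mult_right L2_integrable_square)
    show "AE x in M. norm ((cmod (f x))\<^sup>2) \<le> norm (C\<^sup>2 * (cmod (g x))\<^sup>2)"
      using assms(3) by eventually_elim (simp add: norm_power power_mono flip: power_mult_distrib)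
  qed (use assms(2) in measurable)
  then show ?thesis using assms(2) by (simp add: L2_def)
qed

lemma L2_scale: "f \<in> L2 M \<Longrightarrow> (\<lambda>x. c * f x) \<in> L2 M"
  by (rule L2_bounded[where g=f and C="cmod c"]) (auto simp: norm_mult)

lemma L2_add:
  assumes "f \<in> L2 M" "g \<in> L2 M"
  shows "(\<lambda>x. f x + g x) \<in> L2 M"
proof -
  have "integrable M (\<lambda>x. (cmod (f x + g x))\<^sup>2)"
  proof (rule Bochner_Integration.integrable_bound)
    show "integrable M (\<lambda>x. 2 * (cmod (f x))\<^sup>2 + 2 * (cmod (g x))\<^sup>2)"
      using assms by (intro Bochner_Integration.integrable_add integrable_mult_right L2_integrable_square)
    have "(cmod (a + b))\<^sup>2 \<le> 2 * (cmod a)\<^sup>2 + 2 * (cmod b)\<^sup>2" for a b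
    proof -
      have "(cmod (a + b))\<^sup>2 \<le> (cmod a + cmod b)\<^sup>2"
        by (intro power_mono norm_triangle_ineq) simp
      also have "\<dots> \<le> 2 * (cmod a)\<^sup>2 + 2 * (cmod b)\<^sup>2"
        using sum_squares_bound[of "cmod a" "cmod b"] by (simp add: power2_sum)
      finally show ?thesis .
    qed
    then show "AE x in M. norm ((cmod (f x + g x))\<^sup>2) \<le> norm (2 * (cmod (f x))\<^sup>2 + 2 * (cmod (g x))\<^sup>2)"
      by simp
  qed (use assms in measurable)
  then show ?thesis using assms by (auto simp: L2_def)
qed

lemma L2_diff: "f \<in> L2 M \<Longrightarrow> g \<in> L2 M \<Longrightarrow> (\<lambda>x. f x - g x) \<in> L2 M"
  using L2_add[of f M "\<lambda>x. (- 1) * g x"] L2_scale[of g M "- 1"] by simp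

lemma L2_zero: "(\<lambda>x. 0) \<in> L2 M"
  by (simp add: L2_def)

lemma L2_sum: "(\<And>i. i \<in> I \<Longrightarrow> f i \<in> L2 M) \<Longrightarrow> (\<lambda>x. \<Sum>i\<in>I. f i x) \<in> L2 M"
  by (induction I rule: infinite_finite_induct) (auto simp: L2_zero intro: L2_add)

lemma L2_norm_nonneg [simp]: "0 \<le> L2_norm M f"
  by (simp add: L2_norm_def)

lemma L2_norm_square: "(L2_norm M f)\<^sup>2 = (\<integral>x. (cmod (f x))\<^sup>2 \<partial>M)"
  by (simp add: L2_norm_def)

lemma nn_integral_L2:
  "f \<in> L2 M \<Longrightarrow> (\<integral>\<^sup>+x. (ennreal (cmod (f x)))\<^sup>2 \<partial>M) = ennreal ((L2_norm M f)\<^sup>2)"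
  by (simp add: L2_norm_square ennreal_power nn_integral_eq_integral L2_integrable_square)

lemma L2_norm_scale: "L2_norm M (\<lambda>x. c * f x) = cmod c * L2_norm M f"
  by (simp add: L2_norm_def norm_mult power_mult_distrib real_sqrt_mult)

lemma L2_norm_zero [simp]: "L2_norm M (\<lambda>x. 0) = 0"
  by (simp add: L2_norm_def)

lemma L2_norm_minus: "L2_norm M (\<lambda>x. - f x) = L2_norm M f"
  by (simp add: L2_norm_def)

lemma L2_norm_minus_commute: "L2_norm M (\<lambda>x. f x - g x) = L2_norm M (\<lambda>x. g x - f x)"
  by (simp add: L2_norm_def norm_minus_commute)

lemma L2_norm_mono:
  assumes "g \<in> L2 M" "f \<in> borel_measurable M" "0 \<le> C" "AE x in M. cmod (f x) \<le> C * cmod (g x)"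
  shows "L2_norm M f \<le> C * L2_norm M g"
proof -
  have "f \<in> L2 M" by (rule L2_bounded[OF assms(1,2,4)])
  have "(\<integral>x. (cmod (f x))\<^sup>2 \<partial>M) \<le> (\<integral>x. C\<^sup>2 * (cmod (g x))\<^sup>2 \<partial>M)"
  proof (rule integral_mono_AE)
    show "AE x in M. (cmod (f x))\<^sup>2 \<le> C\<^sup>2 * (cmod (g x))\<^sup>2"
      using assms(4) by eventually_elim (simp add: power_mono flip: power_mult_distrib)
  qed (use assms \<open>f \<in> L2 M\<close> in \<open>auto intro: L2_integrable_square\<close>)
  then have "(L2_norm M f)\<^sup>2 \<le> (C * L2_norm M g)\<^sup>2"
    by (simp add: L2_norm_square power_mult_distrib)
  then show ?thesis
    by (rule power2_le_imp_le) (simp add: assms)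
qed

lemma L2_norm_eq_zeroD:
  assumes "f \<in> L2 M" "L2_norm M f = 0"
  shows "AE x in M. f x = 0"
proof -
  have "(\<integral>x. (cmod (f x))\<^sup>2 \<partial>M) = 0"
    using assms(2) by (simp add: L2_norm_def)
  then show ?thesis
    using integral_nonneg_eq_0_iff_AE[OF L2_integrable_square[OF assms(1)]] by simp
qed

lemma L2_inner_self: "L2_inner M f f = of_real ((L2_norm M f)\<^sup>2)"
  by (simp add: L2_inner_def L2_norm_square complex_mult_cnj cmod_power2 flip: integral_complex_of_real)

text \<open>Taking absolute values reduces this to the Cauchy-Schwarz inequality for nonnegative
  integrals, \<open>I\<close> being the integral of the product of the moduli.\<close>

lemma L2_inner_Cauchy_Schwarz:
  assumes "f \<in> L2 M" "g \<in> L2 M"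
  shows "cmod (L2_inner M f g) \<le> L2_norm M f * L2_norm M g"
proof -
  have [measurable]: "f \<in> borel_measurable M" "g \<in> borel_measurable M"
    using assms by measurable
  have int: "integrable M (\<lambda>x. cmod (f x) * cmod (g x))"
    using integrable_norm[OF L2_integrable_inner[OF assms]] by (simp add: norm_mult)
  define I where "I = (\<integral>x. cmod (f x) * cmod (g x) \<partial>M)"
  have "(ennreal I)\<^sup>2 = (\<integral>\<^sup>+x. ennreal (cmod (f x)) * ennreal (cmod (g x)) \<partial>M)\<^sup>2"
    unfolding I_def by (simp add: nn_integral_eq_integral[OF int] flip: ennreal_mult)
  also have "\<dots> \<le> (\<integral>\<^sup>+x. (ennreal (cmod (f x)))\<^sup>2 \<partial>M) * (\<integral>\<^sup>+x. (ennreal (cmod (g x)))\<^sup>2 \<partial>M)"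
    by (rule Cauchy_Schwarz_nn_integral) simp_all
  also have "\<dots> = ennreal ((L2_norm M f * L2_norm M g)\<^sup>2)"
    by (simp add: nn_integral_L2 assms power_mult_distrib ennreal_mult)
  finally have "I\<^sup>2 \<le> (L2_norm M f * L2_norm M g)\<^sup>2"
    by (simp add: I_def ennreal_power)
  then have "I \<le> L2_norm M f * L2_norm M g"
    by (rule power2_le_imp_le) simp
  moreover have "cmod (L2_inner M f g) \<le> I"
    unfolding L2_inner_def I_def using integral_norm_bound[of M "\<lambda>x. f x * cnj (g x)"]
    by (simp add: norm_mult)
  ultimately show ?thesis by simp
qed

lemma L2_inner_add_left:
  "f \<in> L2 M \<Longrightarrow> g \<in> L2 M \<Longrightarrow> h \<in> L2 M \<Longrightarrow>
    L2_inner M (\<lambda>x. f x + g x) h = L2_inner M f h + L2_inner M g h"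
  by (simp add: L2_inner_def distrib_right L2_integrable_inner)

lemma L2_inner_diff_left:
  "f \<in> L2 M \<Longrightarrow> g \<in> L2 M \<Longrightarrow> h \<in> L2 M \<Longrightarrow>
    L2_inner M (\<lambda>x. f x - g x) h = L2_inner M f h - L2_inner M g h"
  by (simp add: L2_inner_def left_diff_distrib L2_integrable_inner)

lemma L2_inner_scale_left: "L2_inner M (\<lambda>x. c * f x) g = c * L2_inner M f g"
  by (simp add: L2_inner_def mult.assoc)

lemma L2_inner_commute: "L2_inner M f g = cnj (L2_inner M g f)"
  by (simp add: L2_inner_def mult.commute flip: Bochner_Integration.integral_cnj)

lemma L2_inner_sum_left:
  assumes "\<And>i. i \<in> I \<Longrightarrow> f i \<in> L2 M" "h \<in> L2 M"
  shows "L2_inner M (\<lambda>x. \<Sum>i\<in>I. f i x) h = (\<Sum>i\<in>I. L2_inner M (f i) h)"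
  using assms by (simp add: L2_inner_def sum_distrib_right L2_integrable_inner)

text \<open>The triangle inequality, Bessel's inequality and the polarisation argument for inner
  products are all read off from this expansion.\<close>

lemma L2_norm_add_square:
  assumes "f \<in> L2 M" "g \<in> L2 M"
  shows "(L2_norm M (\<lambda>x. f x + g x))\<^sup>2 = (L2_norm M f)\<^sup>2 + (L2_norm M g)\<^sup>2 + 2 * Re (L2_inner M f g)"
proof -
  have "(cmod (f x + g x))\<^sup>2 = (cmod (f x))\<^sup>2 + (cmod (g x))\<^sup>2 + 2 * Re (f x * cnj (g x))" for x
    unfolding cmod_power2 by (simp add: power2_eq_square algebra_simps)
  moreover have "integrable M (\<lambda>x. Re (f x * cnj (g x)))"
    by (rule integrable_Re[OF L2_integrable_inner[OF assms]])
  ultimately show ?thesis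
    using assms L2_integrable_inner[OF assms]
    by (simp add: L2_norm_square L2_inner_def L2_integrable_square del: times_complex.sel)
qed

lemma L2_norm_triangle:
  assumes "f \<in> L2 M" "g \<in> L2 M"
  shows "L2_norm M (\<lambda>x. f x + g x) \<le> L2_norm M f + L2_norm M g"
proof -
  have "Re (L2_inner M f g) \<le> L2_norm M f * L2_norm M g"
    using L2_inner_Cauchy_Schwarz[OF assms] complex_Re_le_cmod order_trans by blast
  then have "(L2_norm M (\<lambda>x. f x + g x))\<^sup>2 \<le> (L2_norm M f + L2_norm M g)\<^sup>2"
    unfolding L2_norm_add_square[OF assms] by (simp add: power2_sum)
  then show ?thesis by (rule power2_le_imp_le) simp
qed

lemma L2_norm_triangle_diff:
  assumes "f \<in> L2 M" "g \<in> L2 M" "h \<in> L2 M"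
  shows "L2_norm M (\<lambda>x. f x - h x) \<le> L2_norm M (\<lambda>x. f x - g x) + L2_norm M (\<lambda>x. g x - h x)"
  using L2_norm_triangle[OF L2_diff[OF assms(1,2)] L2_diff[OF assms(2,3)]] by simp

lemma L2_norm_diff_le:
  assumes "f \<in> L2 M" "g \<in> L2 M"
  shows "\<bar>L2_norm M f - L2_norm M g\<bar> \<le> L2_norm M (\<lambda>x. f x - g x)"
  using L2_norm_triangle[OF L2_diff[OF assms] assms(2)]
    L2_norm_triangle[OF L2_diff[OF assms(2,1)] assms(1)]
  by (simp add: L2_norm_minus_commute[of M f])

lemma L2_norm_tendsto:
  assumes "\<And>n. f n \<in> L2 M" "g \<in> L2 M" "(\<lambda>n. L2_norm M (\<lambda>x. f n x - g x)) \<longlonglongrightarrow> 0"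
  shows "(\<lambda>n. L2_norm M (f n)) \<longlonglongrightarrow> L2_norm M g"
proof -
  have "(\<lambda>n. L2_norm M (f n) - L2_norm M g) \<longlonglongrightarrow> 0"
    by (rule Lim_null_comparison[OF _ assms(3)]) (simp add: L2_norm_diff_le assms)
  then show ?thesis by (simp add: LIM_zero_iff)
qed

lemma L2_inner_tendsto:
  assumes "\<And>n. f n \<in> L2 M" "g \<in> L2 M" "h \<in> L2 M" "(\<lambda>n. L2_norm M (\<lambda>x. f n x - g x)) \<longlonglongrightarrow> 0"
  shows "(\<lambda>n. L2_inner M (f n) h) \<longlonglongrightarrow> L2_inner M g h"
proof -
  have "(\<lambda>n. L2_norm M (\<lambda>x. f n x - g x) * L2_norm M h) \<longlonglongrightarrow> 0"
    using assms(4) tendsto_mult_left_zero by blast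
  then have "(\<lambda>n. L2_inner M (f n) h - L2_inner M g h) \<longlonglongrightarrow> 0"
    by (rule Lim_null_comparison[rotated])
      (simp add: L2_inner_Cauchy_Schwarz L2_diff assms flip: L2_inner_diff_left)
  then show ?thesis by (simp add: LIM_zero_iff)
qed

text \<open>A subsequence whose consecutive distances decay geometrically converges almost
  everywhere. Fatou's lemma then turns the Cauchy estimate into an estimate of the distance to the
  pointwise limit, for the whole sequence.\<close>

theorem L2_complete:
  fixes f :: "nat \<Rightarrow> 'a \<Rightarrow> complex"
  assumes f: "\<And>n. f n \<in> L2 M"
    and Cauchy: "\<And>\<epsilon>. 0 < \<epsilon> \<Longrightarrow> \<exists>N. \<forall>m\<ge>N. \<forall>n\<ge>N. L2_norm M (\<lambda>x. f m x - f n x) < \<epsilon>"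
  obtains g where "g \<in> L2 M" "(\<lambda>n. L2_norm M (\<lambda>x. f n x - g x)) \<longlonglongrightarrow> 0"
proof -
  have [measurable]: "f n \<in> borel_measurable M" for n
    using f by measurable
  have "\<forall>k::nat. \<exists>N. \<forall>m\<ge>N. \<forall>n\<ge>N. L2_norm M (\<lambda>x. f m x - f n x) < (1/2) ^ k"
    using Cauchy by simp
  then obtain N where N: "\<And>k m n. m \<ge> N k \<Longrightarrow> n \<ge> N k \<Longrightarrow> L2_norm M (\<lambda>x. f m x - f n x) < (1/2) ^ k"
    by (auto dest!: choice)
  \<comment> \<open>Partial sums of the thresholds give indices that are monotone in k and still
    satisfy \<open>N k \<le> s k\<close>.\<close>
  define s where "s k = (\<Sum>i\<le>k. N i)" for k
  have sN: "N k \<le> s k" for k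
    unfolding s_def by (rule member_le_sum) auto
  have s_mono: "s k \<le> s l" if "k \<le> l" for k l
    unfolding s_def using that by (intro sum_mono2) auto
  define h where "h k x = f (s (Suc k)) x - f (s k) x" for k x
  have [measurable]: "h k \<in> borel_measurable M" for k
    unfolding h_def by measurable
  have hL2: "h k \<in> L2 M" for k
    unfolding h_def by (intro L2_diff f)
  have hn: "L2_norm M (h k) \<le> (1/2) ^ k" for k
    unfolding h_def using N[of k "s (Suc k)" "s k"] sN[of k] s_mono[of k "Suc k"] by simp
  \<comment> \<open>The weights \<open>2 ^ k\<close> make \<open>h k x\<close> geometrically small for almost every \<open>x\<close>, without Minkowski's
    inequality for infinite sums.\<close>
  have "(\<integral>\<^sup>+x. (\<Sum>k. ennreal (2 ^ k * (cmod (h k x))\<^sup>2)) \<partial>M)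
      = (\<Sum>k. \<integral>\<^sup>+x. ennreal (2 ^ k * (cmod (h k x))\<^sup>2) \<partial>M)"
    by (rule nn_integral_suminf) simp
  also have "\<dots> \<le> (\<Sum>k. ennreal ((1/2) ^ k))"
  proof (intro suminf_le summableI)
    fix k
    have "(\<integral>\<^sup>+x. ennreal (2 ^ k * (cmod (h k x))\<^sup>2) \<partial>M) = ennreal (2 ^ k * (L2_norm M (h k))\<^sup>2)"
      unfolding L2_norm_square
      by (subst nn_integral_eq_integral) (auto intro!: L2_integrable_square hL2)
    also have "2 ^ k * (L2_norm M (h k))\<^sup>2 \<le> 2 ^ k * ((1/2) ^ k)\<^sup>2"
      by (intro mult_left_mono power_mono hn) auto
    also have "2 ^ k * ((1/2) ^ k)\<^sup>2 = ((1/2) ^ k :: real)"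
      by (simp add: power2_eq_square power_divide)
    finally show "(\<integral>\<^sup>+x. ennreal (2 ^ k * (cmod (h k x))\<^sup>2) \<partial>M) \<le> ennreal ((1/2) ^ k)"
      by (simp add: ennreal_leI)
  qed
  also have "\<dots> = ennreal (\<Sum>k. (1/2) ^ k)"
    by (rule suminf_ennreal2) (auto intro: summable_geometric)
  finally have "(\<integral>\<^sup>+x. (\<Sum>k. ennreal (2 ^ k * (cmod (h k x))\<^sup>2)) \<partial>M) \<noteq> \<infinity>"
    by (auto simp: top_unique)
  then have "AE x in M. (\<Sum>k. ennreal (2 ^ k * (cmod (h k x))\<^sup>2)) \<noteq> \<infinity>"
    by (intro nn_integral_PInf_AE) auto
  then have conv: "AE x in M. convergent (\<lambda>k. f (s k) x)"
  proof eventually_elim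
    case (elim x)
    have sm: "summable (\<lambda>k. 2 ^ k * (cmod (h k x))\<^sup>2)"
      using elim by (intro summable_suminf_not_top) auto
    have "Bseq (\<lambda>k. 2 ^ k * (cmod (h k x))\<^sup>2)"
      by (intro convergent_imp_Bseq convergentI[OF summable_LIMSEQ_zero[OF sm]])
    then obtain B where "\<forall>k. norm (2 ^ k * (cmod (h k x))\<^sup>2) \<le> B"
      by (rule BseqE)
    then have B: "2 ^ k * (cmod (h k x))\<^sup>2 \<le> B" for k
      by (simp add: abs_le_iff)
    have "cmod (h k x) \<le> sqrt B * sqrt (1/2) ^ k" for k
    proof -
      have "(cmod (h k x))\<^sup>2 \<le> B * (1/2) ^ k"
        using B[of k] by (simp add: power_divide field_simps)
      then have "cmod (h k x) \<le> sqrt (B * (1/2) ^ k)"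
        by (rule real_le_rsqrt)
      then show ?thesis by (simp only: real_sqrt_mult real_sqrt_power)
    qed
    moreover have "summable (\<lambda>k. sqrt B * sqrt (1/2) ^ k)"
      by (intro summable_mult summable_geometric) (simp add: real_sqrt_divide)
    ultimately have "summable (\<lambda>k. h k x)"
      by (rule summable_comparison_test'[where N=0, rotated])
    then have "convergent (\<lambda>n. \<Sum>k<n. h k x)"
      by (simp add: summable_iff_convergent)
    moreover have "(\<Sum>k<n. h k x) = f (s n) x - f (s 0) x" for n
      unfolding h_def by (rule sum_lessThan_telescope)
    ultimately have "convergent (\<lambda>n. f (s n) x - f (s 0) x)"
      by simp
    from convergent_add[OF this convergent_const[of "f (s 0) x"]]
    show ?case by simp
  qed
  define g where "g x = lim (\<lambda>k. f (s k) x)" for x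
  have [measurable]: "g \<in> borel_measurable M"
    unfolding g_def by measurable
  have lim: "AE x in M. (\<lambda>k. f (s k) x) \<longlonglongrightarrow> g x"
    using conv by eventually_elim (simp add: g_def convergent_LIMSEQ_iff)
  \<comment> \<open>Fatou's lemma along the subsequence: for \<open>l \<ge> k\<close> both m and
    \<open>s l\<close> are at least \<open>N k\<close>, so the integrals inside the lower limit have
    a common bound.\<close>
  have bound: "(\<integral>\<^sup>+x. ennreal ((cmod (f m x - g x))\<^sup>2) \<partial>M) \<le> ennreal (((1/2) ^ k)\<^sup>2)" if m: "m \<ge> N k" for m k
  proof -
    have "(\<integral>\<^sup>+x. ennreal ((cmod (f m x - g x))\<^sup>2) \<partial>M)
        = (\<integral>\<^sup>+x. liminf (\<lambda>l. ennreal ((cmod (f m x - f (s l) x))\<^sup>2)) \<partial>M)"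
    proof (rule nn_integral_cong_AE, use lim in eventually_elim)
      case (elim x)
      then have "(\<lambda>l. ennreal ((cmod (f m x - f (s l) x))\<^sup>2)) \<longlonglongrightarrow> ennreal ((cmod (f m x - g x))\<^sup>2)"
        by (intro tendsto_ennrealI tendsto_intros)
      then show ?case by (rule lim_imp_Liminf[symmetric, rotated]) simp
    qed
    also have "\<dots> \<le> liminf (\<lambda>l. \<integral>\<^sup>+x. ennreal ((cmod (f m x - f (s l) x))\<^sup>2) \<partial>M)"
      by (rule nn_integral_liminf) simp
    also have "\<dots> \<le> limsup (\<lambda>l. \<integral>\<^sup>+x. ennreal ((cmod (f m x - f (s l) x))\<^sup>2) \<partial>M)"
      by (rule Liminf_le_Limsup) simp
    also have "\<dots> \<le> ennreal (((1/2) ^ k)\<^sup>2)"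
    proof (rule Limsup_bounded)
      show "\<forall>\<^sub>F l in sequentially. (\<integral>\<^sup>+x. ennreal ((cmod (f m x - f (s l) x))\<^sup>2) \<partial>M) \<le> ennreal (((1/2) ^ k)\<^sup>2)"
        using eventually_ge_at_top[of k]
      proof eventually_elim
        case (elim l)
        have "(\<integral>\<^sup>+x. ennreal ((cmod (f m x - f (s l) x))\<^sup>2) \<partial>M) = ennreal ((L2_norm M (\<lambda>x. f m x - f (s l) x))\<^sup>2)"
          unfolding L2_norm_square
          by (subst nn_integral_eq_integral) (auto intro!: L2_integrable_square L2_diff f)
        also have "(L2_norm M (\<lambda>x. f m x - f (s l) x))\<^sup>2 \<le> ((1/2) ^ k)\<^sup>2"
          using N[OF m, of "s l"] sN[of k] s_mono[OF elim] by (intro power_mono) auto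
        finally show ?case by (simp add: ennreal_leI)
      qed
    qed
    finally show ?thesis .
  qed
  have diff: "(\<lambda>x. f m x - g x) \<in> L2 M" and le: "L2_norm M (\<lambda>x. f m x - g x) \<le> (1/2) ^ k"
    if m: "m \<ge> N k" for m k
  proof -
    have "integrable M (\<lambda>x. (cmod (f m x - g x))\<^sup>2)"
      using bound[OF m] by (intro integrableI_bounded) (auto simp: less_top[symmetric] top_unique)
    then show *: "(\<lambda>x. f m x - g x) \<in> L2 M" by (simp add: L2_def)
    have "ennreal ((L2_norm M (\<lambda>x. f m x - g x))\<^sup>2) \<le> ennreal (((1/2) ^ k)\<^sup>2)"
      using bound[OF m] unfolding L2_norm_square
      by (subst (asm) nn_integral_eq_integral) (auto intro!: L2_integrable_square *)
    then have "(L2_norm M (\<lambda>x. f m x - g x))\<^sup>2 \<le> ((1/2) ^ k)\<^sup>2"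
      by (subst (asm) ennreal_le_iff) auto
    then show "L2_norm M (\<lambda>x. f m x - g x) \<le> (1/2) ^ k"
      by (rule power2_le_imp_le) simp
  qed
  have "(\<lambda>x. f (N 0) x - (f (N 0) x - g x)) \<in> L2 M"
    by (intro L2_diff f diff) auto
  then have "g \<in> L2 M" by simp
  moreover have "(\<lambda>n. L2_norm M (\<lambda>x. f n x - g x)) \<longlonglongrightarrow> 0"
  proof (rule LIMSEQ_I)
    fix \<epsilon> :: real assume "0 < \<epsilon>"
    then obtain k where "(1/2) ^ k < \<epsilon>"
      using real_arch_pow_inv[of \<epsilon> "1/2"] by auto
    then show "\<exists>n0. \<forall>n\<ge>n0. norm (L2_norm M (\<lambda>x. f n x - g x) - 0) < \<epsilon>"
      using le[of k] by (intro exI[of _ "N k"]) force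
  qed
  ultimately show thesis using that by blast
qed


section \<open>Tensor products and Fourier coefficients\<close>

lemma L2_tensor:
  fixes \<phi> :: "'n::finite \<Rightarrow> 'a \<Rightarrow> complex"
  assumes "sigma_finite_measure M" "\<And>j. \<phi> j \<in> L2 M"
  shows "(\<lambda>x. \<Prod>j\<in>UNIV. \<phi> j (x j)) \<in> L2 (Pi\<^sub>M UNIV (\<lambda>_. M))"
proof -
  interpret sigma_finite_measure M by fact
  interpret product_sigma_finite "\<lambda>_::'n. M" ..
  have [measurable]: "\<phi> j \<in> borel_measurable M" for j
    using assms(2) by measurable
  have "integrable (Pi\<^sub>M UNIV (\<lambda>_::'n. M)) (\<lambda>x. \<Prod>j\<in>UNIV. (cmod (\<phi> j (x j)))\<^sup>2)"
    by (rule product_integrable_prod) (simp_all add: L2_integrable_square assms)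
  then show ?thesis
    by (simp add: L2_def prod_power_distrib flip: prod_norm)
qed

lemma L2_inner_tensor:
  fixes \<phi> \<psi> :: "'n::finite \<Rightarrow> 'a \<Rightarrow> complex"
  assumes "sigma_finite_measure M" "\<And>j. \<phi> j \<in> L2 M" "\<And>j. \<psi> j \<in> L2 M"
  shows "L2_inner (Pi\<^sub>M UNIV (\<lambda>_. M)) (\<lambda>x. \<Prod>j\<in>UNIV. \<phi> j (x j)) (\<lambda>x. \<Prod>j\<in>UNIV. \<psi> j (x j))
    = (\<Prod>j\<in>UNIV. L2_inner M (\<phi> j) (\<psi> j))"
proof -
  interpret sigma_finite_measure M by fact
  interpret product_sigma_finite "\<lambda>_::'n. M" ..
  show ?thesis
    unfolding L2_inner_def
    by (subst product_integral_prod[symmetric]) (simp_all add: L2_integrable_inner assms prod.distrib)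
qed

text \<open>The squared norm of a finite sum of tensors is a double sum of products of one-variable
  inner products, so it depends only on the Gram matrices of the factors. With counting measure on
  one side and the circle on the other, one-dimensional Parseval thus yields the isometry in
  dimension d.\<close>

lemma L2_norm_sum_tensor_cong:
  fixes \<phi> :: "nat \<Rightarrow> 'n::finite \<Rightarrow> 'a \<Rightarrow> complex" and \<psi> :: "nat \<Rightarrow> 'n \<Rightarrow> 'b \<Rightarrow> complex"
  assumes "sigma_finite_measure M" "sigma_finite_measure M'"
    and \<phi>: "\<And>k j. k < N \<Longrightarrow> \<phi> k j \<in> L2 M"
    and \<psi>: "\<And>k j. k < N \<Longrightarrow> \<psi> k j \<in> L2 M'"
    and inner: "\<And>k l j. k < N \<Longrightarrow> l < N \<Longrightarrow> L2_inner M (\<phi> k j) (\<phi> l j) = L2_inner M' (\<psi> k j) (\<psi> l j)"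
  shows "L2_norm (Pi\<^sub>M UNIV (\<lambda>_. M)) (\<lambda>x. \<Sum>k<N. \<Prod>j\<in>UNIV. \<phi> k j (x j))
    = L2_norm (Pi\<^sub>M UNIV (\<lambda>_. M')) (\<lambda>x. \<Sum>k<N. \<Prod>j\<in>UNIV. \<psi> k j (x j))"
proof -
  have expand: "L2_inner P (\<lambda>x. \<Sum>k<N. t k x) (\<lambda>x. \<Sum>k<N. t k x) = (\<Sum>k<N. \<Sum>l<N. L2_inner P (t k) (t l))"
    if "\<And>k. k < N \<Longrightarrow> t k \<in> L2 P" for P :: "'c measure" and t :: "nat \<Rightarrow> 'c \<Rightarrow> complex"
  proof -
    have "L2_inner P (\<lambda>x. \<Sum>k<N. t k x) (\<lambda>x. \<Sum>k<N. t k x) = (\<Sum>k<N. L2_inner P (t k) (\<lambda>x. \<Sum>l<N. t l x))"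
      using that by (intro L2_inner_sum_left L2_sum) auto
    also have "\<dots> = (\<Sum>k<N. \<Sum>l<N. L2_inner P (t k) (t l))"
    proof (rule sum.cong)
      fix k assume "k \<in> {..<N}"
      have "L2_inner P (t k) (\<lambda>x. \<Sum>l<N. t l x) = cnj (\<Sum>l<N. L2_inner P (t l) (t k))"
        using that \<open>k \<in> _\<close> by (subst L2_inner_commute, subst L2_inner_sum_left) auto
      also have "\<dots> = (\<Sum>l<N. L2_inner P (t k) (t l))"
        by (simp add: L2_inner_commute[of P "t k"])
      finally show "L2_inner P (t k) (\<lambda>x. \<Sum>l<N. t l x) = (\<Sum>l<N. L2_inner P (t k) (t l))" .
    qed simp
    finally show ?thesis .
  qed
  have "complex_of_real ((L2_norm (Pi\<^sub>M UNIV (\<lambda>_. M)) (\<lambda>x. \<Sum>k<N. \<Prod>j\<in>UNIV. \<phi> k j (x j)))\<^sup>2)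
      = complex_of_real ((L2_norm (Pi\<^sub>M UNIV (\<lambda>_. M')) (\<lambda>x. \<Sum>k<N. \<Prod>j\<in>UNIV. \<psi> k j (x j)))\<^sup>2)"
    unfolding L2_inner_self[symmetric] by (simp add: expand L2_tensor L2_inner_tensor assms)
  then show ?thesis
    by (simp only: of_real_eq_iff power2_eq_iff_nonneg L2_norm_nonneg)
qed

section \<open>Square-summable functions as the L2 space of counting measure\<close>

lemma ell2_eq_L2: "ell2 = L2 (count_space UNIV)"
proof -
  have "(\<lambda>x. (cmod (f x))\<^sup>2) summable_on UNIV \<longleftrightarrow> integrable (count_space UNIV) (\<lambda>x. (cmod (f x))\<^sup>2)"
    for f :: "'i \<Rightarrow> complex"
    using abs_summable_equivalent[of "\<lambda>x. (cmod (f x))\<^sup>2" UNIV]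
    by (simp add: abs_summable_on_def)
  then show ?thesis by (auto simp: ell2_def L2_def)
qed

lemma ell2_norm_eq_L2_norm: "ell2_norm = L2_norm (count_space UNIV)"
proof
  fix f :: "'i \<Rightarrow> complex"
  have "(\<Sum>\<^sub>\<infinity>x. (cmod (f x))\<^sup>2) = (\<integral>x. (cmod (f x))\<^sup>2 \<partial>count_space UNIV)"
  proof (cases "f \<in> ell2")
    case True
    then have "Infinite_Set_Sum.abs_summable_on (\<lambda>x. (cmod (f x))\<^sup>2) UNIV"
      by (simp add: abs_summable_on_def ell2_eq_L2 L2_integrable_square)
    from infsetsum_infsum[OF this] show ?thesis
      by (simp add: infsetsum_def)
  next
    \<comment> \<open>Outside \<open>ell2\<close> the infinite sum and the Bochner integral both
      take the default value 0, so the two norms agree as functions.\<close>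
    case False
    then have "\<not> (\<lambda>x. (cmod (f x))\<^sup>2) summable_on UNIV"
      and "\<not> integrable (count_space UNIV) (\<lambda>x. (cmod (f x))\<^sup>2)"
      by (simp add: ell2_def, simp add: ell2_eq_L2 L2_def)
    then show ?thesis
      by (simp add: infsum_not_exists not_integrable_integral_eq)
  qed
  then show "ell2_norm f = L2_norm (count_space UNIV) f"
    by (simp add: ell2_norm_def L2_norm_def)
qed

section \<open>The circle and its orthonormal system of exponentials\<close>

lemma finite_measure_circle: "finite_measure circle_measure"
  by (intro finite_measureI) (simp add: emeasure_restrict_space)

lemma sigma_finite_measure_circle: "sigma_finite_measure circle_measure"
  using finite_measure_circle by (simp add: finite_measure_def)

lemma L2_circle_eq_L2: "L2_circle = L2 circle_measure"
  by (simp add: L2_circle_def L2_def)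

lemma (in finite_measure) L2_bounded_const:
  assumes "f \<in> borel_measurable M" "\<And>x. x \<in> space M \<Longrightarrow> cmod (f x) \<le> C"
  shows "f \<in> L2 M"
proof (rule L2_bounded[where g="\<lambda>_. 1" and C=C])
  show "(\<lambda>_. 1) \<in> L2 M" by (simp add: L2_def)
qed (use assms in auto)

text \<open>The constant makes the system orthonormal, and the sign of the exponent is chosen so
  that the conjugation in the second argument of \<open>L2_inner\<close> reproduces the kernel of
  \<open>inv_fourier\<close>.\<close>

definition fourier_basis :: "int \<Rightarrow> real \<Rightarrow> complex" where
  "fourier_basis n \<theta> = complex_of_real (1 / sqrt (2 * pi)) * cis (real_of_int n * \<theta>)"

lemma fourier_basis_measurable [measurable]: "fourier_basis n \<in> borel_measurable circle_measure"
proof -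
  have "continuous_on UNIV (fourier_basis n)"
    unfolding fourier_basis_def by (intro continuous_intros)
  then have "fourier_basis n \<in> borel_measurable lborel"
    by (simp add: borel_measurable_continuous_onI)
  then show ?thesis by (rule measurable_restrict_space1)
qed

lemma cmod_fourier_basis: "cmod (fourier_basis n \<theta>) = 1 / sqrt (2 * pi)"
  by (simp add: fourier_basis_def norm_mult norm_divide)

lemma fourier_basis_L2: "fourier_basis n \<in> L2 circle_measure"
  by (rule finite_measure.L2_bounded_const[OF finite_measure_circle])
    (auto simp: cmod_fourier_basis)

lemma inv_fourier_eq_inner: "inv_fourier g n = L2_inner circle_measure g (fourier_basis n)"
  by (simp add: inv_fourier_def L2_inner_def fourier_basis_def cis_cnj ac_simps
      flip: integral_mult_right_zero)

lemma integral_cis: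
  "(\<integral>\<theta>. cis (real_of_int n * \<theta>) \<partial>circle_measure) = (if n = 0 then complex_of_real (2 * pi) else 0)"
proof (cases "n = 0")
  case True
  have "measure circle_measure (space circle_measure) = 2 * pi"
    by (simp add: measure_restrict_space space_restrict_space)
  then show ?thesis using True by (simp add: scaleR_conv_of_real)
next
  case False
  \<comment> \<open>A complex antiderivative, restricted to the real line below; its values at pi
    and - pi agree because n is an integer.\<close>
  define F where "F z = exp (\<i> * of_int n * z) / (\<i> * of_int n)" for z
  have F: "F (of_real \<theta>) = cis (of_int n * \<theta>) / (\<i> * of_int n)" for \<theta>
    by (simp add: F_def cis_conv_exp mult.assoc)
  have "(F has_field_derivative cis (of_int n * \<theta>)) (at (of_real \<theta>))" for \<theta>
    unfolding F_def using False
    by (auto intro!: derivative_eq_intros simp: cis_conv_exp mult.assoc)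
  then have "((\<lambda>\<theta>. F (of_real \<theta>)) has_vector_derivative cis (of_int n * \<theta>)) (at \<theta> within {-pi..pi})" for \<theta>
    by (intro has_vector_derivative_real_field)
  moreover have "continuous_on {-pi..pi} (\<lambda>\<theta>. cis (real_of_int n * \<theta>))"
    by (intro continuous_intros)
  ultimately have "(\<integral>\<theta>. indicator {-pi..pi} \<theta> *\<^sub>R cis (real_of_int n * \<theta>) \<partial>lborel)
      = F (of_real pi) - F (of_real (- pi))"
    by (intro integral_FTC_Icc) auto
  also have "cis (of_int n * pi) = cis (of_int n * - pi)"
    by (simp add: complex_eq_iff sin_npi_int mult.commute[of "real_of_int n"])
  then have "F (of_real pi) - F (of_real (- pi)) = 0"
    unfolding F by simp
  finally show ?thesis
    using False by (simp add: integral_restrict_space)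
qed

lemma fourier_basis_orthonormal:
  "L2_inner circle_measure (fourier_basis k) (fourier_basis l) = (if k = l then 1 else 0)"
proof -
  have "fourier_basis k \<theta> * cnj (fourier_basis l \<theta>)
      = complex_of_real (1 / (2 * pi)) * cis (real_of_int (k - l) * \<theta>)" for \<theta>
  proof -
    have "complex_of_real (1 / sqrt (2 * pi)) * complex_of_real (1 / sqrt (2 * pi)) = complex_of_real (1 / (2 * pi))"
      unfolding of_real_mult[symmetric] by (simp only: times_divide_times_eq mult_1 real_sqrt_mult_self) simp
    moreover have "cis (real_of_int (k - l) * \<theta>) = cis (real_of_int k * \<theta>) * cnj (cis (real_of_int l * \<theta>))"
      by (simp add: cis_cnj cis_mult algebra_simps)
    ultimately show ?thesis
      unfolding fourier_basis_def by (simp del: of_real_divide)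
  qed
  then show ?thesis
    unfolding L2_inner_def by (simp add: integral_cis del: of_int_diff of_real_divide) simp
qed

lemma inv_fourier_add:
  assumes "f \<in> L2 circle_measure" "g \<in> L2 circle_measure"
  shows "inv_fourier (\<lambda>\<theta>. f \<theta> + g \<theta>) = (\<lambda>n. inv_fourier f n + inv_fourier g n)"
  using assms by (simp add: inv_fourier_eq_inner L2_inner_add_left fourier_basis_L2 fun_eq_iff)

lemma inv_fourier_diff:
  assumes "f \<in> L2 circle_measure" "g \<in> L2 circle_measure"
  shows "inv_fourier (\<lambda>\<theta>. f \<theta> - g \<theta>) = (\<lambda>n. inv_fourier f n - inv_fourier g n)"
  using assms by (simp add: inv_fourier_eq_inner L2_inner_diff_left fourier_basis_L2 fun_eq_iff)

lemma inv_fourier_scale: "inv_fourier (\<lambda>\<theta>. c * f \<theta>) = (\<lambda>n. c * inv_fourier f n)"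
  by (simp add: inv_fourier_eq_inner L2_inner_scale_left fun_eq_iff)

lemma inv_fourier_basis: "inv_fourier (fourier_basis k) = (\<lambda>n. if n = k then 1 else 0)"
  by (auto simp: inv_fourier_eq_inner fourier_basis_orthonormal)

lemma fourier_sum_L2: "(\<lambda>\<theta>. \<Sum>k\<in>A. a k * fourier_basis k \<theta>) \<in> L2 circle_measure"
  by (intro L2_sum L2_scale fourier_basis_L2)

lemma inv_fourier_sum:
  assumes "finite A"
  shows "inv_fourier (\<lambda>\<theta>. \<Sum>k\<in>A. a k * fourier_basis k \<theta>) n = (if n \<in> A then a n else 0)"
proof -
  have "inv_fourier (\<lambda>\<theta>. \<Sum>k\<in>A. a k * fourier_basis k \<theta>) n
      = (\<Sum>k\<in>A. a k * L2_inner circle_measure (fourier_basis k) (fourier_basis n))"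
    unfolding inv_fourier_eq_inner
    by (subst L2_inner_sum_left) (auto intro: L2_scale fourier_basis_L2 simp: L2_inner_scale_left)
  also have "\<dots> = (\<Sum>k\<in>A. if n = k then a k else 0)"
    by (intro sum.cong) (auto simp: fourier_basis_orthonormal)
  finally show ?thesis
    using assms by simp
qed

lemma L2_inner_fourier_sum:
  assumes "f \<in> L2 circle_measure"
  shows "L2_inner circle_measure (\<lambda>\<theta>. \<Sum>k\<in>A. a k * fourier_basis k \<theta>) f = (\<Sum>k\<in>A. a k * cnj (inv_fourier f k))"
  using assms
  by (subst L2_inner_sum_left)
    (auto intro: L2_scale fourier_basis_L2 simp: L2_inner_scale_left inv_fourier_eq_inner
      L2_inner_commute[of _ _ f])

lemma L2_norm_fourier_sum:
  assumes "finite A"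
  shows "(L2_norm circle_measure (\<lambda>\<theta>. \<Sum>k\<in>A. a k * fourier_basis k \<theta>))\<^sup>2 = (\<Sum>k\<in>A. (cmod (a k))\<^sup>2)"
proof -
  have "complex_of_real ((L2_norm circle_measure (\<lambda>\<theta>. \<Sum>k\<in>A. a k * fourier_basis k \<theta>))\<^sup>2)
      = (\<Sum>k\<in>A. a k * cnj (a k))"
    unfolding L2_inner_self[symmetric] using assms
    by (simp add: L2_inner_fourier_sum fourier_sum_L2 inv_fourier_sum)
  also have "\<dots> = complex_of_real (\<Sum>k\<in>A. (cmod (a k))\<^sup>2)"
    by (simp only: of_real_sum complex_norm_square)
  finally show ?thesis
    by (simp only: of_real_eq_iff)
qed

text \<open>The partial sum \<open>S\<close> is the orthogonal projection of g: the coefficients of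
  g - S vanish on A, so g - S is orthogonal to S and Pythagoras applies.\<close>

lemma Bessel_inequality:
  assumes g: "g \<in> L2 circle_measure" and "finite A"
  shows "(\<Sum>k\<in>A. (cmod (inv_fourier g k))\<^sup>2) \<le> (L2_norm circle_measure g)\<^sup>2"
proof -
  define S where "S \<theta> = (\<Sum>k\<in>A. inv_fourier g k * fourier_basis k \<theta>)" for \<theta>
  have S: "S \<in> L2 circle_measure"
    unfolding S_def by (rule fourier_sum_L2)
  have D: "(\<lambda>\<theta>. g \<theta> - S \<theta>) \<in> L2 circle_measure"
    by (intro L2_diff g S)
  have "L2_inner circle_measure S (\<lambda>\<theta>. g \<theta> - S \<theta>) = (\<Sum>k\<in>A. inv_fourier g k * cnj (inv_fourier g k - inv_fourier S k))"
    unfolding S_def using D[unfolded S_def]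
    by (subst L2_inner_fourier_sum) (auto simp: inv_fourier_diff g fourier_sum_L2)
  also have "\<dots> = 0"
    unfolding S_def using assms by (intro sum.neutral) (auto simp: inv_fourier_sum)
  finally have "(L2_norm circle_measure (\<lambda>\<theta>. S \<theta> + (g \<theta> - S \<theta>)))\<^sup>2
      = (L2_norm circle_measure S)\<^sup>2 + (L2_norm circle_measure (\<lambda>\<theta>. g \<theta> - S \<theta>))\<^sup>2"
    by (simp only: L2_norm_add_square[OF S D]) simp
  moreover have "(L2_norm circle_measure S)\<^sup>2 = (\<Sum>k\<in>A. (cmod (inv_fourier g k))\<^sup>2)"
    unfolding S_def by (rule L2_norm_fourier_sum) fact
  ultimately show ?thesis by simp
qed

lemma inv_fourier_ell2: "g \<in> L2 circle_measure \<Longrightarrow> inv_fourier g \<in> ell2"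
  unfolding ell2_def
  by (auto intro!: nonneg_bdd_above_summable_on bdd_aboveI2[where M="(L2_norm circle_measure g)\<^sup>2"] Bessel_inequality)

text \<open>The partial Fourier sums \<open>S n\<close> have the same norms and mutual distances as
  the truncations \<open>t n\<close>, which tend to c; so they are Cauchy, and their limit has the
  right coefficients by continuity of the inner product. The norm identity is part of the conclusion
  because \<open>Parseval\<close> transfers it to every function with these coefficients.\<close>

lemma Riesz_Fischer:
  assumes c: "c \<in> ell2"
  obtains g where "g \<in> L2 circle_measure" "inv_fourier g = c" "L2_norm circle_measure g = ell2_norm c"
proof -
  let ?C = "count_space (UNIV :: int set)"
  have cL2: "c \<in> L2 ?C" using c by (simp add: ell2_eq_L2)
  define t where "t n k = (if k \<in> {- int n..int n} then c k else 0)" for n :: nat and k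
  define S where "S n \<theta> = (\<Sum>k=-int n..int n. c k * fourier_basis k \<theta>)" for n :: nat and \<theta>
  have t: "t n \<in> L2 ?C" for n
    by (rule L2_bounded[OF cL2, where C=1]) (auto simp: t_def)
  have S: "S n \<in> L2 circle_measure" for n
    unfolding S_def by (rule fourier_sum_L2)
  have iso: "L2_norm circle_measure (\<lambda>\<theta>. \<Sum>k\<in>A. a k * fourier_basis k \<theta>) = L2_norm ?C a"
    if "finite A" "\<And>k. k \<notin> A \<Longrightarrow> a k = 0" for A a
  proof -
    have "(\<integral>k. (cmod (a k))\<^sup>2 \<partial>?C) = (\<Sum>k\<in>A. (cmod (a k))\<^sup>2)"
      using that by (subst lebesgue_integral_count_space_finite_support)
        (auto intro!: sum.mono_neutral_left intro: finite_subset[OF _ that(1)])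
    then show ?thesis
      using L2_norm_fourier_sum[OF that(1), of a]
      by (rule_tac power2_eq_imp_eq) (simp_all flip: L2_norm_square)
  qed
  \<comment> \<open>Partial sums of different length are written over one common range, so that
    their difference is again a single Fourier sum.\<close>
  have S_eq: "S n \<theta> = (\<Sum>k=-int m..int m. t n k * fourier_basis k \<theta>)" if "n \<le> m" for n m \<theta>
    unfolding S_def t_def using that by (intro sum.mono_neutral_cong_left) auto
  have Sdiff: "L2_norm circle_measure (\<lambda>\<theta>. S m \<theta> - S n \<theta>) = L2_norm ?C (\<lambda>k. t m k - t n k)" for m n
  proof -
    have "S m \<theta> - S n \<theta> = (\<Sum>k=-int (max m n)..int (max m n). (t m k - t n k) * fourier_basis k \<theta>)" for \<theta>
      using S_eq[of m "max m n" \<theta>] S_eq[of n "max m n" \<theta>] by (simp add: left_diff_distrib sum_subtractf)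
    moreover have "L2_norm circle_measure (\<lambda>\<theta>. \<Sum>k=-int (max m n)..int (max m n). (t m k - t n k) * fourier_basis k \<theta>)
      = L2_norm ?C (\<lambda>k. t m k - t n k)"
      by (rule iso) (auto simp: t_def)
    ultimately show ?thesis by simp
  qed
  have Snorm: "L2_norm circle_measure (S n) = L2_norm ?C (t n)" for n
  proof -
    have "S n = (\<lambda>\<theta>. \<Sum>k=-int n..int n. t n k * fourier_basis k \<theta>)"
      using S_eq[of n n] by (intro ext) simp
    moreover have "L2_norm circle_measure \<dots> = L2_norm ?C (t n)"
      by (rule iso) (auto simp: t_def)
    ultimately show ?thesis by simp
  qed
  have "(\<lambda>n. \<integral>k. (cmod (t n k - c k))\<^sup>2 \<partial>?C) \<longlonglongrightarrow> (\<integral>k. 0 \<partial>?C)"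
  proof (rule integral_dominated_convergence[where w="\<lambda>k. (cmod (c k))\<^sup>2"])
    show "AE k in ?C. (\<lambda>n. (cmod (t n k - c k))\<^sup>2) \<longlonglongrightarrow> 0"
    proof (rule AE_I2)
      fix k :: int
      have "\<forall>\<^sub>F n in sequentially. (cmod (t n k - c k))\<^sup>2 = 0"
        using eventually_ge_at_top[of "nat \<bar>k\<bar>"] by eventually_elim (auto simp: t_def)
      then show "(\<lambda>n. (cmod (t n k - c k))\<^sup>2) \<longlonglongrightarrow> 0"
        by (rule tendsto_eventually)
    qed
  qed (auto simp: t_def L2_integrable_square cL2)
  then have "(\<lambda>n. sqrt (\<integral>k. (cmod (t n k - c k))\<^sup>2 \<partial>?C)) \<longlonglongrightarrow> sqrt 0"
    by (intro tendsto_real_sqrt) simp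
  then have tc: "(\<lambda>n. L2_norm ?C (\<lambda>k. t n k - c k)) \<longlonglongrightarrow> 0"
    by (simp add: L2_norm_def)
  obtain g where g: "g \<in> L2 circle_measure" and lim: "(\<lambda>n. L2_norm circle_measure (\<lambda>\<theta>. S n \<theta> - g \<theta>)) \<longlonglongrightarrow> 0"
  proof (rule L2_complete[OF S])
    fix \<epsilon> :: real assume "0 < \<epsilon>"
    then obtain N where N: "\<And>n. n \<ge> N \<Longrightarrow> L2_norm ?C (\<lambda>k. t n k - c k) < \<epsilon> / 2"
      using LIMSEQ_D[OF tc, of "\<epsilon> / 2"] by auto
    show "\<exists>N. \<forall>m\<ge>N. \<forall>n\<ge>N. L2_norm circle_measure (\<lambda>x. S m x - S n x) < \<epsilon>"
    proof (intro exI allI impI)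
      fix m n assume "N \<le> m" "N \<le> n"
      then show "L2_norm circle_measure (\<lambda>x. S m x - S n x) < \<epsilon>"
        using L2_norm_triangle_diff[OF t[of m] cL2 t[of n]] N[of m] N[of n]
        by (simp add: Sdiff L2_norm_minus_commute[of ?C c])
    qed
  qed
  have "inv_fourier g n = c n" for n
  proof -
    have "(\<lambda>m. inv_fourier (S m) n) \<longlonglongrightarrow> inv_fourier g n"
      unfolding inv_fourier_eq_inner by (rule L2_inner_tendsto[OF S g fourier_basis_L2 lim])
    moreover have "(\<lambda>m. inv_fourier (S m) n) \<longlonglongrightarrow> c n"
    proof (rule tendsto_eventually)
      show "\<forall>\<^sub>F m in sequentially. inv_fourier (S m) n = c n"
        using eventually_ge_at_top[of "nat \<bar>n\<bar>"]
        by eventually_elim (auto simp: S_def[abs_def] inv_fourier_sum)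
    qed
    ultimately show ?thesis by (rule LIMSEQ_unique)
  qed
  moreover have "L2_norm circle_measure g = L2_norm ?C c"
    using L2_norm_tendsto[OF S g lim] L2_norm_tendsto[OF t cL2 tc]
    unfolding Snorm by (rule LIMSEQ_unique)
  ultimately show thesis
    using that g c by (auto simp: ell2_norm_eq_L2_norm)
qed


section \<open>Completeness of the trigonometric system\<close>

inductive trig_poly :: "(real \<Rightarrow> complex) \<Rightarrow> bool" where
  trig_poly_monom: "trig_poly (\<lambda>\<theta>. c * cis (real_of_int n * \<theta>))"
| trig_poly_add: "trig_poly p \<Longrightarrow> trig_poly q \<Longrightarrow> trig_poly (\<lambda>\<theta>. p \<theta> + q \<theta>)"

lemma trig_poly_mult:
  assumes "trig_poly p" "trig_poly q"
  shows "trig_poly (\<lambda>\<theta>. p \<theta> * q \<theta>)"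
  using assms(1)
proof induction
  case (trig_poly_monom c n)
  show ?case
    using assms(2)
  proof induction
    case (trig_poly_monom d m)
    have "(\<lambda>\<theta>. (c * cis (real_of_int n * \<theta>)) * (d * cis (real_of_int m * \<theta>)))
        = (\<lambda>\<theta>. (c * d) * cis (real_of_int (n + m) * \<theta>))"
      by (simp add: fun_eq_iff distrib_right flip: cis_mult)
    then show ?case
      using trig_poly.trig_poly_monom[of "c * d" "n + m"] by simp
  next
    case (trig_poly_add p q)
    then show ?case
      using trig_poly.trig_poly_add by (simp add: distrib_left)
  qed
next
  case (trig_poly_add p q)
  then show ?case
    using trig_poly.trig_poly_add by (simp add: distrib_right)
qed

text \<open>Stone-Weierstrass will be used on the unit circle inside the complex plane, seen as a
  real vector space of dimension two. This identifies the approximating polynomials, restricted to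
  the circle, as trigonometric ones.\<close>

lemma trig_poly_real_polynomial_cis:
  assumes "real_polynomial_function p"
  shows "trig_poly (\<lambda>\<theta>. complex_of_real (p (cis \<theta>)))"
  using assms
proof induction
  case (linear f)
  interpret bounded_linear f by fact
  define a where "a = complex_of_real (f 1)"
  define b where "b = complex_of_real (f \<i>)"
  \<comment> \<open>Euler's formulas for cosine and sine, inserted into
    \<open>a * cos \<theta> + b * sin \<theta>\<close>.\<close>
  have "complex_of_real (f (cis \<theta>)) = (a / 2 - \<i> * b / 2) * cis (real_of_int 1 * \<theta>) + (a / 2 + \<i> * b / 2) * cis (real_of_int (- 1) * \<theta>)" for \<theta>
  proof -
    have "cis \<theta> = cos \<theta> *\<^sub>R 1 + sin \<theta> *\<^sub>R \<i>"
      by (simp add: complex_eq_iff)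
    then have "f (cis \<theta>) = cos \<theta> * f 1 + sin \<theta> * f \<i>"
      by (simp only: add scaleR real_scaleR_def)
    then show ?thesis
      by (simp add: complex_eq_iff a_def b_def)
  qed
  then show ?case
    using trig_poly_add[OF trig_poly_monom[of "a / 2 - \<i> * b / 2" 1] trig_poly_monom[of "a / 2 + \<i> * b / 2" "- 1"]]
    by simp
next
  case (const c)
  then show ?case
    using trig_poly_monom[of "complex_of_real c" 0] by simp
next
  case (add f g)
  then show ?case using trig_poly_add by simp
next
  case (mult f g)
  then show ?case using trig_poly_mult by simp
qed

lemma continuous_imp_measurable_circle:
  "continuous_on UNIV f \<Longrightarrow> f \<in> borel_measurable circle_measure"
  by (rule measurable_restrict_space1) (simp add: borel_measurable_continuous_onI)

text \<open>Equal values force the difference to be an integer multiple of 2 pi. One argument has to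
  be interior, since \<open>cis\<close> identifies pi with - pi; then the difference is smaller than
  2 pi in modulus.\<close>

lemma cis_inj_open:
  assumes "-pi < \<theta>" "\<theta> < pi" "-pi \<le> \<eta>" "\<eta> \<le> pi" "cis \<theta> = cis \<eta>"
  shows "\<theta> = \<eta>"
proof -
  obtain n :: int where n: "\<theta> = \<eta> + 2 * pi * n"
    using assms(5) sin_cos_eq_iff[of \<theta> \<eta>] by (auto simp: complex_eq_iff)
  then have "\<bar>2 * pi * of_int n\<bar> < 2 * pi"
    using assms by linarith
  then have "n = 0" by (simp add: abs_mult)
  then show ?thesis using n by simp
qed

lemma AE_circle_interior: "AE \<theta> in circle_measure. -pi < \<theta> \<and> \<theta> < pi"
proof -
  have "AE \<theta> in lborel. \<theta> \<noteq> pi" "AE \<theta> in lborel. \<theta> \<noteq> -pi"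
    by (rule AE_lborel_singleton)+
  then have "AE \<theta> in lborel. \<theta> \<in> {-pi..pi} \<longrightarrow> -pi < \<theta> \<and> \<theta> < pi"
    by eventually_elim auto
  then show ?thesis by (subst AE_restrict_space_iff) auto
qed

section \<open>Functions all of whose Fourier coefficients vanish\<close>

context
  fixes g :: "real \<Rightarrow> complex"
  assumes gL2: "g \<in> L2 circle_measure" and coeff: "\<And>n. inv_fourier g n = 0"
begin

lemma zero_coeff_measurable [measurable]: "g \<in> borel_measurable circle_measure"
  using gL2 by measurable

lemma zero_coeff_integrable: "integrable circle_measure g"
  by (rule L2_circle_integrable) (simp add: L2_circle_eq_L2 gL2)

lemma zero_coeff_integrable_mult:
  assumes [measurable]: "f \<in> borel_measurable circle_measure"
    and "\<And>\<theta>. \<theta> \<in> space circle_measure \<Longrightarrow> cmod (f \<theta>) \<le> C"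
  shows "integrable circle_measure (\<lambda>\<theta>. g \<theta> * f \<theta>)"
proof (rule Bochner_Integration.integrable_bound)
  show "integrable circle_measure (\<lambda>\<theta>. C * cmod (g \<theta>))"
    by (intro integrable_mult_right integrable_norm zero_coeff_integrable)
  show "AE \<theta> in circle_measure. norm (g \<theta> * f \<theta>) \<le> norm (C * cmod (g \<theta>))"
    using assms(2) by (intro AE_I2)
      (auto simp: norm_mult abs_mult mult.commute[of "cmod (g _)"] intro!: mult_right_mono order_trans[OF _ abs_ge_self])
qed measurable

lemma integral_trig_poly_zero:
  assumes "trig_poly p"
  shows "integrable circle_measure (\<lambda>\<theta>. g \<theta> * p \<theta>) \<and> (\<integral>\<theta>. g \<theta> * p \<theta> \<partial>circle_measure) = 0"
  using assms
proof induction
  case (trig_poly_monom c n)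
  have "integrable circle_measure (\<lambda>\<theta>. g \<theta> * (c * cis (real_of_int n * \<theta>)))"
    by (rule zero_coeff_integrable_mult[where C="cmod c"])
      (auto intro!: continuous_imp_measurable_circle continuous_intros simp: norm_mult)
  \<comment> \<open>The coefficient with index \<open>- n\<close> is used, because
    \<open>inv_fourier\<close> integrates against the conjugate exponential.\<close>
  moreover have "(\<integral>\<theta>. g \<theta> * cis (real_of_int n * \<theta>) \<partial>circle_measure) = 0"
    using coeff[of "- n"] by (simp add: inv_fourier_def)
  then have "(\<integral>\<theta>. g \<theta> * (c * cis (real_of_int n * \<theta>)) \<partial>circle_measure) = 0"
    by (simp add: mult.left_commute[of "g _"])
  ultimately show ?case by simp
next
  case (trig_poly_add p q)
  then show ?case by (simp add: distrib_left)
qed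

text \<open>The integral against a trigonometric polynomial vanishes, and a uniform error \<epsilon>
  on the circle changes the integral by at most \<epsilon> times the L1 norm \<open>K\<close> of
  g.\<close>

lemma integral_continuous_zero:
  fixes h :: "complex \<Rightarrow> real"
  assumes h: "continuous_on UNIV h"
  shows "(\<integral>\<theta>. g \<theta> * h (cis \<theta>) \<partial>circle_measure) = 0"
proof (rule ccontr)
  let ?I = "\<integral>\<theta>. g \<theta> * h (cis \<theta>) \<partial>circle_measure"
  assume nz: "?I \<noteq> 0"
  define K where "K = (\<integral>\<theta>. cmod (g \<theta>) \<partial>circle_measure)"
  have K: "0 \<le> K" unfolding K_def by (intro integral_nonneg_AE) simp
  \<comment> \<open>Chosen so that \<open>\<epsilon> * K\<close> stays below the modulus of the
    integral; the summand 1 keeps the denominator positive.\<close>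
  define \<epsilon> where "\<epsilon> = cmod ?I / (2 * (K + 1))"
  have \<epsilon>: "0 < \<epsilon>" unfolding \<epsilon>_def using nz K by simp
  obtain p where p: "real_polynomial_function p" and approx: "\<And>w. w \<in> sphere 0 1 \<Longrightarrow> \<bar>h w - p w\<bar> < \<epsilon>"
    using Stone_Weierstrass_real_polynomial_function[of "sphere 0 1" h \<epsilon>] h \<epsilon>
    by (metis compact_sphere continuous_on_subset subset_UNIV)
  have cp: "continuous_on UNIV p"
    using p continuous_on_polymonial_function real_polynomial_function_eq by blast
  have "integrable circle_measure (\<lambda>\<theta>. g \<theta> * p (cis \<theta>))" and pz: "(\<integral>\<theta>. g \<theta> * p (cis \<theta>) \<partial>circle_measure) = 0"
    using integral_trig_poly_zero[OF trig_poly_real_polynomial_cis[OF p]] by auto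
  moreover have diff: "integrable circle_measure (\<lambda>\<theta>. g \<theta> * complex_of_real (h (cis \<theta>) - p (cis \<theta>)))"
  proof (rule zero_coeff_integrable_mult[where C=\<epsilon>])
    show "(\<lambda>\<theta>. complex_of_real (h (cis \<theta>) - p (cis \<theta>))) \<in> borel_measurable circle_measure"
      by (intro continuous_imp_measurable_circle continuous_intros continuous_on_compose2[OF h]
          continuous_on_compose2[OF cp]) auto
    show "cmod (complex_of_real (h (cis \<theta>) - p (cis \<theta>))) \<le> \<epsilon>" for \<theta>
      using approx[of "cis \<theta>"] by (simp del: of_real_diff)
  qed
  ultimately have "(\<integral>\<theta>. g \<theta> * p (cis \<theta>) + g \<theta> * complex_of_real (h (cis \<theta>) - p (cis \<theta>)) \<partial>circle_measure)
      = (\<integral>\<theta>. g \<theta> * complex_of_real (h (cis \<theta>) - p (cis \<theta>)) \<partial>circle_measure)"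
    by (simp del: of_real_diff)
  then have "?I = (\<integral>\<theta>. g \<theta> * complex_of_real (h (cis \<theta>) - p (cis \<theta>)) \<partial>circle_measure)"
    by (simp add: right_diff_distrib)
  then have "cmod ?I \<le> (\<integral>\<theta>. cmod (g \<theta> * complex_of_real (h (cis \<theta>) - p (cis \<theta>))) \<partial>circle_measure)"
    by (simp only: integral_norm_bound)
  also have "\<dots> \<le> (\<integral>\<theta>. \<epsilon> * cmod (g \<theta>) \<partial>circle_measure)"
  proof (rule integral_mono)
    show "cmod (g \<theta> * complex_of_real (h (cis \<theta>) - p (cis \<theta>))) \<le> \<epsilon> * cmod (g \<theta>)" for \<theta>
      using approx[of "cis \<theta>"]
      by (simp add: norm_mult mult.commute[of "cmod (g _)"] mult_right_mono del: of_real_diff)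
  qed (intro integrable_norm diff integrable_mult_right zero_coeff_integrable)+
  also have "\<dots> = \<epsilon> * K" by (simp add: K_def)
  also have "\<dots> < cmod ?I"
    unfolding \<epsilon>_def using nz K by (simp add: pos_divide_less_eq distrib_left add_nonneg_pos)
  finally show False by simp
qed

text \<open>The functions \<open>h n\<close> increase to the indicator of the complement of the
  closed set \<open>C\<close>. Composed with \<open>cis\<close> they exhibit the indicator of U, off
  a null set, as a bounded limit of functions already known to integrate to zero against g.\<close>

lemma integral_open_zero:
  assumes "open U"
  shows "(\<integral>\<theta>. indicator U \<theta> *\<^sub>R g \<theta> \<partial>circle_measure) = 0"
proof -
  \<comment> \<open>The end points are always counted as outside U: \<open>cis\<close> identifies
    them, so U might contain only one of the two. This costs a null set and makes \<open>C\<close>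
    nonempty, so that \<open>infdist\<close> is a genuine distance.\<close>
  define C where "C = cis ` ({-pi..pi} - (U \<inter> {-pi<..<pi}))"
  have "closed ({-pi..pi} - (U \<inter> {-pi<..<pi}))"
    using assms by (intro closed_Diff) auto
  then have "compact ({-pi..pi} - (U \<inter> {-pi<..<pi}))"
    by (meson Diff_subset bounded_subset compact_eq_bounded_closed bounded_closed_interval)
  then have "closed C"
    unfolding C_def by (intro compact_imp_closed compact_continuous_image continuous_intros)
  have "pi \<in> {-pi..pi} - (U \<inter> {-pi<..<pi})" by simp
  then have "C \<noteq> {}" unfolding C_def by blast
  define h where "h n w = min 1 (real n * infdist w C)" for n w
  have h: "continuous_on UNIV (h n)" for n
    unfolding h_def by (intro continuous_intros)
  have [measurable]: "(\<lambda>\<theta>. h n (cis \<theta>)) \<in> borel_measurable circle_measure" for n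
    by (intro continuous_imp_measurable_circle continuous_on_compose2[OF h] continuous_intros) auto
  have "U \<in> sets borel" using assms by simp
  then have [measurable]: "indicator U \<in> borel_measurable circle_measure"
    by (intro measurable_restrict_space1) simp
  have "(\<lambda>n. \<integral>\<theta>. g \<theta> * h n (cis \<theta>) \<partial>circle_measure) \<longlonglongrightarrow> (\<integral>\<theta>. indicator U \<theta> *\<^sub>R g \<theta> \<partial>circle_measure)"
  proof (rule integral_dominated_convergence[where w="\<lambda>\<theta>. cmod (g \<theta>)"])
    show "AE \<theta> in circle_measure. (\<lambda>n. g \<theta> * h n (cis \<theta>)) \<longlonglongrightarrow> indicator U \<theta> *\<^sub>R g \<theta>"
      using AE_circle_interior
    proof eventually_elim
      case (elim \<theta>)
      have "(\<lambda>n. h n (cis \<theta>)) \<longlonglongrightarrow> indicator U \<theta>"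
      proof (cases "\<theta> \<in> U")
        case True
        have "cis \<theta> \<notin> C"
          using True elim cis_inj_open[of \<theta>] unfolding C_def by force
        then have pos: "0 < infdist (cis \<theta>) C"
          using \<open>closed C\<close> \<open>C \<noteq> {}\<close> by (simp add: infdist_pos_not_in_closed)
        obtain n0 where n0: "1 / infdist (cis \<theta>) C \<le> real n0"
          using real_arch_simple by blast
        have "\<forall>\<^sub>F n in sequentially. h n (cis \<theta>) = 1"
          using eventually_ge_at_top[of n0]
        proof eventually_elim
          case (elim n)
          then have "1 / infdist (cis \<theta>) C \<le> real n" using n0 by simp
          then show ?case using pos by (simp add: h_def field_simps)
        qed
        then show ?thesis using True by (simp add: tendsto_eventually)
      next
        case False
        then have "cis \<theta> \<in> C" unfolding C_def using elim by auto
        then show ?thesis using False by (simp add: h_def)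
      qed
      then have "(\<lambda>n. g \<theta> * complex_of_real (h n (cis \<theta>))) \<longlonglongrightarrow> g \<theta> * complex_of_real (indicator U \<theta>)"
        by (intro tendsto_intros)
      then show ?case by (simp add: scaleR_conv_of_real mult.commute)
    qed
    show "AE \<theta> in circle_measure. norm (g \<theta> * h n (cis \<theta>)) \<le> cmod (g \<theta>)" for n
      by (intro AE_I2) (auto simp: norm_mult h_def infdist_nonneg intro!: mult_left_le)
  qed (auto intro: zero_coeff_integrable)
  then show ?thesis
    unfolding integral_continuous_zero[OF h] by (rule LIMSEQ_unique[OF tendsto_const, symmetric])
qed

text \<open>An integrable function vanishes almost everywhere once its integral over every
  measurable set is zero. The open sets are stable under intersection and generate the Borel sets,
  so Dynkin's lemma extends the case of open sets to all of them.\<close>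

lemma zero_of_inv_fourier_zero: "AE \<theta> in circle_measure. g \<theta> = 0"
proof (rule sigma_finite_measure.density_zero[OF sigma_finite_measure_circle zero_coeff_integrable])
  have int: "integrable circle_measure (\<lambda>\<theta>. indicator B \<theta> *\<^sub>R g \<theta>)" if "B \<in> sets borel" for B
  proof (rule Bochner_Integration.integrable_bound[OF zero_coeff_integrable])
    have [measurable]: "(indicator B :: real \<Rightarrow> real) \<in> borel_measurable circle_measure"
      using that by (intro measurable_restrict_space1) simp
    show "(\<lambda>\<theta>. indicator B \<theta> *\<^sub>R g \<theta>) \<in> borel_measurable circle_measure"
      by measurable
  qed (auto simp: indicator_def)
  have zero: "(\<integral>\<theta>. indicator B \<theta> *\<^sub>R g \<theta> \<partial>circle_measure) = 0" if "B \<in> sets borel" for B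
  proof -
    have "Int_stable {S. open (S :: real set)}" by (auto simp: Int_stable_def)
    moreover have "{S. open S} \<subseteq> Pow (UNIV :: real set)" by simp
    moreover have "B \<in> sigma_sets UNIV {S. open S}"
      using that by (simp add: borel_def)
    ultimately show ?thesis
    proof (induction rule: sigma_sets_induct_disjoint)
      show "(\<integral>\<theta>. indicator A \<theta> *\<^sub>R g \<theta> \<partial>circle_measure) = 0" if "A \<in> {S. open S}" for A
        using that integral_open_zero by simp
      show "(\<integral>\<theta>. indicator {} \<theta> *\<^sub>R g \<theta> \<partial>circle_measure) = 0" by simp
    next
      fix A assume "A \<in> sigma_sets UNIV {S. open (S :: real set)}"
        and z: "(\<integral>\<theta>. indicator A \<theta> *\<^sub>R g \<theta> \<partial>circle_measure) = 0"
      then have "A \<in> sets borel" by (simp add: borel_def)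
      have "(\<integral>\<theta>. g \<theta> \<partial>circle_measure) = 0"
        using integral_open_zero[of UNIV] by simp
      moreover have "indicator (UNIV - A) \<theta> *\<^sub>R g \<theta> = g \<theta> - indicator A \<theta> *\<^sub>R g \<theta>" for \<theta>
        by (simp add: indicator_def)
      ultimately show "(\<integral>\<theta>. indicator (UNIV - A) \<theta> *\<^sub>R g \<theta> \<partial>circle_measure) = 0"
        using int[OF \<open>A \<in> sets borel\<close>] zero_coeff_integrable z by simp
    next
      fix A :: "nat \<Rightarrow> real set"
      assume disj: "disjoint_family A" and A: "range A \<subseteq> sigma_sets UNIV {S. open S}"
        and z: "\<And>i. (\<integral>\<theta>. indicator (A i) \<theta> *\<^sub>R g \<theta> \<partial>circle_measure) = 0"
      have Ab: "A i \<in> sets borel" for i using A by (auto simp: borel_def)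
      \<comment> \<open>Measurable sets of \<open>circle_measure\<close> are subsets of the
        interval, so the Borel sets are intersected with it before countable additivity is
        applied.\<close>
      let ?A = "\<lambda>i. A i \<inter> {-pi..pi}"
      have "(\<integral>\<theta>. indicator (\<Union>i. A i) \<theta> *\<^sub>R g \<theta> \<partial>circle_measure) = (LINT \<theta>:(\<Union>i. ?A i)|circle_measure. g \<theta>)"
        unfolding set_lebesgue_integral_def
        by (intro Bochner_Integration.integral_cong) (auto simp: space_restrict_space indicator_def)
      also have "\<dots> = (\<Sum>i. LINT \<theta>:?A i|circle_measure. g \<theta>)"
      proof (rule lebesgue_integral_countable_add)
        show "?A i \<in> sets circle_measure" for i using Ab[of i] by (auto simp: sets_restrict_space)
        show "i \<noteq> j \<Longrightarrow> ?A i \<inter> ?A j = {}" for i j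
          using disj by (auto simp: disjoint_family_on_def)
        have "(\<Union>i. A i) \<in> sets borel" using Ab by auto
        then show "set_integrable circle_measure (\<Union>i. ?A i) g"
          unfolding set_integrable_def using int[of "\<Union>i. A i"]
          by (rule_tac Bochner_Integration.integrable_cong[THEN iffD1, OF refl, rotated])
            (auto simp: space_restrict_space indicator_def)
      qed
      also have "\<dots> = (\<Sum>i. \<integral>\<theta>. indicator (A i) \<theta> *\<^sub>R g \<theta> \<partial>circle_measure)"
        unfolding set_lebesgue_integral_def
        by (intro suminf_cong Bochner_Integration.integral_cong) (auto simp: space_restrict_space indicator_def)
      finally show "(\<integral>\<theta>. indicator (\<Union>i. A i) \<theta> *\<^sub>R g \<theta> \<partial>circle_measure) = 0"
        by (simp add: z)
    qed
  qed
  fix A assume "A \<in> sets circle_measure"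
  then have "A \<in> sets borel" by (auto simp: sets_restrict_space)
  then show "set_lebesgue_integral circle_measure A g = 0"
    unfolding set_lebesgue_integral_def by (rule zero)
qed

end

text \<open>Riesz-Fischer gives some h with the coefficients of g and the correct norm; g - h has
  vanishing coefficients and therefore vanishes almost everywhere.\<close>

theorem Parseval:
  assumes g: "g \<in> L2 circle_measure"
  shows "ell2_norm (inv_fourier g) = L2_norm circle_measure g"
proof -
  obtain h where h: "h \<in> L2 circle_measure" "inv_fourier h = inv_fourier g"
      "L2_norm circle_measure h = ell2_norm (inv_fourier g)"
    using Riesz_Fischer[OF inv_fourier_ell2[OF g]] by blast
  have "AE \<theta> in circle_measure. g \<theta> - h \<theta> = 0"
    using h g by (intro zero_of_inv_fourier_zero) (auto simp: inv_fourier_diff intro: L2_diff)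
  then have "(\<integral>\<theta>. (cmod (g \<theta>))\<^sup>2 \<partial>circle_measure) = (\<integral>\<theta>. (cmod (h \<theta>))\<^sup>2 \<partial>circle_measure)"
    using g h by (intro integral_cong_AE) (auto dest: L2_measurable)
  then show ?thesis
    using h(3) by (simp add: L2_norm_def)
qed

text \<open>Polarisation: equality of norms for f, g and f + g gives equality of the real parts, and
  replacing f by - i f turns real parts into imaginary ones.\<close>

lemma Parseval_inner:
  assumes f: "f \<in> L2 circle_measure" and g: "g \<in> L2 circle_measure"
  shows "L2_inner (count_space UNIV) (inv_fourier f) (inv_fourier g) = L2_inner circle_measure f g"
proof -
  have mem: "inv_fourier f \<in> L2 (count_space UNIV)" if "f \<in> L2 circle_measure" for f
    using inv_fourier_ell2[OF that] by (simp add: ell2_eq_L2)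
  have norm: "L2_norm (count_space UNIV) (inv_fourier f) = L2_norm circle_measure f" if "f \<in> L2 circle_measure" for f
    using Parseval[OF that] by (simp add: ell2_norm_eq_L2_norm)
  have Re: "Re (L2_inner (count_space UNIV) (inv_fourier f) (inv_fourier g)) = Re (L2_inner circle_measure f g)"
    if f: "f \<in> L2 circle_measure" for f
    using L2_norm_add_square[OF f g] L2_norm_add_square[OF mem[OF f] mem[OF g]]
      norm[OF f] norm[OF g] norm[OF L2_add[OF f g]]
    by (simp add: inv_fourier_add f g)
  have "Im (L2_inner (count_space UNIV) (inv_fourier f) (inv_fourier g)) = Im (L2_inner circle_measure f g)"
    using Re[OF L2_scale[OF f, of "- \<i>"]]
    unfolding inv_fourier_scale L2_inner_scale_left by simp
  then show ?thesis
    using Re[OF f] by (simp add: complex_eq_iff)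
qed


section \<open>Resolvents and spectra of Fourier multipliers\<close>

lemma ell2_tail:
  assumes "f \<in> ell2" "0 < \<epsilon>"
  obtains F where "finite F" "ell2_norm (\<lambda>x. if x \<in> F then 0 else f x) < \<epsilon>"
proof -
  have sm: "(\<lambda>x. (cmod (f x))\<^sup>2) summable_on UNIV"
    using assms(1) by (simp add: ell2_def)
  have "0 < \<epsilon>\<^sup>2 / 2" using assms(2) by simp
  then obtain F where F: "finite F" "dist (\<Sum>x\<in>F. (cmod (f x))\<^sup>2) (\<Sum>\<^sub>\<infinity>x. (cmod (f x))\<^sup>2) \<le> \<epsilon>\<^sup>2 / 2"
    using has_sum_finite_approximation[OF has_sum_infsum[OF sm]] by blast
  have "(\<Sum>\<^sub>\<infinity>x. (cmod (if x \<in> F then 0 else f x))\<^sup>2) = (\<Sum>\<^sub>\<infinity>x\<in>UNIV - F. (cmod (f x))\<^sup>2)"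
    by (rule infsum_cong_neutral) auto
  also have "\<dots> = (\<Sum>\<^sub>\<infinity>x. (cmod (f x))\<^sup>2) - (\<Sum>x\<in>F. (cmod (f x))\<^sup>2)"
    using F(1) by (subst infsum_Diff[OF sm]) (auto intro: summable_on_finite)
  also have "\<dots> \<le> \<epsilon>\<^sup>2 / 2"
    using F(2) unfolding dist_real_def by linarith
  also have "\<dots> < \<epsilon>\<^sup>2" using assms(2) by simp
  finally have "ell2_norm (\<lambda>x. if x \<in> F then 0 else f x) < \<epsilon>"
    unfolding ell2_norm_def using assms(2) by (intro real_less_lsqrt) auto
  with F(1) show thesis using that by blast
qed

text \<open>Injectivity comes from the lower bound applied to the difference of two graph points,
  which is why T is required to be closed under differences.\<close>

lemma resolvent_setI:
  assumes T: "T \<subseteq> ell2 \<times> ell2"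
    and diff: "\<And>f g f' g'. (f, g) \<in> T \<Longrightarrow> (f', g') \<in> T \<Longrightarrow> (\<lambda>x. f x - f' x, \<lambda>x. g x - g' x) \<in> T"
    and bound: "\<And>f g. (f, g) \<in> T \<Longrightarrow> ell2_norm f \<le> C * ell2_norm (\<lambda>x. g x - z * f x)"
    and surj: "\<And>h. h \<in> ell2 \<Longrightarrow> \<exists>(f, g)\<in>T. h = (\<lambda>x. g x - z * f x)"
  shows "z \<in> resolvent_set T"
proof -
  let ?R = "\<lambda>(f, g). (\<lambda>x. g x - z * f x)"
  have "inj_on ?R T"
  proof (rule inj_onI, clarify)
    fix f g f' g' assume p: "(f, g) \<in> T" "(f', g') \<in> T"
      and "(\<lambda>x. g x - z * f x) = (\<lambda>x. g' x - z * f' x)"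
    then have eq: "g x - z * f x = g' x - z * f' x" for x by meson
    have "(\<lambda>x. (g x - g' x) - z * (f x - f' x)) = (\<lambda>x. 0)"
      using eq by (simp add: fun_eq_iff algebra_simps)
    then have "L2_norm (count_space UNIV) (\<lambda>x. f x - f' x) \<le> 0"
      using bound[OF diff[OF p]] by (simp add: ell2_norm_eq_L2_norm)
    then have "L2_norm (count_space UNIV) (\<lambda>x. f x - f' x) = 0"
      by (simp add: antisym)
    moreover have "(\<lambda>x. f x - f' x) \<in> L2 (count_space UNIV)"
      using diff[OF p] T by (auto simp: ell2_eq_L2)
    ultimately have "f x = f' x" for x
      using L2_norm_eq_zeroD by (fastforce simp: AE_count_space)
    then show "f = f' \<and> g = g'" using eq by (auto simp: fun_eq_iff)
  qed
  moreover have "?R ` T = ell2"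
  proof
    show "?R ` T \<subseteq> ell2"
      using T by (auto simp: ell2_eq_L2 intro!: L2_diff L2_scale)
    show "ell2 \<subseteq> ?R ` T"
      using surj by fastforce
  qed
  ultimately show ?thesis
    unfolding resolvent_set_def bij_betw_def using bound by fast
qed

lemma subset_ell2_op_closure:
  assumes "T \<subseteq> ell2 \<times> ell2"
  shows "T \<subseteq> ell2_op_closure T"
proof clarify
  fix f g assume "(f, g) \<in> T"
  then show "(f, g) \<in> ell2_op_closure T"
    using assms unfolding ell2_op_closure_def
    by (auto simp: ell2_norm_eq_L2_norm intro!: bexI[of _ "(f, g)"])
qed

text \<open>The lower bound passes to the closure by continuity. It also makes approximate solutions
  of (T - z) u = h a Cauchy sequence, whose limit belongs to the closure and solves the equation
  exactly; so dense range improves to full range.\<close>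

lemma resolvent_set_ell2_op_closureI:
  assumes T: "T \<subseteq> ell2 \<times> ell2"
    and diff: "\<And>f g f' g'. (f, g) \<in> T \<Longrightarrow> (f', g') \<in> T \<Longrightarrow> (\<lambda>x. f x - f' x, \<lambda>x. g x - g' x) \<in> T"
    and C: "0 \<le> C"
    and bound: "\<And>f g. (f, g) \<in> T \<Longrightarrow> ell2_norm f \<le> C * ell2_norm (\<lambda>x. g x - z * f x)"
    and dense: "\<And>h \<epsilon>. h \<in> ell2 \<Longrightarrow> 0 < \<epsilon> \<Longrightarrow> \<exists>(f, g)\<in>T. ell2_norm (\<lambda>x. (g x - z * f x) - h x) < \<epsilon>"
  shows "z \<in> resolvent_set (ell2_op_closure T)"
proof (rule resolvent_setI)
  note [simp] = ell2_eq_L2 ell2_norm_eq_L2_norm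
  let ?n = "L2_norm (count_space UNIV)"
  have TL: "f \<in> L2 (count_space UNIV)" "g \<in> L2 (count_space UNIV)" if "(f, g) \<in> T" for f g
    using that T by auto
  show "ell2_op_closure T \<subseteq> ell2 \<times> ell2" by (auto simp: ell2_op_closure_def)
  have clE: "\<exists>f' g'. (f', g') \<in> T \<and> ?n (\<lambda>x. f x - f' x) < \<epsilon> \<and> ?n (\<lambda>x. g x - g' x) < \<epsilon>"
    if "(f, g) \<in> ell2_op_closure T" "0 < \<epsilon>" for f g \<epsilon>
    using that unfolding ell2_op_closure_def by fastforce
  have clL: "f \<in> L2 (count_space UNIV)" "g \<in> L2 (count_space UNIV)" if "(f, g) \<in> ell2_op_closure T" for f g
    using that by (auto simp: ell2_op_closure_def)
  show "(\<lambda>x. f x - f' x, \<lambda>x. g x - g' x) \<in> ell2_op_closure T"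
    if p: "(f, g) \<in> ell2_op_closure T" "(f', g') \<in> ell2_op_closure T" for f g f' g'
    unfolding ell2_op_closure_def
  proof (intro CollectI case_prodI conjI allI impI)
    fix \<epsilon> :: real assume "0 < \<epsilon>"
    then have "0 < \<epsilon> / 2" by simp
    obtain a b where ab: "(a, b) \<in> T" "?n (\<lambda>x. f x - a x) < \<epsilon> / 2" "?n (\<lambda>x. g x - b x) < \<epsilon> / 2"
      using clE[OF p(1) \<open>0 < \<epsilon> / 2\<close>] by blast
    obtain a' b' where ab': "(a', b') \<in> T" "?n (\<lambda>x. f' x - a' x) < \<epsilon> / 2" "?n (\<lambda>x. g' x - b' x) < \<epsilon> / 2"
      using clE[OF p(2) \<open>0 < \<epsilon> / 2\<close>] by blast
    have tri: "?n (\<lambda>x. (k x - k' x) - (l x - l' x)) < \<epsilon>"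
      if "k \<in> L2 (count_space UNIV)" "k' \<in> L2 (count_space UNIV)" "l \<in> L2 (count_space UNIV)" "l' \<in> L2 (count_space UNIV)"
        "?n (\<lambda>x. k x - l x) < \<epsilon> / 2" "?n (\<lambda>x. k' x - l' x) < \<epsilon> / 2" for k k' l l' :: "'a \<Rightarrow> complex"
    proof -
      have "?n (\<lambda>x. (k x - l x) + (l' x - k' x)) \<le> ?n (\<lambda>x. k x - l x) + ?n (\<lambda>x. l' x - k' x)"
        using that by (intro L2_norm_triangle L2_diff)
      moreover have "(k x - l x) + (l' x - k' x) = (k x - k' x) - (l x - l' x)" for x by simp
      ultimately show ?thesis using that by (simp add: L2_norm_minus_commute[of _ l'])
    qed
    show "\<exists>(a, b)\<in>T. ell2_norm (\<lambda>x. (f x - f' x) - a x) < \<epsilon> \<and> ell2_norm (\<lambda>x. (g x - g' x) - b x) < \<epsilon>"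
      using diff[OF ab(1) ab'(1)] tri[OF clL(1)[OF p(1)] clL(1)[OF p(2)] TL(1)[OF ab(1)] TL(1)[OF ab'(1)] ab(2) ab'(2)]
        tri[OF clL(2)[OF p(1)] clL(2)[OF p(2)] TL(2)[OF ab(1)] TL(2)[OF ab'(1)] ab(3) ab'(3)]
      by (intro bexI[of _ "(\<lambda>x. a x - a' x, \<lambda>x. b x - b' x)"]) auto
  qed (use clL[OF p(1)] clL[OF p(2)] in \<open>auto intro: L2_diff\<close>)
  show "ell2_norm f \<le> C * ell2_norm (\<lambda>x. g x - z * f x)" if p: "(f, g) \<in> ell2_op_closure T" for f g
  proof (rule field_le_epsilon)
    fix \<epsilon> :: real assume "0 < \<epsilon>"
    \<comment> \<open>Replacing (f, g) by a graph point of T within \<eta> costs at most \<eta> on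
      the left and \<open>C * (\<eta> + cmod z * \<eta>)\<close> on the right; these add up to
      \<epsilon>.\<close>
    define \<eta> where "\<eta> = \<epsilon> / (1 + C * (1 + cmod z))"
    have pos: "0 < 1 + C * (1 + cmod z)" using C by (simp add: add_pos_nonneg)
    have "0 < \<eta>" unfolding \<eta>_def using \<open>0 < \<epsilon>\<close> pos by simp
    obtain a b where ab: "(a, b) \<in> T" "?n (\<lambda>x. f x - a x) < \<eta>" "?n (\<lambda>x. g x - b x) < \<eta>"
      using clE[OF p \<open>0 < \<eta>\<close>] by blast
    note L = clL[OF p] TL[OF ab(1)]
    have 1: "?n f \<le> ?n (\<lambda>x. f x - a x) + ?n a"
      using L2_norm_triangle[OF L2_diff[OF L(1) L(3)] L(3)] by simp
    have "?n (\<lambda>x. b x - z * a x) \<le> ?n (\<lambda>x. g x - z * f x) + ?n (\<lambda>x. (b x - g x) + z * (f x - a x))"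
    proof -
      have "?n (\<lambda>x. (g x - z * f x) + ((b x - g x) + z * (f x - a x)))
          \<le> ?n (\<lambda>x. g x - z * f x) + ?n (\<lambda>x. (b x - g x) + z * (f x - a x))"
        using L by (intro L2_norm_triangle L2_add L2_diff L2_scale)
      moreover have "(g x - z * f x) + ((b x - g x) + z * (f x - a x)) = b x - z * a x" for x
        by (simp add: algebra_simps)
      ultimately show ?thesis by simp
    qed
    also have "?n (\<lambda>x. (b x - g x) + z * (f x - a x)) \<le> ?n (\<lambda>x. b x - g x) + ?n (\<lambda>x. z * (f x - a x))"
      using L by (intro L2_norm_triangle L2_diff L2_scale)
    also have "?n (\<lambda>x. z * (f x - a x)) = cmod z * ?n (\<lambda>x. f x - a x)"
      by (rule L2_norm_scale)
    also have "\<dots> \<le> cmod z * \<eta>" using ab(2) by (intro mult_left_mono) auto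
    also have "?n (\<lambda>x. b x - g x) \<le> \<eta>" using ab(3) by (simp add: L2_norm_minus_commute[of _ b])
    finally have 2: "?n (\<lambda>x. b x - z * a x) \<le> ?n (\<lambda>x. g x - z * f x) + (\<eta> + cmod z * \<eta>)" by simp
    have "?n f \<le> \<eta> + C * ?n (\<lambda>x. b x - z * a x)"
      using 1 ab(2) bound[OF ab(1)] by simp
    also have "\<dots> \<le> \<eta> + C * (?n (\<lambda>x. g x - z * f x) + (\<eta> + cmod z * \<eta>))"
      using 2 C by (intro add_left_mono mult_left_mono)
    also have "\<dots> = C * ?n (\<lambda>x. g x - z * f x) + \<eta> * (1 + C * (1 + cmod z))"
      by (simp add: algebra_simps)
    also have "\<eta> * (1 + C * (1 + cmod z)) = \<epsilon>" unfolding \<eta>_def using pos by simp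
    finally show "ell2_norm f \<le> C * ell2_norm (\<lambda>x. g x - z * f x) + \<epsilon>" by simp
  qed
  show "\<exists>(f, g)\<in>ell2_op_closure T. h = (\<lambda>x. g x - z * f x)" if h: "h \<in> ell2" for h
  proof -
    have "\<forall>n::nat. \<exists>p. p \<in> T \<and> ?n (\<lambda>x. (snd p x - z * fst p x) - h x) < 1 / (real n + 1)"
      using dense[OF h, of "1 / (real n + 1)" for n] by fastforce
    then obtain p where p: "\<And>n. p n \<in> T" "\<And>n. ?n (\<lambda>x. (snd (p n) x - z * fst (p n) x) - h x) < 1 / (real n + 1)"
      by metis
    define u v where "u n = fst (p n)" and "v n = snd (p n)" for n
    have uv: "(u n, v n) \<in> T" and lim: "?n (\<lambda>x. (v n x - z * u n x) - h x) < 1 / (real n + 1)" for n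
      using p[of n] by (simp_all add: u_def v_def)
    have hL: "h \<in> L2 (count_space UNIV)" using h by simp
    note L = TL[OF uv]
    have wL: "(\<lambda>x. v n x - z * u n x) \<in> L2 (count_space UNIV)" for n
      using L by (intro L2_diff L2_scale)
    have conv: "(\<lambda>n. ?n (\<lambda>x. (v n x - z * u n x) - h x)) \<longlonglongrightarrow> 0"
    proof (rule Lim_null_comparison)
      show "\<forall>\<^sub>F n in sequentially. norm (?n (\<lambda>x. (v n x - z * u n x) - h x)) \<le> inverse (real (Suc n))"
        using lim by (auto intro!: always_eventually less_imp_le simp: field_simps)
    qed (rule LIMSEQ_inverse_real_of_nat)
    obtain f where f: "f \<in> L2 (count_space UNIV)" and uf: "(\<lambda>n. ?n (\<lambda>x. u n x - f x)) \<longlonglongrightarrow> 0"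
    proof (rule L2_complete[OF L(1)])
      fix \<epsilon> :: real assume "0 < \<epsilon>"
      \<comment> \<open>Dividing by \<open>C + 1\<close> instead of C covers the case C = 0 and
        leaves the factor \<open>C / (C + 1)\<close>, which is below 1.\<close>
      then have "0 < \<epsilon> / (C + 1) / 2" using C by simp
      then obtain N where N: "\<And>n. n \<ge> N \<Longrightarrow> ?n (\<lambda>x. (v n x - z * u n x) - h x) < \<epsilon> / (C + 1) / 2"
        using LIMSEQ_D[OF conv] by force
      show "\<exists>N. \<forall>m\<ge>N. \<forall>n\<ge>N. ?n (\<lambda>x. u m x - u n x) < \<epsilon>"
      proof (intro exI allI impI)
        fix m n assume mn: "N \<le> m" "N \<le> n"
        have "?n (\<lambda>x. u m x - u n x) \<le> C * ?n (\<lambda>x. (v m x - v n x) - z * (u m x - u n x))"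
          using bound[OF diff[OF uv uv]] by simp
        also have "\<dots> = C * ?n (\<lambda>x. (v m x - z * u m x) - (v n x - z * u n x))"
          by (simp add: algebra_simps)
        also have "\<dots> \<le> C * (?n (\<lambda>x. (v m x - z * u m x) - h x) + ?n (\<lambda>x. h x - (v n x - z * u n x)))"
          using C by (intro mult_left_mono L2_norm_triangle_diff wL hL)
        also have "\<dots> \<le> C * (\<epsilon> / (C + 1) / 2 + \<epsilon> / (C + 1) / 2)"
          using C N[OF mn(1)] N[OF mn(2)] by (intro mult_left_mono) (simp_all add: L2_norm_minus_commute[of _ h])
        also have "\<dots> = (C / (C + 1)) * \<epsilon>" by (simp only: field_sum_of_halves) simp
        also have "\<dots> < 1 * \<epsilon>" using C \<open>0 < \<epsilon>\<close> by (intro mult_strict_right_mono) auto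
        finally show "?n (\<lambda>x. u m x - u n x) < \<epsilon>" by simp
      qed
    qed
    \<comment> \<open>The only possible image of f, since the difference of g and z f has to be
      h.\<close>
    define g where "g x = h x + z * f x" for x
    have gL: "g \<in> L2 (count_space UNIV)" unfolding g_def by (intro L2_add L2_scale hL f)
    have vg: "(\<lambda>n. ?n (\<lambda>x. v n x - g x)) \<longlonglongrightarrow> 0"
    proof (rule Lim_null_comparison)
      show "\<forall>\<^sub>F n in sequentially. norm (?n (\<lambda>x. v n x - g x))
          \<le> ?n (\<lambda>x. (v n x - z * u n x) - h x) + cmod z * ?n (\<lambda>x. u n x - f x)"
      proof (rule always_eventually, rule allI)
        fix n
        have "v n x - g x = ((v n x - z * u n x) - h x) + z * (u n x - f x)" for x
          by (simp add: g_def algebra_simps)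
        then have "?n (\<lambda>x. v n x - g x) = ?n (\<lambda>x. ((v n x - z * u n x) - h x) + z * (u n x - f x))"
          by presburger
        also have "\<dots> \<le> ?n (\<lambda>x. (v n x - z * u n x) - h x) + ?n (\<lambda>x. z * (u n x - f x))"
          by (intro L2_norm_triangle L2_diff[OF wL hL] L2_scale[OF L2_diff[OF L(1) f]])
        finally show "norm (?n (\<lambda>x. v n x - g x))
            \<le> ?n (\<lambda>x. (v n x - z * u n x) - h x) + cmod z * ?n (\<lambda>x. u n x - f x)"
          by (simp add: L2_norm_scale)
      qed
      show "(\<lambda>n. ?n (\<lambda>x. (v n x - z * u n x) - h x) + cmod z * ?n (\<lambda>x. u n x - f x)) \<longlonglongrightarrow> 0"
        using tendsto_add[OF conv tendsto_mult_left[OF uf, of "cmod z"]] by simp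
    qed
    have "(f, g) \<in> ell2_op_closure T"
      unfolding ell2_op_closure_def
    proof (intro CollectI case_prodI conjI allI impI)
      fix \<epsilon> :: real assume "0 < \<epsilon>"
      then have "\<forall>\<^sub>F n in sequentially. ?n (\<lambda>x. u n x - f x) < \<epsilon> \<and> ?n (\<lambda>x. v n x - g x) < \<epsilon>"
        using order_tendstoD(2)[OF uf] order_tendstoD(2)[OF vg] by (simp add: eventually_conj)
      then obtain n where "?n (\<lambda>x. u n x - f x) < \<epsilon>" "?n (\<lambda>x. v n x - g x) < \<epsilon>"
        by (auto dest: eventually_happens)
      then show "\<exists>(f', g')\<in>T. ell2_norm (\<lambda>x. f x - f' x) < \<epsilon> \<and> ell2_norm (\<lambda>x. g x - g' x) < \<epsilon>"
        using uv[of n] by (intro bexI[of _ "(u n, v n)"]) (auto simp: L2_norm_minus_commute[of _ f] L2_norm_minus_commute[of _ g])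
    qed (use f gL in auto)
    moreover have "h = (\<lambda>x. g x - z * f x)" by (simp add: g_def)
    ultimately show ?thesis by blast
  qed
qed

section \<open>Multiplication operators in dimension one\<close>

lemma fourier_multiplier_cong_AE:
  assumes [measurable]: "m \<in> borel_measurable circle_measure" "m' \<in> borel_measurable circle_measure"
    and AE: "AE \<theta> in circle_measure. m \<theta> = m' \<theta>"
  shows "fourier_multiplier m = fourier_multiplier m'"
proof -
  have sub: "fourier_multiplier m \<subseteq> fourier_multiplier m'"
    if [measurable]: "m \<in> borel_measurable circle_measure" "m' \<in> borel_measurable circle_measure"
      and AE: "AE \<theta> in circle_measure. m \<theta> = m' \<theta>" for m m'
  proof
    fix p assume "p \<in> fourier_multiplier m"
    then obtain g where g: "g \<in> L2 circle_measure" "(\<lambda>\<theta>. complex_of_real (m \<theta>) * g \<theta>) \<in> L2 circle_measure"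
      and p: "p = (inv_fourier g, inv_fourier (\<lambda>\<theta>. complex_of_real (m \<theta>) * g \<theta>))"
      by (auto simp: fourier_multiplier_def L2_circle_eq_L2)
    have [measurable]: "g \<in> borel_measurable circle_measure" using g(1) by measurable
    have L: "(\<lambda>\<theta>. complex_of_real (m' \<theta>) * g \<theta>) \<in> L2 circle_measure"
      by (rule L2_bounded[OF g(2), where C=1]) (use AE in auto)
    have "inv_fourier (\<lambda>\<theta>. complex_of_real (m \<theta>) * g \<theta>) n = inv_fourier (\<lambda>\<theta>. complex_of_real (m' \<theta>) * g \<theta>) n" for n
      unfolding inv_fourier_eq_inner L2_inner_def
      by (rule integral_cong_AE) (measurable, use AE in auto)
    then have "inv_fourier (\<lambda>\<theta>. complex_of_real (m \<theta>) * g \<theta>) = inv_fourier (\<lambda>\<theta>. complex_of_real (m' \<theta>) * g \<theta>)" by blast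
    then show "p \<in> fourier_multiplier m'"
      using p g(1) L by (auto simp: fourier_multiplier_def L2_circle_eq_L2)
  qed
  have "AE \<theta> in circle_measure. m' \<theta> = m \<theta>" using AE by eventually_elim simp
  then show ?thesis using sub[of m m'] sub[of m' m] AE assms by auto
qed

lemma fourier_multiplier_ell2: "fourier_multiplier m \<subseteq> ell2 \<times> ell2"
  by (auto simp: fourier_multiplier_def L2_circle_eq_L2 inv_fourier_ell2)

text \<open>Indicators of the sets where m is close to t are the approximate eigenvectors. On such a
  set m is bounded by \<open>\<bar>t\<bar> + \<epsilon>\<close>, so they lie in the domain even if m
  is unbounded.\<close>

lemma L2_band:
  assumes [measurable]: "m \<in> borel_measurable circle_measure" and "0 < \<epsilon>"
  shows "(\<lambda>\<theta>. indicator {\<theta>. \<bar>m \<theta> - t\<bar> < \<epsilon>} \<theta>) \<in> L2 circle_measure"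
    and "(\<lambda>\<theta>. complex_of_real (m \<theta>) * indicator {\<theta>. \<bar>m \<theta> - t\<bar> < \<epsilon>} \<theta>) \<in> L2 circle_measure"
proof -
  have ind: "indicator {\<theta>. \<bar>m \<theta> - t\<bar> < \<epsilon>} = (\<lambda>\<theta>. if \<bar>m \<theta> - t\<bar> < \<epsilon> then 1 else 0 :: complex)"
    by (auto simp: indicator_def)
  show "(\<lambda>\<theta>. indicator {\<theta>. \<bar>m \<theta> - t\<bar> < \<epsilon>} \<theta>) \<in> L2 circle_measure"
    unfolding ind by (rule finite_measure.L2_bounded_const[OF finite_measure_circle, where C=1]) auto
  show "(\<lambda>\<theta>. complex_of_real (m \<theta>) * indicator {\<theta>. \<bar>m \<theta> - t\<bar> < \<epsilon>} \<theta>) \<in> L2 circle_measure"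
    unfolding ind using \<open>0 < \<epsilon>\<close>
    by (intro finite_measure.L2_bounded_const[OF finite_measure_circle, where C="\<bar>t\<bar> + \<epsilon>"]) auto
qed

lemma L2_norm_band_pos:
  fixes m :: "real \<Rightarrow> real"
  assumes [measurable]: "m \<in> borel_measurable circle_measure" and "0 < \<epsilon>"
    and pos: "emeasure circle_measure {\<theta> \<in> space circle_measure. \<bar>m \<theta> - t\<bar> < \<epsilon>} > 0"
  shows "0 < L2_norm circle_measure (indicator {\<theta>. \<bar>m \<theta> - t\<bar> < \<epsilon>})"
proof (rule ccontr)
  assume "\<not> ?thesis"
  then have "L2_norm circle_measure (indicator {\<theta>. \<bar>m \<theta> - t\<bar> < \<epsilon>}) = 0"
    by (simp add: antisym not_less)
  then have "AE \<theta> in circle_measure. (indicator {\<theta>. \<bar>m \<theta> - t\<bar> < \<epsilon>} \<theta> :: complex) = 0"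
    by (intro L2_norm_eq_zeroD L2_band(1)[OF assms(1,2)])
  then have "AE \<theta> in circle_measure. \<not> \<bar>m \<theta> - t\<bar> < \<epsilon>"
    by eventually_elim (simp add: indicator_def split: if_splits)
  moreover have meas: "{\<theta> \<in> space circle_measure. \<not> \<not> \<bar>m \<theta> - t\<bar> < \<epsilon>} \<in> sets circle_measure"
    by measurable
  ultimately have "emeasure circle_measure {\<theta> \<in> space circle_measure. \<not> \<not> \<bar>m \<theta> - t\<bar> < \<epsilon>} = 0"
    by (simp only: AE_iff_measurable[OF meas refl])
  with pos show False by simp
qed

text \<open>The hypotheses describe \<open>S\<close> as the essential range of m and let no value of
  m fall outside it. For z at distance \<delta> from S, division by m - z is bounded by 1 /
  \<delta>; for z in S, the band indicators violate every lower bound.\<close>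

theorem spectrum_fourier_multiplier:
  assumes m [measurable]: "m \<in> borel_measurable circle_measure"
    and S: "closed S" "\<And>\<theta>. m \<theta> \<in> S"
    and ess: "\<And>t \<epsilon>. t \<in> S \<Longrightarrow> 0 < \<epsilon> \<Longrightarrow>
      emeasure circle_measure {\<theta> \<in> space circle_measure. \<bar>m \<theta> - t\<bar> < \<epsilon>} > 0"
  shows "spectrum (fourier_multiplier m) = complex_of_real ` S"
proof (intro equalityI subsetI)
  fix z assume z: "z \<in> spectrum (fourier_multiplier m)"
  show "z \<in> complex_of_real ` S"
  proof (rule ccontr)
    assume "z \<notin> complex_of_real ` S"
    moreover have "closed (complex_of_real ` S)"
      using S(1) by (intro closed_injective_linear_image) (auto simp: inj_on_def linear_of_real)
    ultimately obtain \<delta> where \<delta>: "0 < \<delta>" "\<And>\<theta>. \<delta> \<le> cmod (complex_of_real (m \<theta>) - z)"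
      using S(2) separate_point_closed[of "complex_of_real ` S" z] by (auto simp: dist_norm norm_minus_commute)
    have "z \<in> resolvent_set (fourier_multiplier m)"
    proof (rule resolvent_setI[OF fourier_multiplier_ell2])
      fix f g f' g' assume "(f, g) \<in> fourier_multiplier m" "(f', g') \<in> fourier_multiplier m"
      then obtain a b where a: "a \<in> L2 circle_measure" "(\<lambda>\<theta>. complex_of_real (m \<theta>) * a \<theta>) \<in> L2 circle_measure"
          "f = inv_fourier a" "g = inv_fourier (\<lambda>\<theta>. complex_of_real (m \<theta>) * a \<theta>)"
        and b: "b \<in> L2 circle_measure" "(\<lambda>\<theta>. complex_of_real (m \<theta>) * b \<theta>) \<in> L2 circle_measure"
          "f' = inv_fourier b" "g' = inv_fourier (\<lambda>\<theta>. complex_of_real (m \<theta>) * b \<theta>)"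
        by (auto simp: fourier_multiplier_def L2_circle_eq_L2)
      show "(\<lambda>x. f x - f' x, \<lambda>x. g x - g' x) \<in> fourier_multiplier m"
        unfolding fourier_multiplier_def L2_circle_eq_L2
        using a b L2_diff[OF a(1) b(1)] L2_diff[OF a(2) b(2)]
        by (auto intro!: exI[of _ "\<lambda>\<theta>. a \<theta> - b \<theta>"] simp: inv_fourier_diff right_diff_distrib)
    next
      fix f g assume "(f, g) \<in> fourier_multiplier m"
      then obtain a where a: "a \<in> L2 circle_measure" "(\<lambda>\<theta>. complex_of_real (m \<theta>) * a \<theta>) \<in> L2 circle_measure"
          and fg: "f = inv_fourier a" "g = inv_fourier (\<lambda>\<theta>. complex_of_real (m \<theta>) * a \<theta>)"
        by (auto simp: fourier_multiplier_def L2_circle_eq_L2)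
      have L: "(\<lambda>\<theta>. complex_of_real (m \<theta>) * a \<theta> - z * a \<theta>) \<in> L2 circle_measure"
        by (intro L2_diff a L2_scale)
      have "L2_norm circle_measure a \<le> (1 / \<delta>) * L2_norm circle_measure (\<lambda>\<theta>. complex_of_real (m \<theta>) * a \<theta> - z * a \<theta>)"
      proof (rule L2_norm_mono[OF L])
        have "\<delta> * cmod (a \<theta>) \<le> cmod (complex_of_real (m \<theta>) * a \<theta> - z * a \<theta>)" for \<theta>
          unfolding left_diff_distrib[symmetric] norm_mult using \<delta>(2) by (intro mult_right_mono) auto
        then show "AE \<theta> in circle_measure. cmod (a \<theta>) \<le> (1 / \<delta>) * cmod (complex_of_real (m \<theta>) * a \<theta> - z * a \<theta>)"
          using \<delta>(1) by (simp add: field_simps)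
      qed (use \<delta>(1) a in auto)
      then show "ell2_norm f \<le> (1 / \<delta>) * ell2_norm (\<lambda>x. g x - z * f x)"
        using Parseval[OF a(1)] Parseval[OF L] fg a by (simp add: inv_fourier_diff inv_fourier_scale L2_scale)
    next
      fix h :: "int \<Rightarrow> complex" assume "h \<in> ell2"
      then obtain a where a: "a \<in> L2 circle_measure" "inv_fourier a = h"
        using Riesz_Fischer by blast
      define b where "b \<theta> = a \<theta> / (complex_of_real (m \<theta>) - z)" for \<theta>
      have [measurable]: "a \<in> borel_measurable circle_measure" using a(1) by measurable
      have nz: "complex_of_real (m \<theta>) - z \<noteq> 0" for \<theta>
        using \<delta>(1) \<delta>(2)[of \<theta>] by auto
      have b: "b \<in> L2 circle_measure"
      proof (rule L2_bounded[OF a(1)])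
        show "b \<in> borel_measurable circle_measure" unfolding b_def by measurable
        show "AE \<theta> in circle_measure. cmod (b \<theta>) \<le> (1 / \<delta>) * cmod (a \<theta>)"
          unfolding b_def norm_divide using \<delta> nz by (auto intro!: AE_I2 divide_left_mono mult_pos_pos)
      qed
      have split: "complex_of_real (m \<theta>) * b \<theta> = a \<theta> + z * b \<theta>" for \<theta>
        using nz[of \<theta>] by (simp add: b_def field_simps)
      have mb: "(\<lambda>\<theta>. complex_of_real (m \<theta>) * b \<theta>) \<in> L2 circle_measure"
        unfolding split by (intro L2_add L2_scale a b)
      have "h = (\<lambda>n. inv_fourier (\<lambda>\<theta>. complex_of_real (m \<theta>) * b \<theta>) n - z * inv_fourier b n)"
        unfolding split using a b by (simp add: inv_fourier_add inv_fourier_scale L2_scale)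
      then show "\<exists>(f, g)\<in>fourier_multiplier m. h = (\<lambda>x. g x - z * f x)"
        using b mb by (intro bexI[of _ "(inv_fourier b, inv_fourier (\<lambda>\<theta>. complex_of_real (m \<theta>) * b \<theta>))"])
          (auto simp: fourier_multiplier_def L2_circle_eq_L2)
    qed
    then show False using z by (simp add: spectrum_def)
  qed
next
  fix z assume "z \<in> complex_of_real ` S"
  then obtain t where t: "t \<in> S" "z = complex_of_real t" by blast
  show "z \<in> spectrum (fourier_multiplier m)"
    unfolding spectrum_def
  proof
    assume "z \<in> resolvent_set (fourier_multiplier m)"
    then obtain C where C: "\<And>f g. (f, g) \<in> fourier_multiplier m \<Longrightarrow> ell2_norm f \<le> C * ell2_norm (\<lambda>x. g x - z * f x)"
      unfolding resolvent_set_def by blast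
    \<comment> \<open>Makes \<open>\<bar>C\<bar> * \<epsilon>\<close> smaller than 1. The modulus is
      taken because the resolvent set does not prescribe the sign of C.\<close>
    define \<epsilon> where "\<epsilon> = 1 / (\<bar>C\<bar> + 1)"
    have \<epsilon>: "0 < \<epsilon>" unfolding \<epsilon>_def by simp
    let ?a = "indicator {\<theta>. \<bar>m \<theta> - t\<bar> < \<epsilon>} :: real \<Rightarrow> complex"
    note a = L2_band[OF m \<epsilon>, of t]
    have L: "(\<lambda>\<theta>. complex_of_real (m \<theta>) * ?a \<theta> - z * ?a \<theta>) \<in> L2 circle_measure"
      by (intro L2_diff a L2_scale)
    have "L2_norm circle_measure ?a \<le> C * L2_norm circle_measure (\<lambda>\<theta>. complex_of_real (m \<theta>) * ?a \<theta> - z * ?a \<theta>)"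
      using C[of "inv_fourier ?a" "inv_fourier (\<lambda>\<theta>. complex_of_real (m \<theta>) * ?a \<theta>)"] Parseval[OF a(1)] Parseval[OF L] a
      by (auto simp: fourier_multiplier_def L2_circle_eq_L2 inv_fourier_diff inv_fourier_scale L2_scale)
    also have "\<dots> \<le> \<bar>C\<bar> * L2_norm circle_measure (\<lambda>\<theta>. complex_of_real (m \<theta>) * ?a \<theta> - z * ?a \<theta>)"
      by (intro mult_right_mono) auto
    also have "\<dots> \<le> \<bar>C\<bar> * (\<epsilon> * L2_norm circle_measure ?a)"
    proof (intro mult_left_mono L2_norm_mono a)
      have "cmod (complex_of_real (m \<theta>) * ?a \<theta> - z * ?a \<theta>) \<le> \<epsilon> * cmod (?a \<theta>)" for \<theta>
        unfolding left_diff_distrib[symmetric] norm_mult t(2) of_real_diff[symmetric] norm_of_real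
        by (auto simp: indicator_def)
      then show "AE \<theta> in circle_measure. cmod (complex_of_real (m \<theta>) * ?a \<theta> - z * ?a \<theta>) \<le> \<epsilon> * cmod (?a \<theta>)"
        by simp
    qed (use \<epsilon> L in auto)
    finally have "1 * L2_norm circle_measure ?a \<le> (\<bar>C\<bar> * \<epsilon>) * L2_norm circle_measure ?a" by simp
    moreover have "0 < L2_norm circle_measure ?a"
      by (rule L2_norm_band_pos[OF m \<epsilon> ess[OF t(1) \<epsilon>]])
    ultimately have "1 \<le> \<bar>C\<bar> * \<epsilon>" by (simp only: mult_le_cancel_right_pos)
    then show False by (simp add: \<epsilon>_def)
  qed
qed


section \<open>Finite sums of tensors under the Fourier transform\<close>

text \<open>Concatenation of two finite families by shifting the second index: the device by which a
  sum of two tensor sums is again a tensor sum.\<close>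

lemma sum_append_index:
  "(\<Sum>k<M + N. h (if k < M then F k else G (k - M))) = (\<Sum>k<M. h (F k)) + (\<Sum>k<N. h (G k))"
  for M N :: nat and h :: "'a \<Rightarrow> 'b::comm_monoid_add"
  by (induction N) (auto simp: add.assoc)

lemma prod_fun_upd_scale:
  fixes F :: "'n::finite \<Rightarrow> complex"
  shows "(\<Prod>i\<in>UNIV. (F(j := c * F j)) i) = c * (\<Prod>i\<in>UNIV. F i)"
proof -
  have "(\<Prod>i\<in>UNIV. (F(j := c * F j)) i) = (F(j := c * F j)) j * (\<Prod>i\<in>UNIV - {j}. (F(j := c * F j)) i)"
    by (rule prod.remove) auto
  also have "(\<Prod>i\<in>UNIV - {j}. (F(j := c * F j)) i) = (\<Prod>i\<in>UNIV - {j}. F i)"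
    by (rule prod.cong) auto
  also have "(F(j := c * F j)) j * (\<Prod>i\<in>UNIV - {j}. F i) = c * (F j * (\<Prod>i\<in>UNIV - {j}. F i))"
    by simp
  also have "F j * (\<Prod>i\<in>UNIV - {j}. F i) = (\<Prod>i\<in>UNIV. F i)"
    by (rule prod.remove[symmetric]) auto
  finally show ?thesis .
qed

text \<open>A constant w gives scalar multiples of a tensor; w equal to the symbol
  \<open>m j\<close> gives the j-th summand of the operator.\<close>

lemma prod_fun_upd_apply_scale:
  fixes \<phi> :: "'n::finite \<Rightarrow> 'a \<Rightarrow> complex"
  shows "(\<Prod>i\<in>UNIV. (\<phi>(j := (\<lambda>t. w t * \<phi> j t))) i (x i)) = w (x j) * (\<Prod>i\<in>UNIV. \<phi> i (x i))"
proof -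
  have "(\<phi>(j := (\<lambda>t. w t * \<phi> j t))) i (x i) = ((\<lambda>i. \<phi> i (x i))(j := w (x j) * \<phi> j (x j))) i" for i
    by simp
  then show ?thesis
    using prod_fun_upd_scale[of "\<lambda>i. \<phi> i (x i)" j "w (x j)"] by simp
qed

lemma pure_tensor_fun_upd_scale:
  "pure_tensor (F(j := (\<lambda>n. c * F j n))) x = c * pure_tensor F x"
  unfolding pure_tensor_def by (rule prod_fun_upd_apply_scale)

lemma alg_tensor_sum_add:
  assumes "(u, v) \<in> alg_tensor_sum A" "(u', v') \<in> alg_tensor_sum A"
  shows "(\<lambda>x. u x + u' x, \<lambda>x. v x + v' x) \<in> alg_tensor_sum A"
proof -
  from assms obtain N F G N' F' G' where
    1: "u = (\<lambda>x. \<Sum>k<N. pure_tensor (F k) x)" "v = (\<lambda>x. \<Sum>k<N. \<Sum>j\<in>UNIV. pure_tensor ((F k)(j := G k j)) x)"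
      "\<forall>k<N::nat. \<forall>j. (F k j, G k j) \<in> A j" and
    2: "u' = (\<lambda>x. \<Sum>k<N'. pure_tensor (F' k) x)" "v' = (\<lambda>x. \<Sum>k<N'. \<Sum>j\<in>UNIV. pure_tensor ((F' k)(j := G' k j)) x)"
      "\<forall>k<N'::nat. \<forall>j. (F' k j, G' k j) \<in> A j"
    unfolding alg_tensor_sum_def by blast
  define P where "P k = (if k < N then (F k, G k) else (F' (k - N), G' (k - N)))" for k
  have "(\<lambda>x. u x + u' x) = (\<lambda>x. \<Sum>k<N + N'. pure_tensor (fst (P k)) x)"
    using sum_append_index[where F="\<lambda>k. (F k, G k)" and G="\<lambda>k. (F' k, G' k)" and h="\<lambda>p. pure_tensor (fst p) x" for x]
    by (simp add: 1 2 P_def fun_eq_iff)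
  moreover have "(\<lambda>x. v x + v' x) = (\<lambda>x. \<Sum>k<N + N'. \<Sum>j\<in>UNIV. pure_tensor ((fst (P k))(j := snd (P k) j)) x)"
    using sum_append_index[where F="\<lambda>k. (F k, G k)" and G="\<lambda>k. (F' k, G' k)"
        and h="\<lambda>p. \<Sum>j\<in>UNIV. pure_tensor ((fst p)(j := snd p j)) x" for x]
    by (simp add: 1 2 P_def fun_eq_iff)
  moreover have "\<forall>k<N + N'. \<forall>j. (fst (P k) j, snd (P k) j) \<in> A j"
    using 1(3) 2(3) by (auto simp: P_def)
  ultimately show ?thesis
    unfolding alg_tensor_sum_def
    by (intro CollectI exI[of _ "N + N'"] exI[of _ "\<lambda>k. fst (P k)"] exI[of _ "\<lambda>k. snd (P k)"]) simp
qed

lemma alg_tensor_sum_scale: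
  assumes A: "\<And>j f g. (f, g) \<in> A j \<Longrightarrow> (\<lambda>n. c * f n, \<lambda>n. c * g n) \<in> A j"
    and "(u, v) \<in> alg_tensor_sum A"
  shows "(\<lambda>x. c * u x, \<lambda>x. c * v x) \<in> alg_tensor_sum A"
proof -
  from assms(2) obtain N F G where
    1: "u = (\<lambda>x. \<Sum>k<N. pure_tensor (F k) x)" "v = (\<lambda>x. \<Sum>k<N. \<Sum>j\<in>UNIV. pure_tensor ((F k)(j := G k j)) x)"
      "\<forall>k<N::nat. \<forall>j. (F k j, G k j) \<in> A j"
    unfolding alg_tensor_sum_def by blast
  \<comment> \<open>Any coordinate serves, and types are nonempty. The scalar goes into factor i of
    both F and G, so exactly one copy survives when factor j is replaced, whether or not j =
    i.\<close>
  define i where "i = (undefined :: 'a)"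
  define F' where "F' k = (F k)(i := (\<lambda>n. c * F k i n))" for k
  define G' where "G' k = (G k)(i := (\<lambda>n. c * G k i n))" for k
  have "(\<lambda>x. c * u x) = (\<lambda>x. \<Sum>k<N. pure_tensor (F' k) x)"
    by (simp add: 1 F'_def pure_tensor_fun_upd_scale sum_distrib_left)
  moreover have "pure_tensor ((F' k)(j := G' k j)) x = c * pure_tensor ((F k)(j := G k j)) x" for k j x
  proof -
    have "(F' k)(j := G' k j) = ((F k)(j := G k j))(i := (\<lambda>n. c * ((F k)(j := G k j)) i n))"
      by (auto simp: F'_def G'_def fun_eq_iff)
    then show ?thesis by (simp only: pure_tensor_fun_upd_scale)
  qed
  then have "(\<lambda>x. c * v x) = (\<lambda>x. \<Sum>k<N. \<Sum>j\<in>UNIV. pure_tensor ((F' k)(j := G' k j)) x)"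
    by (simp add: 1 sum_distrib_left)
  moreover have "\<forall>k<N. \<forall>j. (F' k j, G' k j) \<in> A j"
    using 1(3) A by (auto simp: F'_def G'_def)
  ultimately show ?thesis
    unfolding alg_tensor_sum_def by blast
qed

section \<open>Tensor sums on the lattice and on the torus\<close>

lemma bij_vec_nth: "bij (vec_nth :: 'a ^ 'n \<Rightarrow> 'n \<Rightarrow> 'a)"
  by (rule o_bij[where g=vec_lambda]) (auto simp: fun_eq_iff)

text \<open>Lattice points are vectors, whereas product measures live on functions; the coordinate
  bijection passes between the two.\<close>

lemma ell2_vec_nth:
  fixes G :: "('n::finite \<Rightarrow> int) \<Rightarrow> complex"
  shows "(\<lambda>x :: int ^ 'n. G (vec_nth x)) \<in> ell2 \<longleftrightarrow> G \<in> ell2"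
    and "ell2_norm (\<lambda>x :: int ^ 'n. G (vec_nth x)) = ell2_norm G"
  unfolding ell2_def ell2_norm_def
  using summable_on_reindex_bij_betw[OF bij_vec_nth, of "\<lambda>y. (cmod (G y))\<^sup>2"]
    infsum_reindex_bij_betw[OF bij_vec_nth, of "\<lambda>y. (cmod (G y))\<^sup>2"]
  by simp_all

text \<open>Turns the lattice into a finite product of measure spaces like the torus, so that the
  tensor lemmas apply on both sides.\<close>

lemma PiM_count_space_int: "Pi\<^sub>M UNIV (\<lambda>_::'n::finite. count_space (UNIV :: int set)) = count_space UNIV"
  by (subst count_space_PiM_finite) auto

lemma sigma_finite_count_space_int: "sigma_finite_measure (count_space (UNIV :: int set))"
  by (rule sigma_finite_measure_count_space_countable) simp

abbreviation torus_measure :: "('n::finite \<Rightarrow> real) measure" where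
  "torus_measure \<equiv> Pi\<^sub>M UNIV (\<lambda>_. circle_measure)"

definition tensor_sum :: "nat \<Rightarrow> (nat \<Rightarrow> 'n::finite \<Rightarrow> real \<Rightarrow> complex) \<Rightarrow> ('n \<Rightarrow> real) \<Rightarrow> complex" where
  "tensor_sum N \<phi> x = (\<Sum>k<N. \<Prod>j\<in>UNIV. \<phi> k j (x j))"

definition inv_fourier_tensor_sum :: "nat \<Rightarrow> (nat \<Rightarrow> 'n::finite \<Rightarrow> real \<Rightarrow> complex) \<Rightarrow> int ^ 'n \<Rightarrow> complex" where
  "inv_fourier_tensor_sum N \<phi> x = (\<Sum>k<N. pure_tensor (\<lambda>j. inv_fourier (\<phi> k j)) x)"

text \<open>As a relation, the Fourier isometry needs no proof that the image of a sum of tensors is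
  independent of its representation: this follows from \<open>fourier_rel_isometry\<close>.\<close>

definition fourier_rel :: "((('n::finite \<Rightarrow> real) \<Rightarrow> complex) \<times> (int ^ 'n \<Rightarrow> complex)) set" where
  "fourier_rel = {(tensor_sum N \<phi>, inv_fourier_tensor_sum N \<phi>) | N \<phi>. \<forall>k<N. \<forall>j. \<phi> k j \<in> L2 circle_measure}"

lemma tensor_sum_append:
  "tensor_sum (M + N) (\<lambda>k. if k < M then \<phi> k else \<psi> (k - M)) x = tensor_sum M \<phi> x + tensor_sum N \<psi> x"
  using sum_append_index[where F=\<phi> and G=\<psi> and h="\<lambda>\<phi>. \<Prod>j\<in>UNIV. \<phi> j (x j)"]
  by (simp add: tensor_sum_def)

lemma inv_fourier_tensor_sum_append:
  "inv_fourier_tensor_sum (M + N) (\<lambda>k. if k < M then \<phi> k else \<psi> (k - M)) x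
    = inv_fourier_tensor_sum M \<phi> x + inv_fourier_tensor_sum N \<psi> x"
  using sum_append_index[where F=\<phi> and G=\<psi> and h="\<lambda>\<phi>. pure_tensor (\<lambda>j. inv_fourier (\<phi> j)) x"]
  by (simp add: inv_fourier_tensor_sum_def)

lemma tensor_sum_scale:
  "tensor_sum N (\<lambda>k. (\<phi> k)(j := (\<lambda>\<theta>. w \<theta> * \<phi> k j \<theta>))) x = w (x j) * tensor_sum N \<phi> x"
  unfolding tensor_sum_def by (simp only: prod_fun_upd_apply_scale sum_distrib_left)

lemma inv_fourier_tensor_sum_scale:
  "inv_fourier_tensor_sum N (\<lambda>k. (\<phi> k)(j := (\<lambda>\<theta>. c * \<phi> k j \<theta>))) x = c * inv_fourier_tensor_sum N \<phi> x"
proof -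
  have "(\<lambda>i. inv_fourier (((\<phi> k)(j := (\<lambda>\<theta>. c * \<phi> k j \<theta>))) i))
      = (\<lambda>i. inv_fourier (\<phi> k i))(j := (\<lambda>n. c * inv_fourier (\<phi> k j) n))" for k
    by (auto simp: fun_eq_iff inv_fourier_scale)
  then show ?thesis
    unfolding inv_fourier_tensor_sum_def sum_distrib_left
    using pure_tensor_fun_upd_scale[of "\<lambda>i. inv_fourier (\<phi> k i)" j c x for k] by simp
qed

lemma fourier_rel_L2: "(f, u) \<in> fourier_rel \<Longrightarrow> f \<in> L2 torus_measure"
  unfolding fourier_rel_def tensor_sum_def[abs_def]
  by (auto intro!: L2_sum L2_tensor sigma_finite_measure_circle)

lemma inv_fourier_L2: "g \<in> L2 circle_measure \<Longrightarrow> inv_fourier g \<in> L2 (count_space UNIV)"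
  using inv_fourier_ell2 by (simp add: ell2_eq_L2)

text \<open>By \<open>Parseval_inner\<close> the factors on the lattice side and on the circle side
  have the same Gram matrices.\<close>

lemma fourier_rel_isometry:
  fixes f :: "('n::finite \<Rightarrow> real) \<Rightarrow> complex" and u :: "int ^ 'n \<Rightarrow> complex"
  assumes "(f, u) \<in> fourier_rel"
  shows "u \<in> ell2" "ell2_norm u = L2_norm torus_measure f"
proof -
  obtain N \<phi> where f: "f = tensor_sum N \<phi>" and u: "u = inv_fourier_tensor_sum N \<phi>"
    and \<phi>: "\<And>k j. k < N \<Longrightarrow> \<phi> k j \<in> L2 circle_measure"
    using assms unfolding fourier_rel_def by blast
  define G where "G y = (\<Sum>k<N. \<Prod>j\<in>UNIV. inv_fourier (\<phi> k j) (y j))" for y :: "'n \<Rightarrow> int"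
  have u: "u = (\<lambda>x. G (vec_nth x))"
    unfolding u inv_fourier_tensor_sum_def[abs_def] pure_tensor_def G_def ..
  have "G \<in> L2 (Pi\<^sub>M UNIV (\<lambda>_. count_space UNIV))"
    unfolding G_def using \<phi> by (intro L2_sum L2_tensor sigma_finite_count_space_int inv_fourier_L2) auto
  then have "G \<in> ell2" by (simp add: PiM_count_space_int ell2_eq_L2)
  then show "u \<in> ell2" unfolding u by (simp add: ell2_vec_nth)
  have "ell2_norm u = L2_norm (Pi\<^sub>M UNIV (\<lambda>_. count_space UNIV)) G"
    unfolding u ell2_vec_nth by (simp add: PiM_count_space_int ell2_norm_eq_L2_norm)
  also have "\<dots> = L2_norm torus_measure f"
    unfolding G_def f tensor_sum_def[abs_def]
    by (rule L2_norm_sum_tensor_cong)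
      (auto simp: sigma_finite_count_space_int sigma_finite_measure_circle inv_fourier_L2 Parseval_inner \<phi>)
  finally show "ell2_norm u = L2_norm torus_measure f" .
qed

lemma fourier_rel_add:
  assumes "(f, u) \<in> fourier_rel" "(g, v) \<in> fourier_rel"
  shows "(\<lambda>x. f x + g x, \<lambda>x. u x + v x) \<in> fourier_rel"
proof -
  obtain M \<phi> N \<psi> where 1: "f = tensor_sum M \<phi>" "u = inv_fourier_tensor_sum M \<phi>" "\<forall>k<M. \<forall>j. \<phi> k j \<in> L2 circle_measure"
    and 2: "g = tensor_sum N \<psi>" "v = inv_fourier_tensor_sum N \<psi>" "\<forall>k<N. \<forall>j. \<psi> k j \<in> L2 circle_measure"
    using assms unfolding fourier_rel_def by blast
  have "(tensor_sum (M + N) (\<lambda>k. if k < M then \<phi> k else \<psi> (k - M)),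
      inv_fourier_tensor_sum (M + N) (\<lambda>k. if k < M then \<phi> k else \<psi> (k - M))) \<in> fourier_rel"
    unfolding fourier_rel_def using 1(3) 2(3)
    by (intro CollectI exI[of _ "M + N"] exI[of _ "\<lambda>k. if k < M then \<phi> k else \<psi> (k - M)"]) auto
  then show ?thesis
    unfolding tensor_sum_append[abs_def] inv_fourier_tensor_sum_append[abs_def] 1 2 .
qed

lemma fourier_rel_scale:
  assumes "(f, u) \<in> fourier_rel"
  shows "(\<lambda>x. c * f x, \<lambda>x. c * u x) \<in> fourier_rel"
proof -
  obtain N \<phi> where 1: "f = tensor_sum N \<phi>" "u = inv_fourier_tensor_sum N \<phi>" "\<forall>k<N. \<forall>j. \<phi> k j \<in> L2 circle_measure"
    using assms unfolding fourier_rel_def by blast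
  define \<psi> where "\<psi> k = (\<phi> k)(undefined := (\<lambda>\<theta>. c * \<phi> k undefined \<theta>))" for k
  have "(tensor_sum N \<psi>, inv_fourier_tensor_sum N \<psi>) \<in> fourier_rel"
    unfolding fourier_rel_def using 1(3)
    by (intro CollectI exI[of _ N] exI[of _ \<psi>]) (auto simp: \<psi>_def intro: L2_scale)
  then show ?thesis
    unfolding \<psi>_def[abs_def] 1 inv_fourier_tensor_sum_scale[of N \<phi> undefined c, abs_def]
      tensor_sum_scale[of N \<phi> undefined "\<lambda>_. c", abs_def] .
qed

lemma fourier_rel_diff:
  assumes "(f, u) \<in> fourier_rel" "(g, v) \<in> fourier_rel"
  shows "(\<lambda>x. f x - g x, \<lambda>x. u x - v x) \<in> fourier_rel"
  using fourier_rel_add[OF assms(1) fourier_rel_scale[OF assms(2), of "- 1"]] by simp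

lemma fourier_rel_zero: "(\<lambda>x. 0, \<lambda>x. 0) \<in> fourier_rel"
  unfolding fourier_rel_def
  by (intro CollectI exI[of _ 0] exI) (auto simp: tensor_sum_def[abs_def] inv_fourier_tensor_sum_def[abs_def])

lemma fourier_rel_sum:
  "(\<And>i. i \<in> I \<Longrightarrow> (f i, u i) \<in> fourier_rel) \<Longrightarrow> (\<lambda>x. \<Sum>i\<in>I. f i x, \<lambda>x. \<Sum>i\<in>I. u i x) \<in> fourier_rel"
  by (induction I rule: infinite_finite_induct) (auto intro: fourier_rel_zero fourier_rel_add)

section \<open>The tensor sum of multiplication operators\<close>

locale multiplier_family =
  fixes m :: "'n::finite \<Rightarrow> real \<Rightarrow> real"
  assumes m_measurable [measurable]: "m j \<in> borel_measurable circle_measure"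
begin

abbreviation op :: "(int ^ 'n) operator" where
  "op \<equiv> alg_tensor_sum (\<lambda>j. fourier_multiplier (m j))"

definition symb :: "('n \<Rightarrow> real) \<Rightarrow> real" where
  "symb x = (\<Sum>j\<in>UNIV. m j (x j))"

definition op_image :: "nat \<Rightarrow> (nat \<Rightarrow> 'n \<Rightarrow> real \<Rightarrow> complex) \<Rightarrow> int ^ 'n \<Rightarrow> complex" where
  "op_image N \<phi> = (\<lambda>x. \<Sum>k<N. \<Sum>j\<in>UNIV. pure_tensor ((\<lambda>i. inv_fourier (\<phi> k i))(j := inv_fourier (\<lambda>\<theta>. complex_of_real (m j \<theta>) * \<phi> k j \<theta>))) x)"

text \<open>The intertwining relation: under \<open>fourier_rel\<close> the operator becomes
  multiplication by \<open>symb\<close>. Its j-th summand multiplies factor j of each tensor by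
  \<open>m j\<close>, hence the whole tensor by \<open>m j (x j)\<close>.\<close>

lemma op_intro:
  assumes \<phi>: "\<And>k j. k < N \<Longrightarrow> \<phi> k j \<in> L2 circle_measure"
    and m\<phi>: "\<And>k j. k < N \<Longrightarrow> (\<lambda>\<theta>. complex_of_real (m j \<theta>) * \<phi> k j \<theta>) \<in> L2 circle_measure"
  shows "(inv_fourier_tensor_sum N \<phi>, op_image N \<phi>) \<in> op"
    and "(tensor_sum N \<phi>, inv_fourier_tensor_sum N \<phi>) \<in> fourier_rel"
    and "(\<lambda>x. complex_of_real (symb x) * tensor_sum N \<phi> x, op_image N \<phi>) \<in> fourier_rel"
proof -
  show "(tensor_sum N \<phi>, inv_fourier_tensor_sum N \<phi>) \<in> fourier_rel"
    unfolding fourier_rel_def using \<phi> by blast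
  show "(inv_fourier_tensor_sum N \<phi>, op_image N \<phi>) \<in> op"
    unfolding alg_tensor_sum_def inv_fourier_tensor_sum_def[abs_def] op_image_def
    by (intro CollectI exI[of _ N] exI[of _ "\<lambda>k j. inv_fourier (\<phi> k j)"]
        exI[of _ "\<lambda>k j. inv_fourier (\<lambda>\<theta>. complex_of_real (m j \<theta>) * \<phi> k j \<theta>)"])
      (auto simp: fourier_multiplier_def L2_circle_eq_L2 \<phi> m\<phi>)
  define \<psi> where "\<psi> j k = (\<phi> k)(j := (\<lambda>\<theta>. complex_of_real (m j \<theta>) * \<phi> k j \<theta>))" for j k
  have "(\<lambda>x. \<Sum>j\<in>UNIV. tensor_sum N (\<psi> j) x, \<lambda>x. \<Sum>j\<in>UNIV. inv_fourier_tensor_sum N (\<psi> j) x) \<in> fourier_rel"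
  proof (rule fourier_rel_sum)
    show "(tensor_sum N (\<psi> j), inv_fourier_tensor_sum N (\<psi> j)) \<in> fourier_rel" for j
      unfolding fourier_rel_def
      by (intro CollectI exI[of _ N] exI[of _ "\<psi> j"]) (auto simp: \<psi>_def \<phi> m\<phi>)
  qed
  moreover have "(\<Sum>j\<in>UNIV. tensor_sum N (\<psi> j) x) = complex_of_real (symb x) * tensor_sum N \<phi> x" for x
    using tensor_sum_scale[of N \<phi> j "\<lambda>\<theta>. complex_of_real (m j \<theta>)" x for j]
    unfolding \<psi>_def[abs_def] by (simp add: symb_def sum_distrib_right)
  moreover have "(\<lambda>x. \<Sum>j\<in>UNIV. inv_fourier_tensor_sum N (\<psi> j) x) = op_image N \<phi>"
  proof
    fix x
    have "(\<lambda>i. inv_fourier (\<psi> j k i))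
        = (\<lambda>i. inv_fourier (\<phi> k i))(j := inv_fourier (\<lambda>\<theta>. complex_of_real (m j \<theta>) * \<phi> k j \<theta>))" for j k
      by (auto simp: \<psi>_def fun_eq_iff)
    then show "(\<Sum>j\<in>UNIV. inv_fourier_tensor_sum N (\<psi> j) x) = op_image N \<phi> x"
      unfolding inv_fourier_tensor_sum_def op_image_def by (subst sum.swap) simp
  qed
  ultimately show "(\<lambda>x. complex_of_real (symb x) * tensor_sum N \<phi> x, op_image N \<phi>) \<in> fourier_rel"
    by simp
qed

text \<open>The graph only supplies the existence of a preimage on the circle for each factor, so
  preimages are chosen for all k and j at once; after that \<open>op_intro\<close> applies to the
  chosen family.\<close>

lemma op_elim:
  assumes "(u, v) \<in> op"
  obtains f where "(f, u) \<in> fourier_rel" "(\<lambda>x. complex_of_real (symb x) * f x, v) \<in> fourier_rel"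
proof -
  obtain N F G where u: "u = (\<lambda>x. \<Sum>k<N. pure_tensor (F k) x)"
      and v: "v = (\<lambda>x. \<Sum>k<N. \<Sum>j\<in>UNIV. pure_tensor ((F k)(j := G k j)) x)"
      and FG: "\<forall>k<N::nat. \<forall>j. (F k j, G k j) \<in> fourier_multiplier (m j)"
    using assms unfolding alg_tensor_sum_def by blast
  define P where "P k j g \<longleftrightarrow> F k j = inv_fourier g \<and> G k j = inv_fourier (\<lambda>\<theta>. complex_of_real (m j \<theta>) * g \<theta>)
      \<and> g \<in> L2 circle_measure \<and> (\<lambda>\<theta>. complex_of_real (m j \<theta>) * g \<theta>) \<in> L2 circle_measure" for k j g
  define \<phi> where "\<phi> k j = (SOME g. P k j g)" for k j
  have "\<exists>g. P k j g" if "k < N" for k j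
    using FG that unfolding fourier_multiplier_def L2_circle_eq_L2 P_def by fast
  then have "P k j (\<phi> k j)" if "k < N" for k j
    unfolding \<phi>_def using that by (intro someI_ex[of "P k j"])
  then have \<phi>: "\<And>k j. k < N \<Longrightarrow> F k j = inv_fourier (\<phi> k j)"
      "\<And>k j. k < N \<Longrightarrow> G k j = inv_fourier (\<lambda>\<theta>. complex_of_real (m j \<theta>) * \<phi> k j \<theta>)"
      "\<And>k j. k < N \<Longrightarrow> \<phi> k j \<in> L2 circle_measure"
      "\<And>k j. k < N \<Longrightarrow> (\<lambda>\<theta>. complex_of_real (m j \<theta>) * \<phi> k j \<theta>) \<in> L2 circle_measure"
    unfolding P_def by simp_all
  have F: "F k = (\<lambda>j. inv_fourier (\<phi> k j))" if "k < N" for k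
    using \<phi>(1)[OF that] by (simp add: fun_eq_iff)
  have "u = inv_fourier_tensor_sum N \<phi>"
    unfolding u inv_fourier_tensor_sum_def[abs_def] by (simp add: F)
  moreover have "v = op_image N \<phi>"
    unfolding v op_image_def by (simp add: F \<phi>(2))
  ultimately show thesis
    using that[of "tensor_sum N \<phi>"] op_intro(2,3)[of N \<phi>, OF \<phi>(3,4)] by simp
qed

lemma op_scale: "(u, v) \<in> op \<Longrightarrow> (\<lambda>x. c * u x, \<lambda>x. c * v x) \<in> op"
proof (rule alg_tensor_sum_scale)
  fix j f g assume "(f, g) \<in> fourier_multiplier (m j)"
  then obtain a where a: "a \<in> L2 circle_measure" "(\<lambda>\<theta>. complex_of_real (m j \<theta>) * a \<theta>) \<in> L2 circle_measure"
      and fg: "f = inv_fourier a" "g = inv_fourier (\<lambda>\<theta>. complex_of_real (m j \<theta>) * a \<theta>)"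
    by (auto simp: fourier_multiplier_def L2_circle_eq_L2)
  show "(\<lambda>n. c * f n, \<lambda>n. c * g n) \<in> fourier_multiplier (m j)"
    unfolding fourier_multiplier_def L2_circle_eq_L2
    using L2_scale[OF a(1), of c] L2_scale[OF a(2), of c] fg
    by (auto intro!: exI[of _ "\<lambda>\<theta>. c * a \<theta>"] simp: inv_fourier_scale mult.left_commute[of _ c])
qed

lemma op_diff: "(u, v) \<in> op \<Longrightarrow> (u', v') \<in> op \<Longrightarrow> (\<lambda>x. u x - u' x, \<lambda>x. v x - v' x) \<in> op"
  using alg_tensor_sum_add[OF _ op_scale[of u' v' "- 1"], of u v] by simp

lemma op_ell2: "op \<subseteq> ell2 \<times> ell2"
proof clarify
  fix u v assume "(u, v) \<in> op"
  then obtain f where "(f, u) \<in> fourier_rel" "(\<lambda>x. complex_of_real (symb x) * f x, v) \<in> fourier_rel"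
    by (rule op_elim)
  then show "u \<in> ell2 \<and> v \<in> ell2" by (simp add: fourier_rel_isometry)
qed

lemma fourier_rel_resolvent:
  assumes "(f, u) \<in> fourier_rel" "(\<lambda>x. complex_of_real (symb x) * f x, v) \<in> fourier_rel"
  shows "(\<lambda>x. (complex_of_real (symb x) - z) * f x, \<lambda>x. v x - z * u x) \<in> fourier_rel"
  using fourier_rel_diff[OF assms(2) fourier_rel_scale[OF assms(1), of z]] by (simp add: left_diff_distrib)

lemma op_bound:
  assumes \<delta>: "0 < \<delta>" "\<And>x. \<delta> \<le> cmod (complex_of_real (symb x) - z)"
    and "(u, v) \<in> op"
  shows "ell2_norm u \<le> (1 / \<delta>) * ell2_norm (\<lambda>x. v x - z * u x)"
proof -
  obtain f where f: "(f, u) \<in> fourier_rel" "(\<lambda>x. complex_of_real (symb x) * f x, v) \<in> fourier_rel"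
    using assms(3) by (rule op_elim)
  note r = fourier_rel_resolvent[OF f, of z]
  have "L2_norm torus_measure f \<le> (1 / \<delta>) * L2_norm torus_measure (\<lambda>x. (complex_of_real (symb x) - z) * f x)"
  proof (rule L2_norm_mono[OF fourier_rel_L2[OF r]])
    have "\<delta> * cmod (f x) \<le> cmod ((complex_of_real (symb x) - z) * f x)" for x
      unfolding norm_mult using \<delta>(2) by (intro mult_right_mono) auto
    then show "AE x in torus_measure. cmod (f x) \<le> (1 / \<delta>) * cmod ((complex_of_real (symb x) - z) * f x)"
      using \<delta>(1) by (simp add: field_simps)
  qed (use \<delta>(1) L2_measurable[OF fourier_rel_L2[OF f(1)]] in auto)
  then show ?thesis
    by (simp only: fourier_rel_isometry(2)[OF f(1)] fourier_rel_isometry(2)[OF r])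
qed

text \<open>On factors supported where \<open>\<bar>m j\<bar> \<le> K\<close>, multiplication by
  \<open>m j\<close> is bounded. So this space lies in the domain and, unlike the domain itself, is
  stable under repeated multiplication by the symbol.\<close>

definition cutoff :: "real \<Rightarrow> (('n \<Rightarrow> real) \<Rightarrow> complex) set" where
  "cutoff K = {tensor_sum N \<phi> | N \<phi>. \<forall>k<N. \<forall>j. \<phi> k j \<in> L2 circle_measure \<and> (\<forall>\<theta>. K < \<bar>m j \<theta>\<bar> \<longrightarrow> \<phi> k j \<theta> = 0)}"

lemma L2_cutoff_mult:
  assumes "g \<in> L2 circle_measure" "\<And>\<theta>. K < \<bar>m j \<theta>\<bar> \<Longrightarrow> g \<theta> = 0"
  shows "(\<lambda>\<theta>. complex_of_real (m j \<theta>) * g \<theta>) \<in> L2 circle_measure"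
proof (rule L2_bounded[OF assms(1)])
  show "(\<lambda>\<theta>. complex_of_real (m j \<theta>) * g \<theta>) \<in> borel_measurable circle_measure"
    using assms(1) by measurable
  have "\<bar>m j \<theta>\<bar> * cmod (g \<theta>) \<le> K * cmod (g \<theta>)" for \<theta>
    using assms(2)[of \<theta>] by (cases "K < \<bar>m j \<theta>\<bar>") (auto intro: mult_right_mono)
  then show "AE \<theta> in circle_measure. cmod (complex_of_real (m j \<theta>) * g \<theta>) \<le> K * cmod (g \<theta>)"
    by (simp add: norm_mult)
qed

lemma cutoff_op:
  assumes "f \<in> cutoff K"
  obtains u v where "(u, v) \<in> op" "(f, u) \<in> fourier_rel" "(\<lambda>x. complex_of_real (symb x) * f x, v) \<in> fourier_rel"
proof -
  obtain N \<phi> where f: "f = tensor_sum N \<phi>"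
      and \<phi>: "\<forall>k<N. \<forall>j. \<phi> k j \<in> L2 circle_measure \<and> (\<forall>\<theta>. K < \<bar>m j \<theta>\<bar> \<longrightarrow> \<phi> k j \<theta> = 0)"
    using assms unfolding cutoff_def by blast
  have "\<phi> k j \<in> L2 circle_measure" if "k < N" for k j
    using \<phi> that by auto
  moreover have "(\<lambda>\<theta>. complex_of_real (m j \<theta>) * \<phi> k j \<theta>) \<in> L2 circle_measure" if "k < N" for k j
    using \<phi> that by (auto intro: L2_cutoff_mult)
  ultimately show thesis
    using that[of "inv_fourier_tensor_sum N \<phi>" "op_image N \<phi>"] op_intro[of N \<phi>] unfolding f by blast
qed

lemma cutoff_add:
  assumes "f \<in> cutoff K" "g \<in> cutoff K"
  shows "(\<lambda>x. f x + g x) \<in> cutoff K"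
proof -
  obtain M \<phi> N \<psi> where 1: "f = tensor_sum M \<phi>"
      "\<forall>k<M. \<forall>j. \<phi> k j \<in> L2 circle_measure \<and> (\<forall>\<theta>. K < \<bar>m j \<theta>\<bar> \<longrightarrow> \<phi> k j \<theta> = 0)"
    and 2: "g = tensor_sum N \<psi>"
      "\<forall>k<N. \<forall>j. \<psi> k j \<in> L2 circle_measure \<and> (\<forall>\<theta>. K < \<bar>m j \<theta>\<bar> \<longrightarrow> \<psi> k j \<theta> = 0)"
    using assms unfolding cutoff_def by blast
  have "tensor_sum (M + N) (\<lambda>k. if k < M then \<phi> k else \<psi> (k - M)) \<in> cutoff K"
    unfolding cutoff_def using 1(2) 2(2)
    by (intro CollectI exI[of _ "M + N"] exI[of _ "\<lambda>k. if k < M then \<phi> k else \<psi> (k - M)"]) auto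
  then show ?thesis
    unfolding tensor_sum_append[abs_def] 1 2 .
qed

text \<open>The condition on w is restricted to functions vanishing where
  \<open>\<bar>m j\<bar>\<close> exceeds K, so that w may be the possibly unbounded
  \<open>m j\<close>.\<close>

lemma cutoff_mult:
  assumes "f \<in> cutoff K"
    and w: "\<And>g. g \<in> L2 circle_measure \<Longrightarrow> (\<forall>\<theta>. K < \<bar>m j \<theta>\<bar> \<longrightarrow> g \<theta> = 0) \<Longrightarrow> (\<lambda>\<theta>. w \<theta> * g \<theta>) \<in> L2 circle_measure"
  shows "(\<lambda>x. w (x j) * f x) \<in> cutoff K"
proof -
  obtain N \<phi> where 1: "f = tensor_sum N \<phi>"
      "\<forall>k<N. \<forall>j. \<phi> k j \<in> L2 circle_measure \<and> (\<forall>\<theta>. K < \<bar>m j \<theta>\<bar> \<longrightarrow> \<phi> k j \<theta> = 0)"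
    using assms unfolding cutoff_def by blast
  have "tensor_sum N (\<lambda>k. (\<phi> k)(j := (\<lambda>\<theta>. w \<theta> * \<phi> k j \<theta>))) \<in> cutoff K"
    unfolding cutoff_def using 1(2)
    by (intro CollectI exI[of _ N] exI[of _ "\<lambda>k. (\<phi> k)(j := (\<lambda>\<theta>. w \<theta> * \<phi> k j \<theta>))"]) (auto intro: w)
  then show ?thesis
    unfolding tensor_sum_scale[of N \<phi> j w, abs_def] 1 .
qed

lemma cutoff_scale: "f \<in> cutoff K \<Longrightarrow> (\<lambda>x. c * f x) \<in> cutoff K"
  using cutoff_mult[of f K undefined "\<lambda>_. c"] L2_scale by blast

lemma cutoff_zero: "(\<lambda>x. 0) \<in> cutoff K"
  unfolding cutoff_def by (intro CollectI exI[of _ 0] exI) (auto simp: tensor_sum_def[abs_def])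

lemma cutoff_sum: "(\<And>i. i \<in> I \<Longrightarrow> f i \<in> cutoff K) \<Longrightarrow> (\<lambda>x. \<Sum>i\<in>I. f i x) \<in> cutoff K"
  by (induction I rule: infinite_finite_induct) (auto intro: cutoff_zero cutoff_add)

lemma cutoff_symb:
  assumes "f \<in> cutoff K"
  shows "(\<lambda>x. complex_of_real (symb x) * f x) \<in> cutoff K"
proof -
  have "(\<lambda>x. \<Sum>j\<in>UNIV. complex_of_real (m j (x j)) * f x) \<in> cutoff K"
    by (intro cutoff_sum cutoff_mult[OF assms, where w="\<lambda>\<theta>. complex_of_real (m _ \<theta>)"] L2_cutoff_mult) auto
  then show ?thesis
    by (simp add: symb_def sum_distrib_right)
qed

lemma cutoff_polynomial:
  assumes "real_polynomial_function p" "f \<in> cutoff K"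
  shows "(\<lambda>x. complex_of_real (p (symb x)) * f x) \<in> cutoff K"
  using assms
proof (induction arbitrary: f)
  case (linear p)
  interpret bounded_linear p by fact
  \<comment> \<open>A linear function on the reals is multiplication by its value at 1, so this case
    is a scalar multiple of one multiplication by the symbol.\<close>
  have "p t = t * p 1" for t
    using scaleR[of t 1] by simp
  then show ?case
    using cutoff_scale[OF cutoff_symb[OF linear.prems], of "complex_of_real (p 1)"]
    by (metis (no_types, lifting) ext mult.assoc mult.commute of_real_mult)
next
  case (const c)
  then show ?case by (simp add: cutoff_scale)
next
  case (add p q)
  then show ?case
    using cutoff_add by (simp add: distrib_right)
next
  case (mult p q)
  then show ?case by (simp add: mult.assoc)
qed

end


section \<open>The spectrum of the closure\<close>

context multiplier_family
begin

lemma unit_vector_fourier_rel: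
  fixes y :: "int ^ 'n"
  shows "(\<lambda>x. \<Prod>j\<in>UNIV. fourier_basis (y $ j) (x j), \<lambda>x. if x = y then 1 else 0) \<in> fourier_rel"
proof -
  define \<phi> where "\<phi> k j = fourier_basis (y $ j)" for k :: nat and j
  have "(\<Prod>j\<in>UNIV. if x $ j = y $ j then 1 else 0 :: complex) = (if x = y then 1 else 0)" for x
  proof (cases "x = y")
    case False
    then obtain j where "x $ j \<noteq> y $ j" by (auto simp: vec_eq_iff)
    then show ?thesis using False by (auto intro!: prod_zero)
  qed simp
  then have "inv_fourier_tensor_sum 1 \<phi> = (\<lambda>x. if x = y then 1 else 0)"
    by (simp add: fun_eq_iff inv_fourier_tensor_sum_def pure_tensor_def \<phi>_def inv_fourier_basis)
  moreover have "tensor_sum 1 \<phi> = (\<lambda>x. \<Prod>j\<in>UNIV. fourier_basis (y $ j) (x j))"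
    by (simp add: fun_eq_iff tensor_sum_def \<phi>_def)
  moreover have "(tensor_sum 1 \<phi>, inv_fourier_tensor_sum 1 \<phi>) \<in> fourier_rel"
    unfolding fourier_rel_def by (intro CollectI exI[of _ 1] exI[of _ \<phi>]) (auto simp: \<phi>_def fourier_basis_L2)
  ultimately show ?thesis by simp
qed

text \<open>Truncating every factor yields a function that at each point equals the tensor or 0, and
  equals it as soon as K exceeds all \<open>\<bar>m j (x j)\<bar>\<close>; dominated convergence
  finishes. The bound on \<open>symb\<close> where f does not vanish is recorded to confine the
  later polynomial approximation to a compact set.\<close>

lemma cutoff_approximation:
  fixes \<phi> :: "'n \<Rightarrow> real \<Rightarrow> complex"
  assumes \<phi>: "\<And>j. \<phi> j \<in> L2 circle_measure" and "0 < \<epsilon>"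
  obtains K f where "0 \<le> K" "f \<in> cutoff K" "\<And>x. f x \<noteq> 0 \<Longrightarrow> \<bar>symb x\<bar> \<le> K * CARD('n)"
    "L2_norm torus_measure (\<lambda>x. f x - (\<Prod>j\<in>UNIV. \<phi> j (x j))) < \<epsilon>"
proof -
  define e where "e x = (\<Prod>j\<in>UNIV. \<phi> j (x j))" for x
  define \<psi> where "\<psi> K j \<theta> = (if \<bar>m j \<theta>\<bar> \<le> real K then \<phi> j \<theta> else 0)" for K :: nat and j \<theta>
  define f where "f K x = (\<Prod>j\<in>UNIV. \<psi> K j (x j))" for K x
  have e: "e \<in> L2 torus_measure"
    unfolding e_def by (intro L2_tensor sigma_finite_measure_circle \<phi>)
  have \<psi>: "\<psi> K j \<in> L2 circle_measure" for K j
  proof (rule L2_bounded[OF \<phi>[of j], where C=1])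
    have [measurable]: "\<phi> j \<in> borel_measurable circle_measure" using \<phi> by measurable
    show "\<psi> K j \<in> borel_measurable circle_measure" unfolding \<psi>_def by measurable
  qed (simp add: \<psi>_def)
  have fL: "f K \<in> L2 torus_measure" for K
    unfolding f_def by (intro L2_tensor sigma_finite_measure_circle \<psi>)
  have f_cutoff: "f K \<in> cutoff (real K)" for K
    unfolding cutoff_def
    by (intro CollectI exI[of _ 1] exI[of _ "\<lambda>_. \<psi> K"])
      (auto simp: f_def tensor_sum_def \<psi> fun_eq_iff, simp add: \<psi>_def)
  have nz: "\<bar>m j (x j)\<bar> \<le> real K" if "f K x \<noteq> 0" for K x j
    using that by (auto simp: f_def \<psi>_def split: if_splits)
  have f_eq: "f K x = e x \<or> f K x = 0" for K x
  proof (cases "\<forall>j. \<bar>m j (x j)\<bar> \<le> real K")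
    case True
    then show ?thesis by (simp add: f_def e_def \<psi>_def)
  next
    case False
    then show ?thesis using nz by blast
  qed
  have "(\<lambda>K. \<integral>x. (cmod (f K x - e x))\<^sup>2 \<partial>torus_measure) \<longlonglongrightarrow> integral\<^sup>L torus_measure (\<lambda>x :: 'n \<Rightarrow> real. 0)"
  proof (rule integral_dominated_convergence[where w="\<lambda>x. (cmod (e x))\<^sup>2"])
    show "AE x in torus_measure. (\<lambda>K. (cmod (f K x - e x))\<^sup>2) \<longlonglongrightarrow> 0"
    proof (rule AE_I2)
      fix x :: "'n \<Rightarrow> real"
      have "\<forall>\<^sub>F K in sequentially. \<bar>m j (x j)\<bar> \<le> real K" for j
        using eventually_ge_at_top[of "nat \<lceil>\<bar>m j (x j)\<bar>\<rceil>"] by eventually_elim linarith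
      then have "\<forall>\<^sub>F K in sequentially. \<forall>j\<in>UNIV. \<bar>m j (x j)\<bar> \<le> real K"
        by (intro eventually_ball_finite) auto
      then have "\<forall>\<^sub>F K in sequentially. (cmod (f K x - e x))\<^sup>2 = 0"
        by eventually_elim (simp add: f_def e_def \<psi>_def)
      then show "(\<lambda>K. (cmod (f K x - e x))\<^sup>2) \<longlonglongrightarrow> 0"
        by (rule tendsto_eventually)
    qed
    show "AE x in torus_measure. norm ((cmod (f K x - e x))\<^sup>2) \<le> (cmod (e x))\<^sup>2" for K
    proof (rule AE_I2)
      fix x :: "'n \<Rightarrow> real"
      show "norm ((cmod (f K x - e x))\<^sup>2) \<le> (cmod (e x))\<^sup>2"
        using f_eq[of K x] by (elim disjE) simp_all
    qed
    show "(\<lambda>x. (cmod (f K x - e x))\<^sup>2) \<in> borel_measurable torus_measure" for K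
      using L2_measurable[OF L2_diff[OF fL[of K] e]] by measurable
  qed (auto simp: L2_integrable_square e)
  then have "(\<lambda>K. sqrt (\<integral>x. (cmod (f K x - e x))\<^sup>2 \<partial>torus_measure)) \<longlonglongrightarrow> sqrt 0"
    by (intro tendsto_real_sqrt) simp
  then have "(\<lambda>K. L2_norm torus_measure (\<lambda>x. f K x - e x)) \<longlonglongrightarrow> 0"
    by (simp add: L2_norm_def)
  from order_tendstoD(2)[OF this \<open>0 < \<epsilon>\<close>]
  obtain K where K: "L2_norm torus_measure (\<lambda>x. f K x - e x) < \<epsilon>"
    by (auto dest: eventually_happens)
  have "\<bar>symb x\<bar> \<le> real K * CARD('n)" if "f K x \<noteq> 0" for x
  proof -
    have "\<bar>symb x\<bar> \<le> (\<Sum>j\<in>UNIV. \<bar>m j (x j)\<bar>)" unfolding symb_def by (rule sum_abs)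
    also have "\<dots> \<le> (\<Sum>j\<in>(UNIV :: 'n set). real K)" by (intro sum_mono nz that)
    finally show ?thesis by (simp add: mult.commute)
  qed
  with K show thesis
    using that[of "real K" "f K"] f_cutoff by (simp add: e_def)
qed

text \<open>Half of \<epsilon> is spent on replacing the basis function e by its cutoff f. For the
  other half, (s - z) P(s) f - f equals f times (s - z) (P(s) - 1 / (s - z)), and where f does not
  vanish this factor is at most \<open>(B + cmod z) * \<eta>\<close>.\<close>

lemma op_range_unit_vector:
  fixes y :: "int ^ 'n"
  assumes \<delta>: "0 < \<delta>" "\<And>x. \<delta> \<le> cmod (complex_of_real (symb x) - z)"
    and "0 < \<epsilon>"
  shows "\<exists>(u, v)\<in>op. ell2_norm (\<lambda>x. (v x - z * u x) - (if x = y then 1 else 0)) < \<epsilon>"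
proof -
  define e where "e x = (\<Prod>j\<in>UNIV. fourier_basis (y $ j) (x j))" for x
  have "0 < \<epsilon> / 2" using \<open>0 < \<epsilon>\<close> by simp
  then obtain K f where K: "0 \<le> K" and f: "f \<in> cutoff K" and fK: "\<And>x. f x \<noteq> 0 \<Longrightarrow> \<bar>symb x\<bar> \<le> K * CARD('n)"
      and fe: "L2_norm torus_measure (\<lambda>x. f x - e x) < \<epsilon> / 2"
    using cutoff_approximation[of "\<lambda>j. fourier_basis (y $ j)" "\<epsilon> / 2"] fourier_basis_L2
    unfolding e_def by blast
  define B where "B = K * CARD('n)"
  have B: "0 \<le> B" using K by (simp add: B_def)
  have fL: "f \<in> L2 torus_measure"
    using f by (rule cutoff_op) (rule fourier_rel_L2)
  \<comment> \<open>The uniform error allowed for P: multiplied by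
    \<open>(B + cmod z) * L2_norm torus_measure f\<close> it stays below
    \<open>\<epsilon> / 2\<close>.\<close>
  define \<eta> where "\<eta> = \<epsilon> / 2 / ((B + cmod z) * L2_norm torus_measure f + 1)"
  have den: "0 < (B + cmod z) * L2_norm torus_measure f + 1"
    using B by (intro add_nonneg_pos mult_nonneg_nonneg) auto
  have \<eta>: "0 < \<eta>" unfolding \<eta>_def using \<open>0 < \<epsilon>\<close> den by simp
  \<comment> \<open>For real z the whole interval may contain the pole of 1 / (t - z). The values of
    the symbol avoid a \<delta>-neighbourhood of z, so approximation on the rest of the interval
    suffices, and this set is still compact.\<close>
  define D where "D = {t \<in> {-B..B}. \<delta> \<le> cmod (complex_of_real t - z)}"
  have "closed {t. \<delta> \<le> cmod (complex_of_real t - z)}"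
    by (intro closed_Collect_le continuous_intros)
  then have D: "compact D"
    unfolding D_def Collect_conj_eq Collect_mem_eq by (intro compact_Int_closed compact_Icc)
  have contF: "continuous_on D (\<lambda>t. 1 / (complex_of_real t - z))"
    using \<delta>(1) by (intro continuous_intros) (auto simp: D_def)
  \<comment> \<open>Real and imaginary part are approximated by separate real polynomials, each
    within \<open>\<eta> / 2\<close>.\<close>
  obtain p where p: "real_polynomial_function p" "\<And>t. t \<in> D \<Longrightarrow> \<bar>Re (1 / (complex_of_real t - z)) - p t\<bar> < \<eta> / 2"
    using Stone_Weierstrass_real_polynomial_function[OF D continuous_on_Re[OF contF], of "\<eta> / 2"] \<eta> by auto
  obtain q where q: "real_polynomial_function q" "\<And>t. t \<in> D \<Longrightarrow> \<bar>Im (1 / (complex_of_real t - z)) - q t\<bar> < \<eta> / 2"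
    using Stone_Weierstrass_real_polynomial_function[OF D continuous_on_Im[OF contF], of "\<eta> / 2"] \<eta> by auto
  define P where "P t = complex_of_real (p t) + \<i> * complex_of_real (q t)" for t
  have P: "cmod (P t - 1 / (complex_of_real t - z)) \<le> \<eta>" if "t \<in> D" for t
    using cmod_le[of "P t - 1 / (complex_of_real t - z)"] p(2)[OF that] q(2)[OF that]
    by (simp add: P_def abs_minus_commute)
  define g where "g x = P (symb x) * f x" for x
  have g: "g \<in> cutoff K"
    unfolding g_def P_def distrib_right mult.assoc
    by (intro cutoff_add cutoff_scale cutoff_polynomial p q f)
  obtain u v where uv: "(u, v) \<in> op" "(g, u) \<in> fourier_rel" "(\<lambda>x. complex_of_real (symb x) * g x, v) \<in> fourier_rel"
    using g by (rule cutoff_op)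
  define h where "h x = (complex_of_real (symb x) - z) * g x" for x
  have h: "(h, \<lambda>x. v x - z * u x) \<in> fourier_rel"
    unfolding h_def by (rule fourier_rel_resolvent[OF uv(2,3)])
  note hL = fourier_rel_L2[OF h]
  have unit: "(e, \<lambda>x. if x = y then 1 else 0) \<in> fourier_rel"
    unfolding e_def by (rule unit_vector_fourier_rel)
  have "ell2_norm (\<lambda>x. (v x - z * u x) - (if x = y then 1 else 0)) = L2_norm torus_measure (\<lambda>x. h x - e x)"
    by (rule fourier_rel_isometry(2)[OF fourier_rel_diff[OF h unit]])
  also have "\<dots> \<le> L2_norm torus_measure (\<lambda>x. h x - f x) + L2_norm torus_measure (\<lambda>x. f x - e x)"
    by (intro L2_norm_triangle_diff hL fL fourier_rel_L2[OF unit])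
  also have "L2_norm torus_measure (\<lambda>x. h x - f x) \<le> ((B + cmod z) * \<eta>) * L2_norm torus_measure f"
  proof (rule L2_norm_mono[OF fL])
    have "cmod (h x - f x) \<le> ((B + cmod z) * \<eta>) * cmod (f x)" for x
    proof (cases "f x = 0")
      case False
      let ?s = "complex_of_real (symb x) - z"
      have sx: "symb x \<in> D"
        using fK[OF False] \<delta>(2)[of x] by (auto simp: D_def B_def abs_le_iff)
      have "?s \<noteq> 0" using \<delta>(1) \<delta>(2)[of x] by auto
      then have "h x - f x = ?s * (P (symb x) - 1 / ?s) * f x"
        by (simp add: h_def g_def field_simps)
      then have "cmod (h x - f x) = cmod ?s * cmod (P (symb x) - 1 / ?s) * cmod (f x)"
        by (simp only: norm_mult)
      also have "\<dots> \<le> ((B + cmod z) * \<eta>) * cmod (f x)"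
      proof (intro mult_right_mono mult_mono)
        have "cmod ?s \<le> \<bar>symb x\<bar> + cmod z"
          using norm_triangle_ineq4[of "complex_of_real (symb x)" z] by simp
        then show "cmod ?s \<le> B + cmod z" using fK[OF False] by (simp add: B_def)
      qed (use P[OF sx] B in auto)
      finally show ?thesis .
    qed (simp add: h_def g_def)
    then show "AE x in torus_measure. cmod (h x - f x) \<le> ((B + cmod z) * \<eta>) * cmod (f x)" by simp
    show "(\<lambda>x. h x - f x) \<in> borel_measurable torus_measure"
      by (rule L2_measurable[OF L2_diff[OF hL fL]])
  qed (use B \<eta> in auto)
  also have "((B + cmod z) * \<eta>) * L2_norm torus_measure f = \<eta> * ((B + cmod z) * L2_norm torus_measure f)"
    by simp
  also have "\<dots> \<le> \<eta> * ((B + cmod z) * L2_norm torus_measure f + 1)"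
    using \<eta> by (intro mult_left_mono) auto
  also have "\<dots> = \<epsilon> / 2"
    using den by (intro nonzero_eq_divide_eq[THEN iffD1, OF _ \<eta>_def]) simp
  finally have "ell2_norm (\<lambda>x. (v x - z * u x) - (if x = y then 1 else 0)) < \<epsilon>"
    using fe by simp
  then show ?thesis using uv(1) by blast
qed

text \<open>Linearity reduces this to unit vectors: adding a point y to the support costs one more
  graph point, scaled by \<open>h y\<close>, and the error allowance is halved at each
  stage.\<close>

lemma op_range_finite_support:
  fixes h :: "int ^ 'n \<Rightarrow> complex"
  assumes \<delta>: "0 < \<delta>" "\<And>x. \<delta> \<le> cmod (complex_of_real (symb x) - z)"
    and "finite F" "0 < \<epsilon>"
  shows "\<exists>(u, v)\<in>op. ell2_norm (\<lambda>x. (v x - z * u x) - (if x \<in> F then h x else 0)) < \<epsilon>"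
  using assms(3,4)
proof (induction F arbitrary: \<epsilon>)
  case empty
  have "(\<lambda>x. 0, \<lambda>x. 0) \<in> op"
    using cutoff_op[OF cutoff_zero] op_scale[of _ _ 0] by (metis (no_types, lifting) ext mult_zero_left)
  then show ?case
    using empty by (intro bexI[of _ "(\<lambda>x. 0, \<lambda>x. 0)"]) (auto simp: ell2_norm_eq_L2_norm)
next
  case (insert y F)
  have "0 < \<epsilon> / 2" using insert by simp
  obtain u v where uv: "(u, v) \<in> op" "ell2_norm (\<lambda>x. (v x - z * u x) - (if x \<in> F then h x else 0)) < \<epsilon> / 2"
    using insert.IH[OF \<open>0 < \<epsilon> / 2\<close>] by blast
  define \<eta> where "\<eta> = \<epsilon> / 2 / (cmod (h y) + 1)"
  have \<eta>: "0 < \<eta>" unfolding \<eta>_def using insert by (intro divide_pos_pos add_nonneg_pos) auto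
  obtain u' v' where uv': "(u', v') \<in> op" "ell2_norm (\<lambda>x. (v' x - z * u' x) - (if x = y then 1 else 0)) < \<eta>"
    using op_range_unit_vector[OF \<delta> \<eta>, of y] by blast
  let ?C = "count_space (UNIV :: (int ^ 'n) set)"
  define a where "a x = (v x - z * u x) - (if x \<in> F then h x else 0)" for x
  define b where "b x = (v' x - z * u' x) - (if x = y then 1 else 0)" for x
  have L2_fin: "(\<lambda>x. if x \<in> G then k x else 0) \<in> L2 ?C" if "finite G" for G and k :: "int ^ 'n \<Rightarrow> complex"
    unfolding ell2_eq_L2[symmetric] ell2_def
    by (intro CollectI finite_nonzero_values_imp_summable_on finite_subset[OF _ that]) auto
  have L: "u \<in> L2 ?C" "v \<in> L2 ?C" "u' \<in> L2 ?C" "v' \<in> L2 ?C"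
    using uv(1) uv'(1) op_ell2 by (auto simp: ell2_eq_L2)
  have aL: "a \<in> L2 ?C"
    unfolding a_def by (intro L2_diff L2_scale L L2_fin insert)
  have bL: "b \<in> L2 ?C"
    unfolding b_def using L2_fin[of "{y}" "\<lambda>_. 1"] by (intro L2_diff L2_scale L) simp
  have "(\<lambda>x. u x + h y * u' x, \<lambda>x. v x + h y * v' x) \<in> op"
    by (rule alg_tensor_sum_add[OF uv(1) op_scale[OF uv'(1)]])
  moreover have "(v x + h y * v' x) - z * (u x + h y * u' x) - (if x \<in> insert y F then h x else 0)
      = a x + h y * b x" for x
    using insert(2) by (auto simp: a_def b_def algebra_simps)
  moreover have "L2_norm ?C (\<lambda>x. a x + h y * b x) < \<epsilon>"
  proof -
    have "L2_norm ?C (\<lambda>x. a x + h y * b x) \<le> L2_norm ?C a + L2_norm ?C (\<lambda>x. h y * b x)"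
      by (intro L2_norm_triangle L2_scale aL bL)
    also have "L2_norm ?C (\<lambda>x. h y * b x) = cmod (h y) * L2_norm ?C b"
      by (rule L2_norm_scale)
    also have "\<dots> \<le> (cmod (h y) + 1) * \<eta>"
      using uv'(2) \<eta> by (intro mult_mono) (auto simp: b_def[abs_def] ell2_norm_eq_L2_norm)
    also have "(cmod (h y) + 1) * \<eta> = \<epsilon> / 2"
    proof -
      have "cmod (h y) + 1 \<noteq> 0" using norm_ge_zero[of "h y"] by linarith
      then show ?thesis
        by (subst mult.commute) (rule nonzero_eq_divide_eq[THEN iffD1, OF _ \<eta>_def])
    qed
    also have "L2_norm ?C a < \<epsilon> / 2"
      using uv(2) by (simp add: a_def[abs_def] ell2_norm_eq_L2_norm)
    finally show ?thesis by simp
  qed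
  ultimately show ?case
    by (intro bexI[of _ "(\<lambda>x. u x + h y * u' x, \<lambda>x. v x + h y * v' x)"]) (auto simp: ell2_norm_eq_L2_norm)
qed

lemma op_range_dense:
  assumes \<delta>: "0 < \<delta>" "\<And>x. \<delta> \<le> cmod (complex_of_real (symb x) - z)"
    and h: "h \<in> ell2" and "0 < \<epsilon>"
  shows "\<exists>(u, v)\<in>op. ell2_norm (\<lambda>x. (v x - z * u x) - h x) < \<epsilon>"
proof -
  let ?C = "count_space (UNIV :: (int ^ 'n) set)"
  have "0 < \<epsilon> / 2" using \<open>0 < \<epsilon>\<close> by simp
  obtain F where F: "finite F" "ell2_norm (\<lambda>x. if x \<in> F then 0 else h x) < \<epsilon> / 2"
    using ell2_tail[OF h \<open>0 < \<epsilon> / 2\<close>] by blast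
  obtain u v where uv: "(u, v) \<in> op" "ell2_norm (\<lambda>x. (v x - z * u x) - (if x \<in> F then h x else 0)) < \<epsilon> / 2"
    using op_range_finite_support[OF \<delta> F(1) \<open>0 < \<epsilon> / 2\<close>] by blast
  have L: "u \<in> L2 ?C" "v \<in> L2 ?C" using uv(1) op_ell2 by (auto simp: ell2_eq_L2)
  have hL: "h \<in> L2 ?C" using h by (simp add: ell2_eq_L2)
  have h1: "(\<lambda>x. if x \<in> F then h x else 0) \<in> L2 ?C" and h2: "(\<lambda>x. if x \<in> F then 0 else h x) \<in> L2 ?C"
    by (rule L2_bounded[OF hL, where C=1]; simp)+
  have "L2_norm ?C (\<lambda>x. ((v x - z * u x) - (if x \<in> F then h x else 0)) - (if x \<in> F then 0 else h x))
      \<le> L2_norm ?C (\<lambda>x. (v x - z * u x) - (if x \<in> F then h x else 0)) + L2_norm ?C (\<lambda>x. if x \<in> F then 0 else h x)"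
    using L2_norm_triangle_diff[OF L2_diff[OF L2_diff[OF L(2) L2_scale[OF L(1), of z]] h1] L2_zero h2]
    by (simp only: diff_0_right diff_0 L2_norm_minus)
  moreover have "((v x - z * u x) - (if x \<in> F then h x else 0)) - (if x \<in> F then 0 else h x) = (v x - z * u x) - h x" for x
    by simp
  ultimately have "ell2_norm (\<lambda>x. (v x - z * u x) - h x) < \<epsilon>"
    using F(2) uv(2) by (simp add: ell2_norm_eq_L2_norm)
  then show ?thesis using uv(1) by blast
qed

text \<open>The tensor product of the band indicators is an approximate eigenvector: on its support
  every \<open>m j\<close> is within \<epsilon> of \<open>l j\<close>, so the d errors add up to at
  most \<open>d * \<epsilon>\<close>. It is nonzero because its norm is the product of the
  one-dimensional norms.\<close>

lemma symb_sum_in_spectrum: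
  assumes ess: "\<And>j \<epsilon>. 0 < \<epsilon> \<Longrightarrow> emeasure circle_measure {\<theta> \<in> space circle_measure. \<bar>m j \<theta> - l j\<bar> < \<epsilon>} > 0"
  shows "complex_of_real (\<Sum>j\<in>UNIV. l j) \<in> spectrum (ell2_op_closure op)"
  unfolding spectrum_def
proof
  let ?z = "complex_of_real (\<Sum>j\<in>UNIV. l j)"
  assume "?z \<in> resolvent_set (ell2_op_closure op)"
  then obtain C where C: "\<And>u v. (u, v) \<in> ell2_op_closure op \<Longrightarrow> ell2_norm u \<le> C * ell2_norm (\<lambda>x. v x - ?z * u x)"
    unfolding resolvent_set_def by blast
  define d where "d = real CARD('n)"
  have d: "0 < d" unfolding d_def by simp
  \<comment> \<open>The factor d compensates for the d accumulated errors; then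
    \<open>\<bar>C\<bar> * (d * \<epsilon>)\<close> is below 1.\<close>
  define \<epsilon> where "\<epsilon> = 1 / (d * (\<bar>C\<bar> + 1))"
  have \<epsilon>: "0 < \<epsilon>" unfolding \<epsilon>_def using d by simp
  define a where "a j = (indicator {\<theta>. \<bar>m j \<theta> - l j\<bar> < \<epsilon>} :: real \<Rightarrow> complex)" for j
  define f where "f = tensor_sum 1 (\<lambda>_. a)"
  have aL: "a j \<in> L2 circle_measure" "(\<lambda>\<theta>. complex_of_real (m j \<theta>) * a j \<theta>) \<in> L2 circle_measure" for j
    unfolding a_def by (rule L2_band[OF m_measurable \<epsilon>])+
  obtain u v where uv: "(u, v) \<in> op" "(f, u) \<in> fourier_rel" "(\<lambda>x. complex_of_real (symb x) * f x, v) \<in> fourier_rel"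
    using op_intro[of 1 "\<lambda>_. a", OF aL] unfolding f_def by blast
  note r = fourier_rel_resolvent[OF uv(2,3), of ?z]
  have f_eq: "f x = (\<Prod>j\<in>UNIV. a j (x j))" for x
    by (simp add: f_def tensor_sum_def)
  have "L2_norm torus_measure f \<le> C * L2_norm torus_measure (\<lambda>x. (complex_of_real (symb x) - ?z) * f x)"
    using C[of u v] uv(1) subset_ell2_op_closure[OF op_ell2]
    unfolding fourier_rel_isometry(2)[OF uv(2)] fourier_rel_isometry(2)[OF r] by blast
  also have "\<dots> \<le> \<bar>C\<bar> * L2_norm torus_measure (\<lambda>x. (complex_of_real (symb x) - ?z) * f x)"
    by (intro mult_right_mono) auto
  also have "\<dots> \<le> \<bar>C\<bar> * ((d * \<epsilon>) * L2_norm torus_measure f)"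
  proof (intro mult_left_mono L2_norm_mono fourier_rel_L2[OF uv(2)] L2_measurable[OF fourier_rel_L2[OF r]])
    have "cmod ((complex_of_real (symb x) - ?z) * f x) \<le> (d * \<epsilon>) * cmod (f x)" for x
    proof (cases "f x = 0")
      case False
      then have "a j (x j) \<noteq> 0" for j by (simp add: f_eq)
      then have lt: "\<bar>m j (x j) - l j\<bar> < \<epsilon>" for j
        by (simp add: a_def indicator_def split: if_splits)
      have "\<bar>symb x - (\<Sum>j\<in>UNIV. l j)\<bar> \<le> (\<Sum>j\<in>UNIV. \<bar>m j (x j) - l j\<bar>)"
        unfolding symb_def sum_subtractf[symmetric] by (rule sum_abs)
      also have "\<dots> \<le> (\<Sum>j\<in>(UNIV :: 'n set). \<epsilon>)"
        by (intro sum_mono less_imp_le lt)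
      finally have "\<bar>symb x - (\<Sum>j\<in>UNIV. l j)\<bar> \<le> d * \<epsilon>" by (simp add: d_def)
      then show ?thesis
        unfolding norm_mult of_real_diff[symmetric] norm_of_real by (intro mult_right_mono) auto
    qed simp
    then show "AE x in torus_measure. cmod ((complex_of_real (symb x) - ?z) * f x) \<le> (d * \<epsilon>) * cmod (f x)"
      by simp
  qed (use d \<epsilon> in auto)
  finally have "1 * L2_norm torus_measure f \<le> (\<bar>C\<bar> * (d * \<epsilon>)) * L2_norm torus_measure f" by simp
  moreover have "0 < L2_norm torus_measure f"
  proof -
    have "0 < L2_norm circle_measure (a j)" for j
      unfolding a_def by (rule L2_norm_band_pos[OF m_measurable \<epsilon> ess[OF \<epsilon>]])
    then have "L2_norm circle_measure (a j) \<noteq> 0" for j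
      by (metis less_irrefl)
    moreover have "complex_of_real ((L2_norm torus_measure f)\<^sup>2) = (\<Prod>j\<in>UNIV. complex_of_real ((L2_norm circle_measure (a j))\<^sup>2))"
      unfolding L2_inner_self[symmetric] f_eq[abs_def]
      by (rule L2_inner_tensor) (auto simp: sigma_finite_measure_circle aL)
    ultimately have "complex_of_real ((L2_norm torus_measure f)\<^sup>2) \<noteq> 0"
      by simp
    then have "L2_norm torus_measure f \<noteq> 0" by simp
    then show ?thesis using L2_norm_nonneg[of torus_measure f] by linarith
  qed
  ultimately have "1 \<le> \<bar>C\<bar> * (d * \<epsilon>)" by (simp only: mult_le_cancel_right_pos)
  also have "\<bar>C\<bar> * (d * \<epsilon>) = \<bar>C\<bar> / (\<bar>C\<bar> + 1)" using d by (simp add: \<epsilon>_def)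
  also have "\<dots> < 1" by simp
  finally show False by simp
qed

text \<open>Closedness of the sumset provides the positive distance \<delta> from a point outside
  it. The resolvent part combines \<open>op_bound\<close> with \<open>op_range_dense\<close>; the
  reverse inclusion is \<open>symb_sum_in_spectrum\<close>.\<close>

theorem spectrum_tensor_sum:
  assumes S: "\<And>j \<theta>. m j \<theta> \<in> S j"
    and ess: "\<And>j t \<epsilon>. t \<in> S j \<Longrightarrow> 0 < \<epsilon> \<Longrightarrow>
      emeasure circle_measure {\<theta> \<in> space circle_measure. \<bar>m j \<theta> - t\<bar> < \<epsilon>} > 0"
    and closed: "closed {\<Sum>j\<in>UNIV. l j | l. \<forall>j. l j \<in> S j}"
  shows "spectrum (ell2_op_closure op) = complex_of_real ` {\<Sum>j\<in>UNIV. l j | l. \<forall>j. l j \<in> S j}"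
    (is "_ = complex_of_real ` ?\<Sigma>")
proof (intro equalityI subsetI)
  fix z assume z: "z \<in> spectrum (ell2_op_closure op)"
  show "z \<in> complex_of_real ` ?\<Sigma>"
  proof (rule ccontr)
    assume nin: "z \<notin> complex_of_real ` ?\<Sigma>"
    have cl: "closed (complex_of_real ` ?\<Sigma>)"
      using closed by (intro closed_injective_linear_image) (auto simp: inj_on_def linear_of_real)
    obtain \<delta> where \<delta>: "0 < \<delta>" "\<forall>w\<in>complex_of_real ` ?\<Sigma>. \<delta> \<le> dist z w"
      using separate_point_closed[OF cl nin] by (elim exE conjE) (rule that)
    have "symb x \<in> ?\<Sigma>" for x
      unfolding symb_def using S by blast
    then have \<delta>': "\<delta> \<le> cmod (complex_of_real (symb x) - z)" for x
      using bspec[OF \<delta>(2) imageI[of "symb x"]] by (simp add: dist_norm norm_minus_commute)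
    have "z \<in> resolvent_set (ell2_op_closure op)"
    proof (rule resolvent_set_ell2_op_closureI[OF op_ell2 op_diff])
      show "0 \<le> 1 / \<delta>" using \<delta>(1) by simp
      show "ell2_norm u \<le> (1 / \<delta>) * ell2_norm (\<lambda>x. v x - z * u x)" if "(u, v) \<in> op" for u v
        by (rule op_bound[OF \<delta>(1) \<delta>' that])
      show "\<exists>(u, v)\<in>op. ell2_norm (\<lambda>x. (v x - z * u x) - h x) < \<epsilon>" if "h \<in> ell2" "0 < \<epsilon>" for h \<epsilon>
        by (rule op_range_dense[OF \<delta>(1) \<delta>' that])
    qed
    then show False using z by (simp add: spectrum_def)
  qed
next
  fix z assume "z \<in> complex_of_real ` ?\<Sigma>"
  then obtain l where "\<forall>j. l j \<in> S j" "z = complex_of_real (\<Sum>j\<in>UNIV. l j)" by blast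
  then show "z \<in> spectrum (ell2_op_closure op)"
    using symb_sum_in_spectrum[of l] ess by simp
qed

end


section \<open>Powers of the Laplacian\<close>

text \<open>A nonnegative summand is bounded by the sum. So along a convergent sequence of sums all
  summands stay in one interval \<open>{0..B}\<close>, and the sums lie in the continuous image of
  the compact set \<open>Q\<close>. Without a sign condition, large summands could cancel and the
  sumset fail to be closed.\<close>

lemma closed_sumset_nonneg:
  fixes S :: "'n::finite \<Rightarrow> real set"
  assumes closed: "\<And>j. closed (S j)" and nonneg: "\<And>j. S j \<subseteq> {0..}"
  shows "closed {\<Sum>j\<in>UNIV. l j | l. \<forall>j. l j \<in> S j}"
  unfolding closed_sequential_limits
proof (intro allI impI, elim conjE)
  fix y L assume y: "\<forall>n. y n \<in> {\<Sum>j\<in>UNIV. l j | l. \<forall>j. l j \<in> S j}" and L: "y \<longlonglongrightarrow> L"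
  have "Bseq y" by (intro convergent_imp_Bseq convergentI[OF L])
  then obtain B where "\<forall>n. norm (y n) \<le> B" by (rule BseqE)
  then have B: "\<bar>y n\<bar> \<le> B" for n by simp
  define Q where "Q = {v :: real ^ 'n. \<forall>j. v $ j \<in> S j \<inter> {0..B}}"
  have "closed Q"
    unfolding Q_def
    by (intro closed_Collect_all closed_vimage[where f="\<lambda>v. v $ _", unfolded vimage_def] closed_Int closed continuous_intros)
  moreover have "Q \<subseteq> cbox 0 (\<chi> i. B)"
    by (auto simp: Q_def mem_box_cart)
  ultimately have "compact Q"
    by (meson bounded_cbox bounded_subset compact_eq_bounded_closed)
  then have "closed ((\<lambda>v. \<Sum>j\<in>UNIV. v $ j) ` Q)"
    by (intro compact_imp_closed compact_continuous_image continuous_intros)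
  moreover have "y n \<in> (\<lambda>v. \<Sum>j\<in>UNIV. v $ j) ` Q" for n
  proof -
    obtain l where l: "y n = (\<Sum>j\<in>UNIV. l j)" "\<forall>j. l j \<in> S j" using y by blast
    have "0 \<le> l j" for j using l(2) nonneg[of j] by auto
    then have "l j \<le> y n" for j unfolding l(1) by (intro member_le_sum) auto
    then have "l j \<le> B" for j using B[of n] by (meson abs_le_D1 order_trans)
    then have "(\<chi> j. l j) \<in> Q" using l(2) \<open>\<And>j. 0 \<le> l j\<close> by (simp add: Q_def)
    then show ?thesis using l(1) by (intro image_eqI[of _ _ "\<chi> j. l j"]) auto
  qed
  ultimately have "L \<in> (\<lambda>v. \<Sum>j\<in>UNIV. v $ j) ` Q"
    using L closed_sequentially by blast
  then show "L \<in> {\<Sum>j\<in>UNIV. l j | l. \<forall>j. l j \<in> S j}"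
    unfolding Q_def by blast
qed

text \<open>The value at the zeros of the symbol is chosen inside the essential range, so that no
  null set has to be excluded.\<close>

definition laplacian_multiplier :: "real \<Rightarrow> real \<Rightarrow> real" where
  "laplacian_multiplier r \<theta> = (if laplacian_symbol \<theta> = 0 then 4 powr r else laplacian_symbol \<theta> powr r)"

text \<open>The closure of the set of values \<open>s powr r\<close> for 0 < s < 4, where 4 is the
  maximum of the symbol.\<close>

definition laplacian_range :: "real \<Rightarrow> real set" where
  "laplacian_range r = (if 0 < r then {0..4 powr r} else if r = 0 then {1} else {4 powr r..})"

lemma laplacian_multiplier_measurable: "laplacian_multiplier r \<in> borel_measurable circle_measure"
  and laplacian_symbol_powr_measurable: "(\<lambda>\<theta>. laplacian_symbol \<theta> powr r) \<in> borel_measurable circle_measure"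
proof -
  have [measurable]: "laplacian_symbol \<in> borel_measurable circle_measure"
    unfolding laplacian_symbol_def[abs_def] by (intro continuous_imp_measurable_circle continuous_intros)
  show "laplacian_multiplier r \<in> borel_measurable circle_measure"
    "(\<lambda>\<theta>. laplacian_symbol \<theta> powr r) \<in> borel_measurable circle_measure"
    unfolding laplacian_multiplier_def[abs_def] by measurable
qed

text \<open>On the interval the symbol vanishes only at 0, so the two multipliers agree off a null
  set. The change matters for \<open>r \<le> 0\<close>, where \<open>0 powr r = 0\<close> lies
  outside \<open>laplacian_range r\<close>.\<close>

lemma laplacian_Z_pow_eq: "laplacian_Z_pow r = fourier_multiplier (laplacian_multiplier r)"
  unfolding laplacian_Z_pow_def
proof (rule fourier_multiplier_cong_AE[OF laplacian_symbol_powr_measurable laplacian_multiplier_measurable])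
  have "AE \<theta> in lborel. \<theta> \<noteq> (0::real)" by (rule AE_lborel_singleton)
  then have "AE \<theta> in circle_measure. \<theta> \<noteq> 0" by (subst AE_restrict_space_iff) auto
  then show "AE \<theta> in circle_measure. laplacian_symbol \<theta> powr r = laplacian_multiplier r \<theta>"
    using AE_circle_interior
  proof eventually_elim
    case (elim \<theta>)
    have "laplacian_symbol \<theta> \<noteq> 0"
    proof
      assume "laplacian_symbol \<theta> = 0"
      then have "cis \<theta> = cis 0"
        using sin_cos_squared_add[of \<theta>] by (simp add: laplacian_symbol_def complex_eq_iff)
      then have "\<theta> = 0" using elim pi_gt_zero by (intro cis_inj_open) auto
      then show False using elim by simp
    qed
    then show ?case by (simp add: laplacian_multiplier_def)
  qed
qed

lemma laplacian_multiplier_range: "laplacian_multiplier r \<theta> \<in> laplacian_range r"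
proof -
  have "0 \<le> laplacian_symbol \<theta>" "laplacian_symbol \<theta> \<le> 4"
    using cos_le_one[of \<theta>] cos_ge_minus_one[of \<theta>] unfolding laplacian_symbol_def by linarith+
  then show ?thesis
    by (auto simp: laplacian_range_def laplacian_multiplier_def intro: powr_mono2 powr_mono2')
qed

text \<open>For \<open>r \<noteq> 0\<close> the map \<open>s powr r\<close> is inverted at a point
  t' close to t, moved off the boundary of the range so that s lies strictly between 0 and 4. There
  the symbol is positive and attained at an interior angle.\<close>

lemma laplacian_range_approx:
  assumes "t \<in> laplacian_range r" "0 < \<epsilon>"
  obtains s where "0 < s" "s < 4" "\<bar>s powr r - t\<bar> < \<epsilon>"
proof (cases "r = 0")
  case True
  then show thesis using that[of 1] assms by (simp add: laplacian_range_def)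
next
  case False
  define c where "c = 4 powr r"
  have c: "0 < c" by (simp add: c_def)
  have inv: "c powr (1 / r) = 4" using False by (simp add: c_def powr_powr)
  have "\<exists>t'. 0 < t' \<and> \<bar>t' - t\<bar> < \<epsilon> \<and> t' powr (1 / r) < 4"
  proof (cases "0 < r")
    case True
    then have t: "0 \<le> t" "t \<le> c" using assms(1) by (auto simp: laplacian_range_def c_def)
    \<comment> \<open>From t below c the point moves up by at most half of the remaining distance;
      from the right end point t = c it moves down by at most half of c.\<close>
    define t' where "t' = (if t < c then t + min (\<epsilon> / 2) ((c - t) / 2) else c - min (\<epsilon> / 2) (c / 2))"
    have t': "0 < t'" "t' < c" "\<bar>t' - t\<bar> < \<epsilon>"
      using t c \<open>0 < \<epsilon>\<close> by (auto simp: t'_def min_def field_simps)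
    have "t' powr (1 / r) < c powr (1 / r)"
      using True t' by (intro powr_less_mono2) auto
    then show ?thesis using t' inv by auto
  next
    case False
    then have "r < 0" using \<open>r \<noteq> 0\<close> by simp
    then have t: "c \<le> t" using assms(1) by (auto simp: laplacian_range_def c_def)
    \<comment> \<open>A negative exponent reverses the order, so moving t upwards makes s smaller
      than 4.\<close>
    have "(t + \<epsilon> / 2) powr (1 / r) < c powr (1 / r)"
      using \<open>r < 0\<close> t c \<open>0 < \<epsilon>\<close> by (intro powr_less_mono2_neg) auto
    then show ?thesis using t c inv \<open>0 < \<epsilon>\<close> by (intro exI[of _ "t + \<epsilon> / 2"]) auto
  qed
  then obtain t' where "0 < t'" "\<bar>t' - t\<bar> < \<epsilon>" "t' powr (1 / r) < 4" by blast
  then show thesis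
    using that[of "t' powr (1 / r)"] False by (simp add: powr_powr)
qed

text \<open>The angle \<eta> solves 2 - 2 cos \<eta> = s and lies strictly between 0 and pi because
  0 < s < 4. The multiplier is continuous there, so it stays within \<epsilon> of t on an interval
  of positive length around \<eta>.\<close>

lemma laplacian_multiplier_essential:
  assumes "t \<in> laplacian_range r" "0 < \<epsilon>"
  shows "emeasure circle_measure {\<theta> \<in> space circle_measure. \<bar>laplacian_multiplier r \<theta> - t\<bar> < \<epsilon>} > 0"
proof -
  obtain s where s: "0 < s" "s < 4" "\<bar>s powr r - t\<bar> < \<epsilon>"
    using laplacian_range_approx[OF assms] .
  define \<eta> where "\<eta> = arccos (1 - s / 2)"
  have \<eta>: "0 < \<eta>" "\<eta> < pi"
    using arccos_lt_bounded[of "1 - s / 2"] s by (auto simp: \<eta>_def)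
  have sym: "laplacian_symbol \<eta> = s"
    using s by (simp add: laplacian_symbol_def \<eta>_def)
  have lim_sym: "(laplacian_symbol \<longlongrightarrow> s) (nhds \<eta>)"
    unfolding sym[symmetric] laplacian_symbol_def[abs_def]
    by (intro tendsto_intros filterlim_ident)
  then have "((\<lambda>\<theta>. \<bar>laplacian_symbol \<theta> powr r - t\<bar>) \<longlongrightarrow> \<bar>s powr r - t\<bar>) (nhds \<eta>)"
    using s by (intro tendsto_intros) auto
  then have "\<forall>\<^sub>F \<theta> in nhds \<eta>. \<bar>laplacian_symbol \<theta> powr r - t\<bar> < \<epsilon>"
    using s(3) by (rule order_tendstoD(2))
  moreover have "\<forall>\<^sub>F \<theta> in nhds \<eta>. 0 < laplacian_symbol \<theta>"
    using lim_sym s(1) by (rule order_tendstoD(1))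
  moreover have "\<forall>\<^sub>F \<theta> in nhds \<eta>. \<theta> \<in> {0<..<pi}"
    using \<eta> by (intro eventually_nhds_in_open) auto
  ultimately have "\<forall>\<^sub>F \<theta> in nhds \<eta>. \<theta> \<in> {0<..<pi} \<and> \<bar>laplacian_multiplier r \<theta> - t\<bar> < \<epsilon>"
    by eventually_elim (auto simp: laplacian_multiplier_def)
  then obtain d where d: "0 < d" "\<And>\<theta>. dist \<theta> \<eta> < d \<Longrightarrow> \<theta> \<in> {0<..<pi} \<and> \<bar>laplacian_multiplier r \<theta> - t\<bar> < \<epsilon>"
    unfolding eventually_nhds_metric by blast
  have sub: "\<theta> \<in> {0<..<pi} \<and> \<bar>laplacian_multiplier r \<theta> - t\<bar> < \<epsilon>" if "\<theta> \<in> {\<eta> - d<..<\<eta> + d}" for \<theta>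
    using that by (intro d) (auto simp: dist_real_def)
  have "0 < emeasure lborel {\<eta> - d<..<\<eta> + d}"
    using d(1) by simp
  also have "\<dots> = emeasure circle_measure {\<eta> - d<..<\<eta> + d}"
    using sub by (intro emeasure_restrict_space[symmetric]) fastforce+
  also have "\<dots> \<le> emeasure circle_measure {\<theta> \<in> space circle_measure. \<bar>laplacian_multiplier r \<theta> - t\<bar> < \<epsilon>}"
  proof (rule emeasure_mono)
    show "{\<eta> - d<..<\<eta> + d} \<subseteq> {\<theta> \<in> space circle_measure. \<bar>laplacian_multiplier r \<theta> - t\<bar> < \<epsilon>}"
      using sub by (fastforce simp: space_restrict_space)
    have [measurable]: "laplacian_multiplier r \<in> borel_measurable circle_measure"
      by (rule laplacian_multiplier_measurable)
    show "{\<theta> \<in> space circle_measure. \<bar>laplacian_multiplier r \<theta> - t\<bar> < \<epsilon>} \<in> sets circle_measure"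
      by measurable
  qed
  finally show ?thesis .
qed

lemma closed_laplacian_range: "closed (laplacian_range r)"
  by (simp add: laplacian_range_def)

lemma laplacian_range_nonneg: "laplacian_range r \<subseteq> {0..}"
  by (auto simp: laplacian_range_def intro: order_trans[OF powr_ge_zero])

lemma spectrum_laplacian_Z_pow: "spectrum (laplacian_Z_pow r) = complex_of_real ` laplacian_range r"
  unfolding laplacian_Z_pow_eq
  by (rule spectrum_fourier_multiplier)
    (rule laplacian_multiplier_measurable closed_laplacian_range laplacian_multiplier_range
      laplacian_multiplier_essential; assumption?)+

lemma spectrum_laplacian_Zd_pow:
  fixes r :: "real ^ 'n"
  shows "spectrum (laplacian_Zd_pow r) = complex_of_real ` {\<Sum>j\<in>UNIV. l j | l. \<forall>j. l j \<in> laplacian_range (r $ j)}"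
proof -
  interpret multiplier_family "\<lambda>j. laplacian_multiplier (r $ j)"
    by unfold_locales (rule laplacian_multiplier_measurable)
  show ?thesis
    unfolding laplacian_Zd_pow_def laplacian_Z_pow_eq
    by (rule spectrum_tensor_sum)
      (rule laplacian_multiplier_range laplacian_multiplier_essential closed_sumset_nonneg
        closed_laplacian_range laplacian_range_nonneg; assumption?)+
qed

lemma sumset_Icc:
  fixes c :: "'n::finite \<Rightarrow> real"
  assumes c: "\<And>j. 0 < c j"
  shows "{\<Sum>j\<in>UNIV. l j | l. \<forall>j. l j \<in> {0..c j}} = {0..\<Sum>j\<in>UNIV. c j}"
proof (intro equalityI subsetI)
  fix t assume t: "t \<in> {0..\<Sum>j\<in>UNIV. c j}"
  define C where "C = (\<Sum>j\<in>UNIV. c j)"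
  have C: "0 < C" unfolding C_def using c by (intro sum_pos) auto
  have "0 \<le> t / C" "t / C \<le> 1" using t C by (auto simp: C_def)
  \<comment> \<open>The total t is distributed over the coordinates in proportion to the lengths
    \<open>c j\<close>.\<close>
  then have "t / C * c j \<in> {0..c j}" for j
    using c[of j] mult_right_mono[of "t / C" 1 "c j"] mult_nonneg_nonneg[of "t / C" "c j"] by auto
  moreover have "t = (\<Sum>j\<in>UNIV. t / C * c j)"
    using C unfolding sum_distrib_left[symmetric] C_def[symmetric] by simp
  ultimately show "t \<in> {\<Sum>j\<in>UNIV. l j | l. \<forall>j. l j \<in> {0..c j}}" by blast
qed (auto intro: sum_nonneg sum_mono)

theorem proposition2p10:
  fixes r :: "real ^ 'n"
  shows "spectrum (laplacian_Zd_pow r) =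
           {\<Sum>j\<in>UNIV. l j | l. \<forall>j. l j \<in> spectrum (laplacian_Z_pow (r $ j))}
       \<and> ((\<forall>j. r $ j > 0) \<longrightarrow>
           spectrum (laplacian_Zd_pow r) =
             complex_of_real ` {0..\<Sum>j\<in>UNIV. 2 powr (2 * r $ j)})"
proof (intro conjI impI)
  have "complex_of_real ` {\<Sum>j\<in>UNIV. l j | l. \<forall>j. l j \<in> S j}
      = {\<Sum>j\<in>UNIV. l j | l. \<forall>j. l j \<in> complex_of_real ` S j}" for S :: "'n \<Rightarrow> real set"
  proof (intro equalityI subsetI)
    fix z assume "z \<in> complex_of_real ` {\<Sum>j\<in>UNIV. l j | l. \<forall>j. l j \<in> S j}"
    then obtain l where "\<forall>j. l j \<in> S j" "z = (\<Sum>j\<in>UNIV. complex_of_real (l j))" by auto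
    then show "z \<in> {\<Sum>j\<in>UNIV. l j | l. \<forall>j. l j \<in> complex_of_real ` S j}" by blast
  next
    fix z assume "z \<in> {\<Sum>j\<in>UNIV. l j | l. \<forall>j. l j \<in> complex_of_real ` S j}"
    then obtain l where l: "\<forall>j. l j \<in> complex_of_real ` S j" "z = (\<Sum>j\<in>UNIV. l j)" by blast
    \<comment> \<open>All points of the given spectra are real, so the complex family is recovered
      from its real parts.\<close>
    have "Re (l j) \<in> S j \<and> l j = complex_of_real (Re (l j))" for j
      using l(1)[rule_format, of j] by auto
    then have "\<forall>j. Re (l j) \<in> S j" "z = complex_of_real (\<Sum>j\<in>UNIV. Re (l j))"
      unfolding l(2) of_real_sum by (blast, intro sum.cong) simp_all
    then show "z \<in> complex_of_real ` {\<Sum>j\<in>UNIV. l j | l. \<forall>j. l j \<in> S j}" by blast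
  qed
  then show "spectrum (laplacian_Zd_pow r) =
      {\<Sum>j\<in>UNIV. l j | l. \<forall>j. l j \<in> spectrum (laplacian_Z_pow (r $ j))}"
    by (simp only: spectrum_laplacian_Zd_pow spectrum_laplacian_Z_pow)
next
  assume r: "\<forall>j. r $ j > 0"
  have "(4::real) powr (r $ j) = 2 powr (2 * r $ j)" for j
    by (simp add: powr_powr[symmetric])
  then have "laplacian_range (r $ j) = {0..2 powr (2 * r $ j)}" for j
    using r by (simp add: laplacian_range_def)
  then show "spectrum (laplacian_Zd_pow r) = complex_of_real ` {0..\<Sum>j\<in>UNIV. 2 powr (2 * r $ j)}"
    unfolding spectrum_laplacian_Zd_pow by (simp only:) (subst sumset_Icc; simp)
qed

end
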